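(* Let $n\ge p$, and let $X$ ($m\times p$) and $S$ ($p\times p$) be independent with $X\sim \mathcal N_{m\times p}(\Theta, I_m\otimes\Sigma)$ and $S\sim\mathcal W_p(n,\Sigma)$. Assume $m\ge p$. Let $c=n-m-1$ and $k_0=(a+m+2p-n)/(a+m+2p)$, let $\widehat\Sigma_0=n^{-1}S$, and consider the closed-form generalized Bayes estimators $$\widehat\Theta^{GB}=X-k_0X\{I_p+(1-k_0)S^{-1}X^\top X\}^{-1},\qquad \widehat\Sigma^{GB}=\widehat\Sigma_0-k_0\widehat\Sigma_0\{I_p+(1-k_0)S^{-1}X^\top X\}^{-1}.$$ Then $(\widehat\Theta^{GB},\widehat\Sigma^{GB})$ dominates $(X,\widehat\Sigma_0)$ relative to the Kullback-Leibler divergence if $a$ satisfies $n-m-p-1<a$ and $$a\le -m-2p+n\Big(1+2\,\frac{m-p-1+m/n}{n+m/2+p+1}\Big)=:a_{upp}.$$ Moreover, there exists an $a$ satisfying these conditions if $m>(3p+1)/2$ and $n>(2p^2+mp-5m-1)/(2(2m-3p-1))$.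
   Context: $\mathcal N_{m\times p}(M,A\otimes\Sigma)$ denotes the matrix normal distribution with density proportional to $\exp[-\tfrac12\mathrm{tr}\{A^{-1}(X-M)\Sigma^{-1}(X-M)^\top\}]$; $\phi(\cdot\mid\Theta,\Sigma)$ is the density of $\mathcal N_{m\times p}(\Theta,I_m\otimes\Sigma)$; $\mathcal W_p(n,\Sigma)$ is the Wishart distribution with $n$ degrees of freedom and scale matrix $\Sigma$ ($p\times p$ positive definite). Both $\Theta$ and $\Sigma$ are unknown. The estimators displayed in the claim are those the paper obtains as generalized Bayes estimators for the hierarchical prior $\Theta\mid\Sigma,\Omega\sim\mathcal N_{m\times p}(0,\Omega\otimes\Sigma)$, $\pi(\Omega)\propto|I_m+\Omega|^{-a/2-m}|\Omega|^{c/2}$ ($\Omega$ positive definite $m\times m$), $\pi(\Sigma^{-1})\propto|\Sigma^{-1}|^{(b-1)/2}$ with $b=a+p-n$; for the present claim they are defined by the displayed formulas. The Kullback-Leibler loss of $(\widehat\Theta,\widehat\Sigma)$ is $$D_{KL}=\int\log\frac{\phi(Y\mid\widehat\Theta,\widehat\Sigma)}{\phi(Y\mid\Theta,\Sigma)}\,\phi(Y\mid\widehat\Theta,\widehat\Sigma)\,dY=\frac m2\{\mathrm{tr}(\widehat\Sigma\Sigma^{-1})-\log|\widehat\Sigma\Sigma^{-1}|-p\}+\frac12\mathrm{tr}\{(\widehat\Theta-\Theta)\Sigma^{-1}(\widehat\Theta-\Theta)^\top\},$$ and the risk is its expectation over $(X,S)$. One estimator dominates another if its risk is at most that of the other for all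 $(\Theta,\Sigma)$ with strict inequality for some $(\Theta,\Sigma)$. *)

theory Defs
  imports "HOL-Analysis.Analysis"
begin

definition pos_def :: "real ^ 'n ^ 'n \<Rightarrow> bool" where
  "pos_def A \<longleftrightarrow> transpose A = A \<and> (\<forall>x. x \<noteq> 0 \<longrightarrow> 0 < x \<bullet> (A *v x))"

text \<open>
  Density with respect to Lebesgue measure on the space of \<open>m \<times> p\<close> matrices
  (type \<^typ>\<open>real ^ 'p ^ 'm\<close>: the outer index numbers rows) of the matrix normal
  distribution with mean \<open>M\<close> and covariance \<open>A \<otimes> \<Sigma>\<close>.
\<close>

definition matrix_normal_density ::
    "real ^ 'p ^ 'm \<Rightarrow> real ^ 'm ^ 'm \<Rightarrow> real ^ 'p ^ 'p \<Rightarrow> real ^ 'p ^ 'm \<Rightarrow> real" where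
  "matrix_normal_density M A \<Sigma> X =
     (2 * pi) powr (- (real CARD('m) * real CARD('p) / 2))
     * det A powr (- (real CARD('p) / 2)) * det \<Sigma> powr (- (real CARD('m) / 2))
     * exp (- (1 / 2) * trace (matrix_inv A ** (X - M) ** matrix_inv \<Sigma> ** transpose (X - M)))"

definition matrix_normal ::
    "real ^ 'p ^ 'm \<Rightarrow> real ^ 'm ^ 'm \<Rightarrow> real ^ 'p ^ 'p \<Rightarrow> (real ^ 'p ^ 'm) measure" where
  "matrix_normal M A \<Sigma> = density lborel (\<lambda>X. ennreal (matrix_normal_density M A \<Sigma> X))"

definition phi :: "real ^ 'p ^ 'm \<Rightarrow> real ^ 'p ^ 'm \<Rightarrow> real ^ 'p ^ 'p \<Rightarrow> real" where
  "phi Y \<Theta> \<Sigma> = matrix_normal_density \<Theta> (mat 1) \<Sigma> Y"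

text \<open>
  The Wishart distribution with an integer number \<open>n\<close> of degrees of freedom is the law of
  \<open>\<Sum>i<n. z\<^sub>i\<^sup>T z\<^sub>i\<close> for independent normal row vectors \<open>z\<^sub>i\<close> with mean \<open>0\<close> and covariance
  \<open>\<Sigma>\<close>; row vectors are \<open>1 \<times> p\<close> matrices.
\<close>

definition wishart :: "nat \<Rightarrow> real ^ 'p ^ 'p \<Rightarrow> (real ^ 'p ^ 'p) measure" where
  "wishart n \<Sigma> =
     distr (\<Pi>\<^sub>M i\<in>{..<n}. matrix_normal (0 :: real ^ 'p ^ 1) (mat 1) \<Sigma>) borel
       (\<lambda>z. \<Sum>i<n. transpose (z i) ** z i)"

definition KL_loss ::
    "(real ^ 'p ^ 'm) \<times> (real ^ 'p ^ 'p) \<Rightarrow> real ^ 'p ^ 'm \<Rightarrow> real ^ 'p ^ 'p \<Rightarrow> real" where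
  "KL_loss est \<Theta> \<Sigma> = (case est of (\<Theta>h, \<Sigma>h) \<Rightarrow>
     (LBINT Y. ln (phi Y \<Theta>h \<Sigma>h / phi Y \<Theta> \<Sigma>) * phi Y \<Theta>h \<Sigma>h))"

text \<open>
  An estimator maps the observed \<open>(X, S)\<close> to an estimate of \<open>(\<Theta>, \<Sigma>)\<close>.  As a
  Kullback-Leibler divergence the loss is nonnegative whenever the estimate of \<open>\<Sigma>\<close> is
  positive definite, so its expectation is taken in \<open>[0, \<infinity>]\<close>; in this way an infinite risk
  is not identified with \<open>0\<close>.
\<close>

type_synonym ('m, 'p) estimator =
  "real ^ 'p ^ 'm \<Rightarrow> real ^ 'p ^ 'p \<Rightarrow> (real ^ 'p ^ 'm) \<times> (real ^ 'p ^ 'p)"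

definition KL_risk ::
    "nat \<Rightarrow> ('m::finite, 'p::finite) estimator \<Rightarrow> real ^ 'p ^ 'm \<Rightarrow> real ^ 'p ^ 'p \<Rightarrow> ennreal" where
  "KL_risk n \<delta> \<Theta> \<Sigma> =
     (\<integral>\<^sup>+ (X, S). ennreal (KL_loss (\<delta> X S) \<Theta> \<Sigma>)
        \<partial>(matrix_normal \<Theta> (mat 1) \<Sigma> \<Otimes>\<^sub>M wishart n \<Sigma>))"

definition KL_dominates ::
    "nat \<Rightarrow> ('m::finite, 'p::finite) estimator \<Rightarrow> ('m, 'p) estimator \<Rightarrow> bool" where
  "KL_dominates n \<delta>\<^sub>1 \<delta>\<^sub>2 \<longleftrightarrow>
     (\<forall>\<Theta> \<Sigma>. pos_def \<Sigma> \<longrightarrow> KL_risk n \<delta>\<^sub>1 \<Theta> \<Sigma> \<le> KL_risk n \<delta>\<^sub>2 \<Theta> \<Sigma>) \<and>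
     (\<exists>\<Theta> \<Sigma>. pos_def \<Sigma> \<and> KL_risk n \<delta>\<^sub>1 \<Theta> \<Sigma> < KL_risk n \<delta>\<^sub>2 \<Theta> \<Sigma>)"

definition Sigma_hat_0 :: "nat \<Rightarrow> real ^ 'p ^ 'p \<Rightarrow> real ^ 'p ^ 'p" where
  "Sigma_hat_0 n S = (1 / real n) *\<^sub>R S"

definition k0 :: "nat \<Rightarrow> nat \<Rightarrow> nat \<Rightarrow> real \<Rightarrow> real" where
  "k0 m p n a = (a + real m + 2 * real p - real n) / (a + real m + 2 * real p)"

definition Theta_hat_GB :: "nat \<Rightarrow> real \<Rightarrow> real ^ 'p ^ 'm \<Rightarrow> real ^ 'p ^ 'p \<Rightarrow> real ^ 'p ^ 'm" where
  "Theta_hat_GB n a X S = (let k = k0 CARD('m) CARD('p) n a in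
     X - k *\<^sub>R (X ** matrix_inv (mat 1 + (1 - k) *\<^sub>R (matrix_inv S ** transpose X ** X))))"

definition Sigma_hat_GB :: "nat \<Rightarrow> real \<Rightarrow> real ^ 'p ^ 'm \<Rightarrow> real ^ 'p ^ 'p \<Rightarrow> real ^ 'p ^ 'p" where
  "Sigma_hat_GB n a X S = (let k = k0 CARD('m) CARD('p) n a in
     Sigma_hat_0 n S
     - k *\<^sub>R (Sigma_hat_0 n S
        ** matrix_inv (mat 1 + (1 - k) *\<^sub>R (matrix_inv S ** transpose X ** X))))"

definition a_upp :: "nat \<Rightarrow> nat \<Rightarrow> nat \<Rightarrow> real" where
  "a_upp m p n =
     - real m - 2 * real p
     + real n * (1 + 2 * ((real m - real p - 1 + real m / real n)
                          / (real n + real m / 2 + real p + 1)))"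

end

theory Submission
  imports Defs "HOL-Probability.Probability"
begin


text \<open>
  Let \<open>k = k0\<close>, \<open>r = 1 - k\<close>, \<open>d = a + m + 2 p - n\<close>, \<open>W = X\<^sup>T X\<close> and \<open>U = (S + r W)\<^sup>-\<^sup>1 S\<close>.  Then
  \<open>k = d / (n + d)\<close>, and the generalized Bayes estimators are \<open>X - k X U\<close> and \<open>(S - k S U) / n\<close>.  The
  Kullback-Leibler loss has a closed form (\<open>KL_loss_eq\<close>), and the difference of the losses of the two estimators
  is a linear combination of \<open>tr (\<Sigma>\<^sup>-\<^sup>1 S U)\<close>, \<open>tr (\<Sigma>\<^sup>-\<^sup>1 S U\<^sup>2)\<close>, \<open>tr ((X - \<Theta>) \<Sigma>\<^sup>-\<^sup>1 (X U)\<^sup>T)\<close> and \<open>ln det (1 - k U)\<close>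
  (\<open>loss_difference\<close>).

  Integration by parts removes the unknown parameters.  The matrix \<open>X\<close> is Gaussian, and \<open>S\<close> is the sum of
  \<open>z\<^sup>T z\<close> over \<open>n\<close> Gaussian rows \<open>z\<close>, so the first three terms are made of expressions
  \<open>((Y - M) \<Sigma>\<^sup>-\<^sup>1) \<bullet> (Y U\<^sup>q)\<close>, in which \<open>Y\<close> is \<open>X\<close> or one of the rows, \<open>M\<close> is its mean and \<open>q\<close> is \<open>1\<close> or \<open>2\<close>.
  By the identity of Stein the expectation of such an expression is that of the divergence of the field
  \<open>Y \<mapsto> Y U\<^sup>q\<close>.  With \<open>t\<^sub>q = tr U\<^sup>q\<close> the results are (\<open>expectation_scatter_U\<close>, \<open>expectation_scatter_U2\<close>,
  \<open>expectation_X\<close>)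
  \<^item> \<open>E tr (\<Sigma>\<^sup>-\<^sup>1 S U) = E ((n + p + 1) t\<^sub>1 - t\<^sub>2 - t\<^sub>1\<^sup>2)\<close>,
  \<^item> \<open>E tr (\<Sigma>\<^sup>-\<^sup>1 S U\<^sup>2) = E ((n + p + 2) t\<^sub>2 + t\<^sub>1\<^sup>2 - 2 t\<^sub>3 - 2 t\<^sub>1 t\<^sub>2)\<close>,
  \<^item> \<open>E tr ((X - \<Theta>) \<Sigma>\<^sup>-\<^sup>1 (X U)\<^sup>T) = E ((m - p - 1) t\<^sub>1 + t\<^sub>2 + t\<^sub>1\<^sup>2)\<close>.

  The assumptions \<open>p \<le> m\<close> and \<open>p \<le> n\<close> make \<open>W\<close> and \<open>S\<close> almost surely positive definite, so that
  \<open>S + r W\<close> is bounded from below by a fixed positive definite matrix when only \<open>X\<close>, or only one row \<open>z\<close>, varies.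

  It remains to see that the resulting function of the eigenvalues \<open>g \<in> (0, 1]\<close> of \<open>U\<close> is positive under the
  bounds on \<open>a\<close>; this is \<open>risk_difference_pos\<close>, proved by a sharp estimate of \<open>ln (1 - k g)\<close> and elementary inequalities
  between power sums.  The improvement is thus strict in expectation at every parameter.  To conclude for
  risks with values in \<open>[0, \<infinity>]\<close>, the risk of \<open>(X, S / n)\<close> has to be finite at some parameter, which amounts to
  \<open>E (- ln det S) < \<infinity>\<close>.  This follows from the finiteness of \<open>E \<bar>det Z\<bar>\<^sup>-\<^sup>1\<^sup>/\<^sup>2\<close> for a square Gaussian matrix \<open>Z\<close>
  (\<open>nn_integral_inv_sqrt_det_finite\<close>).
\<close>

section \<open>Quadratic forms and simultaneous diagonalization\<close>

interpretation mmul: bounded_bilinear "(**) :: real^'n^'m \<Rightarrow> real^'p^'n \<Rightarrow> real^'p^'m"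
proof -
  have "bilinear ((**) :: real^'n^'m \<Rightarrow> real^'p^'n \<Rightarrow> real^'p^'m)"
    by (auto simp: bilinear_def linear_iff matrix_matrix_mult_def vec_eq_iff sum.distrib
        algebra_simps sum_distrib_left)
  then show "bounded_bilinear ((**) :: real^'n^'m \<Rightarrow> real^'p^'n \<Rightarrow> real^'p^'m)"
    by (simp add: bilinear_conv_bounded_bilinear)
qed

lemma bounded_linear_trace: "bounded_linear (trace :: real^'n^'n \<Rightarrow> real)"
  by (rule linear_conv_bounded_linear[THEN iffD1])
     (auto simp: linear_iff trace_def sum.distrib sum_distrib_left)

lemma bounded_linear_transpose: "bounded_linear (transpose :: real^'n^'m \<Rightarrow> real^'m^'n)"
  by (rule linear_conv_bounded_linear[THEN iffD1])
     (auto simp: linear_iff transpose_def vec_eq_iff)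

lemmas trace_linear =
  linear_add[OF bounded_linear.linear[OF bounded_linear_trace]]
  linear_diff[OF bounded_linear.linear[OF bounded_linear_trace]]
  linear_cmul[OF bounded_linear.linear[OF bounded_linear_trace]]

lemmas transpose_linear =
  linear_add[OF bounded_linear.linear[OF bounded_linear_transpose]]
  linear_diff[OF bounded_linear.linear[OF bounded_linear_transpose]]
  linear_cmul[OF bounded_linear.linear[OF bounded_linear_transpose]]

lemmas mat_linear = mmul.add_left mmul.add_right mmul.diff_left mmul.diff_right
  mmul.scaleR_left mmul.scaleR_right mmul.minus_left mmul.minus_right
  trace_linear transpose_linear

lemma inner_eq_trace:
  fixes A B :: "real^'n^'m"
  shows "A \<bullet> B = trace (transpose A ** B)"
  unfolding inner_vec_def trace_def matrix_matrix_mult_def transpose_def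
  by (simp, subst sum.swap, simp)

lemma inner_transpose_left:
  fixes A :: "real^'n^'m"
  shows "(transpose A *v x) \<bullet> y = x \<bullet> (A *v y)"
  by (metis dot_lmul_matrix vector_transpose_matrix transpose_transpose)

definition diag :: "real^'n \<Rightarrow> real^'n^'n" where
  "diag d = (\<chi> i j. if i = j then d $ i else 0)"

lemma diag_mult: "diag a ** diag b = diag (a * b)"
proof -
  have "(\<Sum>k\<in>UNIV. diag a $ i $ k * diag b $ k $ j) = diag (a * b) $ i $ j" for i j
  proof -
    have "(\<Sum>k\<in>UNIV. diag a $ i $ k * diag b $ k $ j)
        = (\<Sum>k\<in>UNIV. if k = i then diag (a * b) $ i $ j else 0)"
      by (intro sum.cong) (auto simp: diag_def)
    then show ?thesis by simp
  qed
  then show ?thesis by (simp add: matrix_matrix_mult_def vec_eq_iff)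
qed

lemma trace_diag: "trace (diag d) = (\<Sum>i\<in>UNIV. d $ i)"
  by (simp add: trace_def diag_def)

lemma det_diag: "det (diag d) = (\<Prod>i\<in>UNIV. d $ i)"
  by (simp add: diag_def det_diagonal)

lemma transpose_diag: "transpose (diag d) = diag d"
  by (auto simp: transpose_def diag_def vec_eq_iff)

lemma diag_linear: "diag (a + b) = diag a + diag b" "diag (a - b) = diag a - diag b"
   "diag (c *\<^sub>R a) = c *\<^sub>R diag a" "mat 1 = diag 1"
  by (auto simp: diag_def mat_def vec_eq_iff)

lemma inner_diag: "x \<bullet> (diag d *v x) = (\<Sum>i\<in>UNIV. d $ i * (x $ i)\<^sup>2)"
proof -
  have "(\<Sum>k\<in>UNIV. diag d $ i $ k * x $ k) = d $ i * x $ i" for i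
  proof -
    have "(\<Sum>k\<in>UNIV. diag d $ i $ k * x $ k) = (\<Sum>k\<in>UNIV. if k = i then d $ i * x $ i else 0)"
      by (intro sum.cong) (auto simp: diag_def)
    then show ?thesis by simp
  qed
  then show ?thesis
    by (auto simp: inner_vec_def matrix_vector_mult_def power2_eq_square mult_ac intro!: sum.cong)
qed

lemma inner_diag_axis: "axis j 1 \<bullet> (diag d *v axis j 1) = d $ j"
proof -
  have "(\<Sum>i\<in>UNIV. d $ i * (axis j (1::real) $ i)\<^sup>2) = (\<Sum>i\<in>UNIV. if i = j then d $ j else 0)"
    by (intro sum.cong) (auto simp: axis_def)
  then show ?thesis by (simp add: inner_diag)
qed

lemma pos_def_sym: "pos_def A \<Longrightarrow> transpose A = A"
  by (simp add: pos_def_def)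

lemma pos_def_lower_bound:
  fixes A :: "real^'n^'n"
  assumes "pos_def A"
  obtains c where "c > 0" "\<And>x. c * (norm x)\<^sup>2 \<le> x \<bullet> (A *v x)"
proof -
  obtain e :: "real^'n" where "norm e = 1"
    using vector_choose_size[of 1] by auto
  then have ne: "sphere (0::real^'n) 1 \<noteq> {}" by auto
  have "continuous_on (sphere 0 1) (\<lambda>x. x \<bullet> (A *v x))"
    by (intro continuous_intros linear_continuous_on) (simp add: linear_linear)
  then obtain z where z: "z \<in> sphere 0 1" "\<And>x. x \<in> sphere 0 1 \<Longrightarrow> z \<bullet> (A *v z) \<le> x \<bullet> (A *v x)"
    using continuous_attains_inf[OF compact_sphere ne] by meson
  show ?thesis
  proof
    show "z \<bullet> (A *v z) > 0" using z(1) assms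
      by (metis norm_zero pos_def_def mem_sphere_0 zero_neq_one)
    fix x :: "real^'n"
    show "z \<bullet> (A *v z) * (norm x)\<^sup>2 \<le> x \<bullet> (A *v x)"
    proof (cases "x = 0")
      case False
      have "z \<bullet> (A *v z) \<le> (x /\<^sub>R norm x) \<bullet> (A *v (x /\<^sub>R norm x))"
        by (rule z(2)) (use False in simp)
      also have "\<dots> = (x \<bullet> (A *v x)) / (norm x)\<^sup>2"
        by (simp add: matrix_vector_mult_scaleR power2_eq_square divide_simps)
      finally show ?thesis using False by (simp add: field_simps)
    qed simp
  qed
qed

text \<open>
  First order condition at a maximum: the quadratic polynomial \<open>2 t a + t\<^sup>2 b\<close> vanishes at \<open>0\<close>
  and is nowhere positive, so its derivative \<open>2 a\<close> at \<open>0\<close> vanishes.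
\<close>

lemma quadratic_nonpos_imp_linear_zero:
  fixes a b :: real
  assumes "\<And>t. 2 * t * a + t\<^sup>2 * b \<le> 0"
  shows "a = 0"
proof (rule ccontr)
  assume a: "a \<noteq> 0"
\<comment> \<open>the step has the sign of \<open>a\<close> and is short enough for the linear term to win\<close>
  define t where "t = a / (1 + \<bar>b\<bar>)"
  have "2 * t * a + t\<^sup>2 * b = a\<^sup>2 * (2 * (1 + \<bar>b\<bar>) + b) / (1 + \<bar>b\<bar>)\<^sup>2"
    unfolding t_def by (simp add: divide_simps power2_eq_square) (simp add: algebra_simps)
  moreover have "\<dots> > 0" using a by (intro divide_pos_pos mult_pos_pos) auto
  ultimately show False using assms[of t] by simp
qed

text \<open>
  The Rayleigh quotient argument for the pencil \<open>(S, W)\<close>.  Given some \<open>S\<close>-orthonormal eigenvectors,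
  \<open>x \<bullet> W x\<close> attains its maximum on the compact set of those \<open>x\<close> that are \<open>S\<close>-orthogonal to them and
  satisfy \<open>x \<bullet> S x = 1\<close>; a maximizer is a further eigenvector.  Requiring the full equation
  \<open>W v = d S v\<close>, and not only orthogonality, is what makes the induction go through.
\<close>

lemma exists_simultaneous_eigenvectors:
  fixes S W :: "real^'n^'n" and I :: "'n set"
  assumes S: "pos_def S" and W: "transpose W = W" and "finite I"
  shows "\<exists>v d. (\<forall>i\<in>I. v i \<bullet> (S *v v i) = 1) \<and> (\<forall>i\<in>I. \<forall>j\<in>I. i \<noteq> j \<longrightarrow> v i \<bullet> (S *v v j) = 0)
     \<and> (\<forall>i\<in>I. W *v v i = d i *\<^sub>R (S *v v i))"
  using \<open>finite I\<close>
proof (induction I rule: finite_induct)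
  case (insert i I)
  then obtain v d where v1: "\<And>i. i \<in> I \<Longrightarrow> v i \<bullet> (S *v v i) = 1"
    and v0: "\<And>i j. i \<in> I \<Longrightarrow> j \<in> I \<Longrightarrow> i \<noteq> j \<Longrightarrow> v i \<bullet> (S *v v j) = 0"
    and vW: "\<And>i. i \<in> I \<Longrightarrow> W *v v i = d i *\<^sub>R (S *v v i)" by metis
  have symS: "x \<bullet> (S *v y) = y \<bullet> (S *v x)" for x y
    by (metis S inner_commute inner_transpose_left pos_def_sym)
  have symW: "x \<bullet> (W *v y) = y \<bullet> (W *v x)" for x y
    by (metis W inner_commute inner_transpose_left)
  define V where "V = {y. \<forall>j\<in>I. y \<bullet> (S *v v j) = 0}"
  have "dim (span ((\<lambda>j. S *v v j) ` I)) < DIM(real^'n)"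
  proof -
    have "dim (span ((\<lambda>j. S *v v j) ` I)) \<le> card ((\<lambda>j. S *v v j) ` I)"
      using insert.hyps by (intro dim_le_card) auto
    also have "\<dots> \<le> card I" using insert.hyps by (intro card_image_le) auto
    also have "\<dots> < card (insert i I)" using insert.hyps by simp
    also have "\<dots> \<le> CARD('n)" by (intro card_mono) auto
    finally show ?thesis by simp
  qed
  then obtain x0 where x0: "x0 \<noteq> 0" "\<And>y. y \<in> span (span ((\<lambda>j. S *v v j) ` I)) \<Longrightarrow> orthogonal x0 y"
    using orthogonal_to_subspace_exists by blast
  then have x0V: "x0 \<in> V"
    unfolding V_def by (auto simp: orthogonal_def span_span intro: span_base)
  have scV: "c *\<^sub>R y \<in> V" if "y \<in> V" for c y using that by (auto simp: V_def)
  have addV: "x + y \<in> V" if "x \<in> V" "y \<in> V" for x y using that by (auto simp: V_def inner_add_left)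
  define K where "K = V \<inter> {x. x \<bullet> (S *v x) = 1}"
  have normalise: "(1 / sqrt (y \<bullet> (S *v y))) *\<^sub>R y \<in> K" if "y \<in> V" "y \<noteq> 0" for y
  proof -
    have "y \<bullet> (S *v y) > 0" using S that by (auto simp: pos_def_def)
    then show ?thesis using that scV by (simp add: K_def matrix_vector_mult_scaleR)
  qed
  have cont: "continuous_on UNIV (\<lambda>x. A *v x)" for A :: "real^'n^'n"
    by (intro linear_continuous_on) (simp add: linear_linear)
  note contS = cont[of S] and contW = cont[of W]
  have "compact K"
    unfolding compact_eq_bounded_closed
  proof
    obtain c where c: "c > 0" "\<And>x. c * (norm x)\<^sup>2 \<le> x \<bullet> (S *v x)"
      using pos_def_lower_bound[OF S] by blast
    have "norm x \<le> sqrt (1 / c)" if "x \<in> K" for x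
      using c(2)[of x] that c(1) by (intro real_le_rsqrt) (auto simp: K_def field_simps)
    then show "bounded K" by (auto intro: boundedI)
    have "V = (\<Inter>j\<in>I. {y. y \<bullet> (S *v v j) = 0})" by (auto simp: V_def)
    then have "closed V" by (auto intro!: closed_INT closed_Collect_eq continuous_intros)
    moreover have "closed {x. x \<bullet> (S *v x) = 1}"
      using contS by (intro closed_Collect_eq continuous_intros)
    ultimately show "closed K" by (auto simp: K_def)
  qed
  moreover have "K \<noteq> {}" using normalise[OF x0V x0(1)] by auto
  moreover have "continuous_on K (\<lambda>x. x \<bullet> (W *v x))"
    by (intro continuous_intros continuous_on_subset[OF contW]) auto
  ultimately obtain x where x: "x \<in> K" "\<And>y. y \<in> K \<Longrightarrow> y \<bullet> (W *v y) \<le> x \<bullet> (W *v x)"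
    using continuous_attains_sup by metis
  define \<mu> where "\<mu> = x \<bullet> (W *v x)"
  have xV: "x \<in> V" and x1: "x \<bullet> (S *v x) = 1" using x(1) by (auto simp: K_def)
  have le: "y \<bullet> (W *v y) \<le> \<mu> * (y \<bullet> (S *v y))" if "y \<in> V" for y
  proof (cases "y = 0")
    case False
    have "y \<bullet> (S *v y) > 0" using S False by (auto simp: pos_def_def)
    then show ?thesis
      using x(2)[OF normalise[OF that False]]
      by (simp add: \<mu>_def matrix_vector_mult_scaleR field_simps)
  qed simp
  have crit: "y \<bullet> (W *v x) = \<mu> * (y \<bullet> (S *v x))" if "y \<in> V" for y
  proof -
    have "y \<bullet> (W *v x) - \<mu> * (y \<bullet> (S *v x)) = 0"
    proof (rule quadratic_nonpos_imp_linear_zero[where b="y \<bullet> (W *v y) - \<mu> * (y \<bullet> (S *v y))"])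
      fix t
      have "x + t *\<^sub>R y \<in> V" using that xV by (intro addV scV)
      from le[OF this] show "2 * t * (y \<bullet> (W *v x) - \<mu> * (y \<bullet> (S *v x)))
          + t\<^sup>2 * (y \<bullet> (W *v y) - \<mu> * (y \<bullet> (S *v y))) \<le> 0"
        using x1 symS[of x y] symW[of x y]
        by (simp add: matrix_vector_right_distrib matrix_vector_mult_scaleR inner_add_left inner_add_right
            \<mu>_def[symmetric] power2_eq_square algebra_simps)
    qed
    then show ?thesis by simp
  qed
\<comment> \<open>the criticality condition holds on \<open>V\<close>; both sides vanish on the earlier eigenvectors, and
  these span a complement of \<open>V\<close>\<close>
  have "y \<bullet> (W *v x) = y \<bullet> (\<mu> *\<^sub>R (S *v x))" for y
  proof -
    define u where "u = (\<Sum>j\<in>I. (y \<bullet> (S *v v j)) *\<^sub>R v j)"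
    have "u \<bullet> (S *v v k) = y \<bullet> (S *v v k)" if "k \<in> I" for k
    proof -
      have "u \<bullet> (S *v v k) = (\<Sum>j\<in>I. if j = k then y \<bullet> (S *v v k) else 0)"
        unfolding u_def inner_sum_left using v0 v1 that by (intro sum.cong) auto
      then show ?thesis using that insert.hyps by simp
    qed
    then have "y - u \<in> V" by (auto simp: V_def inner_diff_left)
    moreover have "u \<bullet> (W *v x) = 0" "u \<bullet> (S *v x) = 0"
      unfolding u_def inner_sum_left using xV
      by (auto intro!: sum.neutral simp: V_def symW[of _ x] symS[of _ x] vW matrix_vector_mult_scaleR)
    ultimately show ?thesis using crit[of "y - u"] by (simp add: inner_diff_left)
  qed
  then have Wx: "W *v x = \<mu> *\<^sub>R (S *v x)" by (metis vector_eq_ldot)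
  show ?case
  proof (intro exI conjI)
    show "\<forall>j\<in>insert i I. (v(i := x)) j \<bullet> (S *v (v(i := x)) j) = 1"
      using v1 x1 insert.hyps by auto
    show "\<forall>j\<in>insert i I. \<forall>k\<in>insert i I. j \<noteq> k \<longrightarrow> (v(i := x)) j \<bullet> (S *v (v(i := x)) k) = 0"
      using v0 xV insert.hyps by (auto simp: V_def symS[of _ x])
    show "\<forall>j\<in>insert i I. W *v (v(i := x)) j = (d(i := \<mu>)) j *\<^sub>R (S *v (v(i := x)) j)"
      using vW Wx insert.hyps by auto
  qed
qed auto

text \<open>
  With \<open>W = 0\<close> this is a factorization \<open>S = J\<^sup>T J\<close>, and with \<open>S = 1\<close> it is the spectral theorem for \<open>W\<close>.
\<close>

lemma simultaneous_diagonalization: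
  fixes S W :: "real^'n^'n"
  assumes S: "pos_def S" and W: "transpose W = W"
  obtains J L :: "real^'n^'n" and d where "J ** L = mat 1" "L ** J = mat 1"
    "S = transpose J ** J" "W = transpose J ** diag d ** J"
proof -
  obtain v :: "'n \<Rightarrow> real^'n" and d where vd: "(\<forall>i. v i \<bullet> (S *v v i) = 1) \<and> (\<forall>i j. i \<noteq> j \<longrightarrow> v i \<bullet> (S *v v j) = 0)
     \<and> (\<forall>i. W *v v i = d i *\<^sub>R (S *v v i))"
    using exists_simultaneous_eigenvectors[OF S W finite_class.finite_UNIV, unfolded ball_UNIV]
    by blast
  then have v1: "v i \<bullet> (S *v v i) = 1" and vW: "W *v v i = d i *\<^sub>R (S *v v i)"
    and v0: "i \<noteq> j \<Longrightarrow> v i \<bullet> (S *v v j) = 0" for i j by auto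
  define L :: "real^'n^'n" where "L = (\<chi> a i. v i $ a)"
  have form: "(transpose L ** A ** L) $ i $ j = v i \<bullet> (A *v v j)" for A i j
    unfolding L_def matrix_matrix_mult_def transpose_def inner_vec_def matrix_vector_mult_def
    by (simp add: sum_distrib_left sum_distrib_right mult_ac) (rule sum.swap)
  have LSL: "transpose L ** S ** L = mat 1"
    by (auto simp: vec_eq_iff form mat_def v0 v1)
  have LWL: "transpose L ** W ** L = diag (\<chi> i. d i)"
    by (auto simp: vec_eq_iff form diag_def v0 v1 vW)
  define J where "J = transpose L ** S"
  have JL: "J ** L = mat 1" using LSL by (simp add: J_def)
  then have LJ: "L ** J = mat 1" using matrix_left_right_inverse by blast
  have cancel: "A = transpose J ** (transpose L ** A ** L) ** J" for A
  proof -
    have "transpose J ** transpose L = mat 1"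
      using LJ by (metis matrix_transpose_mul transpose_mat)
    then show ?thesis using LJ
      by (metis matrix_mul_assoc matrix_mul_lid matrix_mul_rid)
  qed
  show ?thesis
    using that[OF JL LJ, of "\<chi> i. d i"] cancel[of S] cancel[of W]
    by (simp only: LSL LWL) (simp add: matrix_mul_rid)
qed

lemma diagonal_entry_of_congruence:
  fixes J L :: "real^'n^'n"
  assumes "J ** L = mat 1" and W: "W = transpose J ** diag d ** J"
  shows "(L *v axis j 1) \<bullet> (W *v (L *v axis j 1)) = d $ j" and "L *v axis j 1 \<noteq> 0"
proof -
  have "(L *v axis j 1) \<bullet> (W *v (L *v axis j 1))
      = (J *v (L *v axis j 1)) \<bullet> (diag d *v (J *v (L *v axis j 1)))"
    unfolding W by (metis inner_commute inner_transpose_left matrix_vector_mul_assoc)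
  then show "(L *v axis j 1) \<bullet> (W *v (L *v axis j 1)) = d $ j"
    by (simp add: matrix_vector_mul_assoc assms(1) inner_diag_axis)
  show "L *v axis j 1 \<noteq> 0"
    using assms(1) by (metis axis_eq_0_iff matrix_vector_mul_assoc matrix_vector_mul_lid
        matrix_vector_mult_0_right zero_neq_one)
qed

lemma matrix_inv_eqI:
  fixes A B :: "real^'n^'n"
  assumes "A ** B = mat 1"
  shows "matrix_inv A = B"
proof -
  have BA: "B ** A = mat 1" using assms matrix_left_right_inverse by blast
  then have "\<exists>A'. A ** A' = mat 1 \<and> A' ** A = mat 1" using assms by blast
  then have "A ** matrix_inv A = mat 1" unfolding matrix_inv_def by (rule someI2_ex) simp
  then show ?thesis using BA by (metis matrix_mul_assoc matrix_mul_lid matrix_mul_rid)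
qed

lemma pos_def_matrix_inv:
  fixes A :: "real^'n^'n"
  assumes "pos_def A"
  shows "A ** matrix_inv A = mat 1" "matrix_inv A ** A = mat 1"
    "transpose (matrix_inv A) = matrix_inv A" "pos_def (matrix_inv A)" "det A > 0"
proof -
  have W: "transpose (0::real^'n^'n) = 0" by (simp add: transpose_def vec_eq_iff)
  obtain J L :: "real^'n^'n" where J: "J ** L = mat 1" "L ** J = mat 1" "A = transpose J ** J"
    using simultaneous_diagonalization[OF assms W] by metis
  have LJt: "transpose J ** transpose L = mat 1" using J by (metis matrix_transpose_mul transpose_mat)
  have JLt: "transpose L ** transpose J = mat 1" using J by (metis matrix_transpose_mul transpose_mat)
  have 1: "A ** (L ** transpose L) = mat 1"
    unfolding J(3) using J LJt by (metis matrix_mul_assoc matrix_mul_lid)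
  then have eq: "matrix_inv A = L ** transpose L" by (rule matrix_inv_eqI)
  show "A ** matrix_inv A = mat 1" using 1 eq by simp
  then show "matrix_inv A ** A = mat 1" using matrix_left_right_inverse by blast
  show sym: "transpose (matrix_inv A) = matrix_inv A" by (simp add: eq matrix_transpose_mul)
  show "pos_def (matrix_inv A)" unfolding pos_def_def
  proof (intro conjI sym allI impI)
    fix x :: "real^'n" assume "x \<noteq> 0"
    then have "transpose L *v x \<noteq> 0"
      by (metis LJt matrix_vector_mul_assoc matrix_vector_mul_lid matrix_vector_mult_0_right)
    then have "0 < (transpose L *v x) \<bullet> (transpose L *v x)" by simp
    also have "\<dots> = x \<bullet> (matrix_inv A *v x)"
      unfolding eq by (metis inner_transpose_left matrix_vector_mul_assoc)
    finally show "0 < x \<bullet> (matrix_inv A *v x)" .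
  qed
  have "det J \<noteq> 0" using J(1) by (metis det_I det_mul mult_zero_left zero_neq_one)
  then show "det A > 0" unfolding J(3) by (simp add: det_mul) (meson not_real_square_gt_zero)
qed


section \<open>Integrals over Euclidean spaces\<close>

lemma nn_integral_lborel_shift:
  fixes c :: "'a::euclidean_space"
  assumes [measurable]: "f \<in> borel_measurable borel"
  shows "(\<integral>\<^sup>+x. f (x + c) \<partial>lborel) = (\<integral>\<^sup>+x. f x \<partial>lborel)"
  by (subst (2) lborel_distr_plus[of c, symmetric]) (simp add: nn_integral_distr add.commute)

lemma nn_integral_lborel_reflect:
  fixes f :: "'a::euclidean_space \<Rightarrow> ennreal"
  assumes [measurable]: "f \<in> borel_measurable borel"
  shows "(\<integral>\<^sup>+x. f (- x) \<partial>lborel) = (\<integral>\<^sup>+x. f x \<partial>lborel)"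
  by (subst (2) lborel_affine[of "-1" 0]) (simp_all add: nn_integral_distr density_1)

lemma integral_lborel_shift:
  fixes f :: "'a::euclidean_space \<Rightarrow> real"
  assumes [measurable]: "f \<in> borel_measurable borel"
  shows "(\<integral>x. f (x + c) \<partial>lborel) = (\<integral>x. f x \<partial>lborel)"
  by (subst (2) lborel_distr_plus[of c, symmetric]) (simp add: integral_distr add.commute)

lemma integrable_lborel_shift:
  fixes f :: "'a::euclidean_space \<Rightarrow> real"
  assumes "integrable lborel f"
  shows "integrable lborel (\<lambda>x. f (x + c))"
proof -
  have [measurable]: "f \<in> borel_measurable borel" using assms by auto
  have "integrable (distr lborel borel ((+) c)) f" using assms by (simp add: lborel_distr_plus)
  then show ?thesis by (subst (asm) integrable_distr_eq) (auto simp: add.commute)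
qed

text \<open>
  Integration by parts without boundary terms.  The integral of \<open>F (x + e) - F x\<close> vanishes by translation
  invariance.  By the fundamental theorem of calculus it is the average over \<open>s \<in> [0,1]\<close> of the integrals
  of \<open>D (x + s e)\<close>, and each of these is the integral of \<open>D\<close>.
\<close>

lemma integral_directional_derivative_eq_0:
  fixes F D :: "'a::euclidean_space \<Rightarrow> real" and e :: 'a
  assumes der: "\<And>x. ((\<lambda>t. F (x + t *\<^sub>R e)) has_real_derivative D x) (at 0)"
    and contD: "continuous_on UNIV D"
    and intF: "integrable lborel F" and intD: "integrable lborel D"
  shows "(\<integral>x. D x \<partial>lborel) = 0"
proof -
  have mD [measurable]: "D \<in> borel_measurable borel" using contD by (rule borel_measurable_continuous_onI)
  have mF [measurable]: "F \<in> borel_measurable borel" using intF by auto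
  define G where "G = (\<lambda>(s, x). D (x + s *\<^sub>R e) * indicator {0..1::real} s)"
  have mG [measurable]: "G \<in> borel_measurable (lborel \<Otimes>\<^sub>M lborel)"
    unfolding G_def by measurable
  have Gx: "(\<integral>s. G (s, x) \<partial>lborel) = F (x + e) - F x" for x
  proof -
    have d: "((\<lambda>t. F (x + t *\<^sub>R e)) has_real_derivative D (x + s *\<^sub>R e)) (at s)" for s
      using der[of "x + s *\<^sub>R e"] DERIV_shift[of "\<lambda>t. F (x + t *\<^sub>R e)" _ 0 s]
      by (simp add: scaleR_left_distrib add.assoc add.commute[of "s *\<^sub>R e"])
    have "(\<integral>s. D (x + s *\<^sub>R e) * indicator {0..1} s \<partial>lborel) = F (x + 1 *\<^sub>R e) - F (x + 0 *\<^sub>R e)"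
    proof (rule integral_FTC_Icc_real)
      fix s :: real
      show "DERIV (\<lambda>t. F (x + t *\<^sub>R e)) s :> D (x + s *\<^sub>R e)" by (rule d)
      show "isCont (\<lambda>s. D (x + s *\<^sub>R e)) s"
        using continuous_on_compose2[OF contD, of UNIV "\<lambda>s. x + s *\<^sub>R e"]
        by (simp add: continuous_on_eq_continuous_at continuous_intros)
    qed simp
    then show ?thesis by (simp add: G_def)
  qed
  have Gs: "(\<integral>x. G (s, x) \<partial>lborel) = indicator {0..1} s * (\<integral>x. D x \<partial>lborel)" for s
    using integral_lborel_shift[OF mD, of "s *\<^sub>R e"] by (simp add: G_def mult.commute)
  have intG: "integrable (lborel \<Otimes>\<^sub>M lborel) G"
  proof (rule lborel_pair.Fubini_integrable[OF mG])
    have "(\<integral>x. norm (G (s, x)) \<partial>lborel) = indicator {0..1} s * (\<integral>x. norm (D x) \<partial>lborel)" for s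
      using integral_lborel_shift[of "\<lambda>x. norm (D x)" "s *\<^sub>R e"]
      by (simp add: G_def abs_mult mult.commute)
    then show "integrable lborel (\<lambda>s. \<integral>x. norm (G (s, x)) \<partial>lborel)"
      by (simp add: integrable_mult_left)
    show "AE s in lborel. integrable lborel (\<lambda>x. G (s, x))"
      using integrable_lborel_shift[OF intD] by (simp add: G_def)
  qed
  have "(\<integral>x. D x \<partial>lborel) = (\<integral>s. \<integral>x. G (s, x) \<partial>lborel \<partial>lborel)"
    by (simp add: Gs)
  also have "\<dots> = (\<integral>x. \<integral>s. G (s, x) \<partial>lborel \<partial>lborel)"
    using lborel_pair.Fubini_integral[of "\<lambda>s x. G (s, x)"] intG by (simp add: case_prod_eta)
  also have "\<dots> = (\<integral>x. F (x + e) - F x \<partial>lborel)" by (simp add: Gx)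
  also have "\<dots> = 0"
    using intF integrable_lborel_shift[OF intF] integral_lborel_shift[OF mF] by simp
  finally show ?thesis .
qed

lemma nn_integral_gaussian_1d:
  assumes "c > 0"
  shows "(\<integral>\<^sup>+x. ennreal (exp (- (c * x\<^sup>2 / 2))) \<partial>lborel) = ennreal (sqrt (2 * pi / c))"
proof -
  define s where "s = 1 / sqrt c"
  have s: "s > 0" "s\<^sup>2 = 1 / c" using assms by (auto simp: s_def power_divide)
  have "exp (- (c * x\<^sup>2 / 2)) = sqrt (2 * pi / c) * normal_density 0 s x" for x
    using assms by (simp add: normal_density_def s(2) real_sqrt_divide)
  then have "(\<integral>\<^sup>+x. ennreal (exp (- (c * x\<^sup>2 / 2))) \<partial>lborel)
      = (\<integral>\<^sup>+x. ennreal (sqrt (2 * pi / c)) * ennreal (normal_density 0 s x) \<partial>lborel)"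
    using assms by (simp add: ennreal_mult)
  also have "\<dots> = ennreal (sqrt (2 * pi / c)) * (\<integral>\<^sup>+x. ennreal (normal_density 0 s x) \<partial>lborel)"
    by (rule nn_integral_cmult) simp
  also have "(\<integral>\<^sup>+x. ennreal (normal_density 0 s x) \<partial>lborel) = 1"
    using s(1) by (subst nn_integral_eq_integral) auto
  finally show ?thesis by simp
qed

lemma nn_integral_gaussian_diagonal:
  fixes l :: "'a::euclidean_space \<Rightarrow> real"
  assumes "\<And>b. b \<in> Basis \<Longrightarrow> l b > 0"
  shows "(\<integral>\<^sup>+x. ennreal (exp (- (\<Sum>b\<in>Basis. l b * (x \<bullet> b)\<^sup>2) / 2)) \<partial>lborel)
       = ennreal (\<Prod>b\<in>Basis. sqrt (2 * pi / l b))"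
proof -
  have "exp (- (\<Sum>b\<in>Basis. l b * (x \<bullet> b)\<^sup>2) / 2) = (\<Prod>b\<in>Basis. exp (- (l b * (x \<bullet> b)\<^sup>2 / 2)))" for x
    by (simp add: exp_sum[symmetric] sum_negf sum_divide_distrib)
  then have "(\<integral>\<^sup>+x. ennreal (exp (- (\<Sum>b\<in>Basis. l b * (x \<bullet> b)\<^sup>2) / 2)) \<partial>lborel)
     = (\<integral>\<^sup>+x. (\<Prod>b\<in>Basis. ennreal (exp (- (l b * (x \<bullet> b)\<^sup>2 / 2)))) \<partial>lborel)"
    by (simp add: prod_ennreal)
  also have "\<dots> = (\<Prod>b\<in>Basis. (\<integral>\<^sup>+y. ennreal (exp (- (l b * y\<^sup>2 / 2))) \<partial>lborel))"
    by (rule nn_integral_lborel_prod[where f="\<lambda>b y. ennreal (exp (- (l b * y\<^sup>2 / 2)))"]) auto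
  also have "\<dots> = (\<Prod>b\<in>Basis. ennreal (sqrt (2 * pi / l b)))"
    using assms by (intro prod.cong) (auto simp: nn_integral_gaussian_1d)
  also have "\<dots> = ennreal (\<Prod>b\<in>Basis. sqrt (2 * pi / l b))"
    using assms by (intro prod_ennreal) (auto simp: less_imp_le)
  finally show ?thesis .
qed

lemma norm_sq_eq_sum_Basis: "(norm (x::'a::euclidean_space))\<^sup>2 = (\<Sum>b\<in>Basis. (x \<bullet> b)\<^sup>2)"
  by (subst power2_norm_eq_inner, subst euclidean_inner) (simp add: power2_eq_square)

lemma norm_sq_le_shift:
  fixes x y :: "'a::real_normed_vector"
  shows "(norm x)\<^sup>2 \<le> 2 * (norm (x - y))\<^sup>2 + 2 * (norm y)\<^sup>2"
proof -
  have "norm x \<le> norm (x - y) + norm y" using norm_triangle_ineq[of "x - y" y] by simp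
  then have "(norm x)\<^sup>2 \<le> (norm (x - y) + norm y)\<^sup>2" by (intro power_mono) auto
  also have "\<dots> \<le> 2 * (norm (x - y))\<^sup>2 + 2 * (norm y)\<^sup>2"
    using sum_squares_bound[of "norm (x - y)" "norm y"] by (simp add: power2_sum)
  finally show ?thesis .
qed

lemma integrable_gaussian:
  assumes "c > 0"
  shows "integrable lborel (\<lambda>x::'a::euclidean_space. exp (- (c * (norm x)\<^sup>2)))"
proof (rule integrableI_nonneg)
  have "(\<integral>\<^sup>+(x::'a). ennreal (exp (- (c * (norm x)\<^sup>2))) \<partial>lborel)
     = (\<integral>\<^sup>+(x::'a). ennreal (exp (- (\<Sum>b\<in>Basis. (2 * c) * (x \<bullet> b)\<^sup>2) / 2)) \<partial>lborel)"
    by (simp add: norm_sq_eq_sum_Basis sum_distrib_left[symmetric])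
  also have "\<dots> < \<infinity>" using assms by (subst nn_integral_gaussian_diagonal) auto
  finally show "(\<integral>\<^sup>+(x::'a). ennreal (exp (- (c * (norm x)\<^sup>2))) \<partial>lborel) < \<infinity>" .
qed auto

text \<open>
  Uniqueness of translation invariant measures, in the form of one computation with Fubini's theorem.
  For a Gaussian weight \<open>g\<close>, integrate \<open>f (T x) g (y + T x)\<close> over \<open>x\<close> and \<open>y\<close>.  Shifting \<open>y\<close> gives
  \<open>(\<integral> f \<circ> T) (\<integral> g)\<close>, and shifting \<open>x\<close> gives \<open>(\<integral> f) (\<integral> g \<circ> T)\<close>.  Since \<open>g\<close> is radial, \<open>g \<circ> T = g\<close>, and
  its integral is positive and finite.
\<close>

lemma nn_integral_lborel_orthogonal:
  fixes T :: "'a::euclidean_space \<Rightarrow> 'a"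
  assumes T: "orthogonal_transformation T" and f [measurable]: "f \<in> borel_measurable borel"
  shows "(\<integral>\<^sup>+x. f (T x) \<partial>lborel) = (\<integral>\<^sup>+x. f x \<partial>lborel)"
proof -
  have lin: "linear T" using T by (simp add: orthogonal_transformation_def)
  have [measurable]: "T \<in> borel_measurable borel"
    using lin by (intro borel_measurable_continuous_onI linear_continuous_on) (simp add: linear_linear)
  define g where "g = (\<lambda>x::'a. ennreal (exp (- (1/2 * (norm x)\<^sup>2))))"
  have [measurable]: "g \<in> borel_measurable borel" unfolding g_def by measurable
  have gT: "g (T x) = g x" for x using T by (simp add: g_def orthogonal_transformation_norm)
  define G where "G = (\<integral>\<^sup>+x. g x \<partial>lborel)"
  have G: "G \<noteq> 0" "G \<noteq> top"
  proof -
    have "G = (\<integral>\<^sup>+(x::'a). ennreal (exp (- (\<Sum>b\<in>Basis. 1 * (x \<bullet> b)\<^sup>2) / 2)) \<partial>lborel)"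
      unfolding G_def g_def by (simp add: norm_sq_eq_sum_Basis)
    also have "\<dots> = ennreal (\<Prod>b\<in>(Basis::'a set). sqrt (2 * pi / 1))"
      by (rule nn_integral_gaussian_diagonal) simp
    finally have "G = ennreal (\<Prod>b\<in>(Basis::'a set). sqrt (2 * pi / 1))" .
    moreover have "(\<Prod>b\<in>(Basis::'a set). sqrt (2 * pi / 1)) > 0" by (intro prod_pos) auto
    ultimately show "G \<noteq> 0" "G \<noteq> top" by (metis ennreal_eq_0_iff not_le, simp)
  qed
  have inner_shift: "(\<integral>\<^sup>+x. f (T x) * g (y + T x) \<partial>lborel) = (\<integral>\<^sup>+x. f (T x - y) * g x \<partial>lborel)" for y
  proof -
    obtain u where u: "y = T u" using orthogonal_transformation_surj[OF T] by (metis surjD)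
    have "(\<integral>\<^sup>+x. f (T x - y) * g x \<partial>lborel) = (\<integral>\<^sup>+x. f (T x - y) * g (T x) \<partial>lborel)"
      by (simp add: gT)
    also have "\<dots> = (\<integral>\<^sup>+x. f (T (x + u) - y) * g (T (x + u)) \<partial>lborel)"
      by (rule nn_integral_lborel_shift[symmetric]) measurable
    finally show ?thesis using lin by (simp add: u linear_add add.commute)
  qed
  have "(\<integral>\<^sup>+x. f (T x) \<partial>lborel) * G = (\<integral>\<^sup>+x. f (T x) * G \<partial>lborel)"
    by (rule nn_integral_multc[symmetric]) measurable
  also have "\<dots> = (\<integral>\<^sup>+x. (\<integral>\<^sup>+y. f (T x) * g (y + T x) \<partial>lborel) \<partial>lborel)"
    by (simp add: nn_integral_cmult nn_integral_lborel_shift G_def)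
  also have "\<dots> = (\<integral>\<^sup>+y. (\<integral>\<^sup>+x. f (T x) * g (y + T x) \<partial>lborel) \<partial>lborel)"
    by (rule lborel_pair.Fubini'[symmetric]) measurable
  also have "\<dots> = (\<integral>\<^sup>+y. (\<integral>\<^sup>+x. f (T x - y) * g x \<partial>lborel) \<partial>lborel)"
    by (simp add: inner_shift)
  also have "\<dots> = (\<integral>\<^sup>+x. (\<integral>\<^sup>+y. f (T x - y) * g x \<partial>lborel) \<partial>lborel)"
    by (rule lborel_pair.Fubini') measurable
  also have "\<dots> = (\<integral>\<^sup>+x. (\<integral>\<^sup>+y. f y \<partial>lborel) * g x \<partial>lborel)"
  proof (rule nn_integral_cong)
    fix x
    have "(\<integral>\<^sup>+y. f (T x - y) * g x \<partial>lborel) = (\<integral>\<^sup>+y. f (T x - y) \<partial>lborel) * g x"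
      by (rule nn_integral_multc) measurable
    also have "(\<integral>\<^sup>+y. f (T x - y) \<partial>lborel) = (\<integral>\<^sup>+y. f (- (y + (- T x))) \<partial>lborel)" by simp
    also have "\<dots> = (\<integral>\<^sup>+y. f y \<partial>lborel)"
      by (subst nn_integral_lborel_shift, measurable) (rule nn_integral_lborel_reflect, measurable)
    finally show "(\<integral>\<^sup>+y. f (T x - y) * g x \<partial>lborel) = (\<integral>\<^sup>+y. f y \<partial>lborel) * g x" .
  qed
  also have "\<dots> = (\<integral>\<^sup>+y. f y \<partial>lborel) * G"
    unfolding G_def by (rule nn_integral_cmult) measurable
  finally show ?thesis
    using G by (metis ennreal_mult_cancel_left mult.commute)
qed


section \<open>The matrix normal distribution and the identity of Stein\<close>

text \<open>
  A growth condition that makes continuous functions of a Gaussian matrix integrable and is preserved by sums and by bounded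
  bilinear operations.
\<close>

definition poly_growth :: "('a::real_normed_vector \<Rightarrow> 'b::real_normed_vector) \<Rightarrow> bool" where
  "poly_growth f \<longleftrightarrow> (\<exists>C k. \<forall>x. norm (f x) \<le> C * (1 + norm x) ^ k)"

lemma poly_growthI:
  "(\<And>x. norm (f x) \<le> C * (1 + norm x) ^ k) \<Longrightarrow> poly_growth f"
  by (auto simp: poly_growth_def)

lemma poly_growthE:
  assumes "poly_growth f"
  obtains C k where "C \<ge> 0" "\<And>x. norm (f x) \<le> C * (1 + norm x) ^ k"
proof -
  obtain C k where C: "\<And>x. norm (f x) \<le> C * (1 + norm x) ^ k"
    using assms by (auto simp: poly_growth_def)
  have "C \<ge> 0" using order_trans[OF norm_ge_zero C[of 0]] by simp
  then show ?thesis using C that by blast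
qed

lemma poly_growth_const [intro]: "poly_growth (\<lambda>x. c)"
  by (rule poly_growthI[of _ "norm c" 0]) simp

lemma poly_growth_ident [intro]: "poly_growth (\<lambda>x. x)"
  by (rule poly_growthI[of _ 1 1]) simp

lemma poly_growth_mono:
  assumes "poly_growth g" "\<And>x. norm (f x) \<le> norm (g x)"
  shows "poly_growth f"
  using assms(1) by (elim poly_growthE) (blast intro: poly_growthI order_trans[OF assms(2)])

lemma poly_growth_add [intro]:
  assumes "poly_growth f" "poly_growth g"
  shows "poly_growth (\<lambda>x. f x + g x)"
proof -
  obtain C k D l where f: "C \<ge> 0" "\<And>x. norm (f x) \<le> C * (1 + norm x) ^ k"
    and g: "D \<ge> 0" "\<And>x. norm (g x) \<le> D * (1 + norm x) ^ l"
    using assms by (metis poly_growthE)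
  show ?thesis
  proof (rule poly_growthI[of _ "C + D" "k + l"])
    fix x
    have "norm (f x + g x) \<le> C * (1 + norm x) ^ k + D * (1 + norm x) ^ l"
      using f(2)[of x] g(2)[of x] norm_triangle_ineq[of "f x" "g x"] by linarith
    also have "\<dots> \<le> C * (1 + norm x) ^ (k + l) + D * (1 + norm x) ^ (k + l)"
      using f(1) g(1) by (intro add_mono mult_left_mono power_increasing) auto
    finally show "norm (f x + g x) \<le> (C + D) * (1 + norm x) ^ (k + l)" by (simp add: algebra_simps)
  qed
qed

lemma poly_growth_bounded_linear:
  assumes "bounded_linear h" "poly_growth f"
  shows "poly_growth (\<lambda>x. h (f x))"
proof -
  obtain K where K: "K > 0" "\<And>x. norm (h x) \<le> norm x * K"
    using bounded_linear.pos_bounded[OF assms(1)] by auto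
  obtain C k where f: "C \<ge> 0" "\<And>x. norm (f x) \<le> C * (1 + norm x) ^ k"
    using assms(2) by (metis poly_growthE)
  show ?thesis
  proof (rule poly_growthI[of _ "C * K" k])
    fix x
    show "norm (h (f x)) \<le> C * K * (1 + norm x) ^ k"
      using K(1) K(2)[of "f x"] f(2)[of x] by (smt (verit) mult.assoc mult.commute mult_right_mono)
  qed
qed

lemma poly_growth_bounded_bilinear:
  assumes "bounded_bilinear h" "poly_growth f" "poly_growth g"
  shows "poly_growth (\<lambda>x. h (f x) (g x))"
proof -
  obtain K where K: "K > 0" "\<And>x y. norm (h x y) \<le> norm x * norm y * K"
    using bounded_bilinear.pos_bounded[OF assms(1)] by auto
  obtain C k D l where f: "C \<ge> 0" "\<And>x. norm (f x) \<le> C * (1 + norm x) ^ k"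
    and g: "D \<ge> 0" "\<And>x. norm (g x) \<le> D * (1 + norm x) ^ l"
    using assms(2,3) by (metis poly_growthE)
  show ?thesis
  proof (rule poly_growthI[of _ "C * D * K" "k + l"])
    fix x
    have "norm (h (f x) (g x)) \<le> (C * (1 + norm x) ^ k) * (D * (1 + norm x) ^ l) * K"
      by (rule order_trans[OF K(2)]) (intro mult_mono f g, use f g K in auto)
    then show "norm (h (f x) (g x)) \<le> C * D * K * (1 + norm x) ^ (k + l)"
      by (simp add: power_add mult_ac)
  qed
qed

lemmas poly_growth_matrix_mult [intro] = poly_growth_bounded_bilinear[OF mmul.bounded_bilinear_axioms]
lemmas poly_growth_inner [intro] = poly_growth_bounded_bilinear[OF bounded_bilinear_inner]
lemmas poly_growth_mult [intro] =
  poly_growth_bounded_bilinear[OF bounded_bilinear_mult[where 'a=real]]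
lemmas poly_growth_scaleR [intro] = poly_growth_bounded_bilinear[OF bounded_bilinear_scaleR]
lemmas poly_growth_transpose [intro] = poly_growth_bounded_linear[OF bounded_linear_transpose]
lemmas poly_growth_trace [intro] = poly_growth_bounded_linear[OF bounded_linear_trace]

lemma poly_growth_minus [intro]: "poly_growth f \<Longrightarrow> poly_growth (\<lambda>x. - f x)"
  by (erule poly_growth_mono) simp

lemma poly_growth_diff [intro]:
  "poly_growth f \<Longrightarrow> poly_growth g \<Longrightarrow> poly_growth (\<lambda>x. f x - g x)"
  using poly_growth_add[of f "\<lambda>x. - g x"] by (simp add: poly_growth_minus)

lemma Basis_matrix:
  "(Basis::(real^'p^'m) set) = (\<lambda>(i, j). axis i (axis j 1)) ` UNIV"
  "inj_on (\<lambda>(i, j). axis i (axis j 1) :: real^'p^'m) UNIV"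
  by (auto simp: Basis_vec_def image_iff inj_on_def axis_eq_axis)

lemma sum_Basis_matrix:
  "(\<Sum>b\<in>(Basis::(real^'p^'m) set). h b) = (\<Sum>i\<in>UNIV. \<Sum>j\<in>UNIV. h (axis i (axis j 1)))"
proof -
  have "(\<Sum>b\<in>(Basis::(real^'p^'m) set). h b) = (\<Sum>(i, j)\<in>UNIV. h (axis i (axis j 1)))"
    unfolding Basis_matrix(1) by (subst sum.reindex[OF Basis_matrix(2)]) (simp add: case_prod_beta' comp_def)
  then show ?thesis by (simp add: sum.cartesian_product UNIV_Times_UNIV[symmetric] del: UNIV_Times_UNIV)
qed

lemma prod_Basis_matrix:
  "(\<Prod>b\<in>(Basis::(real^'p^'m) set). h b) = (\<Prod>i\<in>UNIV. \<Prod>j\<in>UNIV. h (axis i (axis j 1)))"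
proof -
  have "(\<Prod>b\<in>(Basis::(real^'p^'m) set). h b) = (\<Prod>(i, j)\<in>UNIV. h (axis i (axis j 1)))"
    unfolding Basis_matrix(1) by (subst prod.reindex[OF Basis_matrix(2)]) (simp add: case_prod_beta' comp_def)
  then show ?thesis by (simp add: prod.cartesian_product UNIV_Times_UNIV[symmetric] del: UNIV_Times_UNIV)
qed

lemma inner_mult_right_rows:
  fixes X :: "real^'p^'m"
  assumes "transpose P = P"
  shows "X \<bullet> (X ** P) = (\<Sum>i\<in>UNIV. X $ i \<bullet> (P *v X $ i))"
proof -
  have "(X ** P) $ i = P *v X $ i" for i
    by (subst assms[symmetric]) (simp add: matrix_matrix_mult_def matrix_vector_mult_def transpose_def
        vec_eq_iff mult.commute)
  then show ?thesis by (simp add: inner_vec_def[of X])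
qed

lemma matrix_normal_density_eq:
  fixes X :: "real^'p^'m"
  shows "matrix_normal_density \<Theta> (mat 1) \<Sigma> X =
    (2 * pi) powr (- (real CARD('m) * real CARD('p) / 2)) * det \<Sigma> powr (- (real CARD('m) / 2))
     * exp (- (((X - \<Theta>) \<bullet> ((X - \<Theta>) ** matrix_inv \<Sigma>)) / 2))"
proof -
  have 1: "matrix_inv (mat 1 :: real^'m^'m) = mat 1" by (rule matrix_inv_eqI) simp
  have "trace (mat 1 ** (X - \<Theta>) ** matrix_inv \<Sigma> ** transpose (X - \<Theta>))
      = (X - \<Theta>) \<bullet> ((X - \<Theta>) ** matrix_inv \<Sigma>)"
    unfolding inner_eq_trace by (subst (2) trace_mul_sym) simp
  then show ?thesis by (simp add: matrix_normal_density_def 1)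
qed

lemma inner_mult_left:
  fixes A :: "real^'n^'m" and B :: "real^'p^'n"
  shows "(A ** B) \<bullet> C = A \<bullet> (C ** transpose B)"
proof -
  have "trace (transpose B ** (transpose A ** C)) = trace ((transpose A ** C) ** transpose B)"
    by (rule trace_mul_sym)
  then show ?thesis by (simp add: inner_eq_trace matrix_transpose_mul matrix_mul_assoc)
qed

text \<open>
  An orthogonal \<open>J\<close> diagonalizes \<open>\<Sigma>\<^sup>-\<^sup>1\<close>, and \<open>Y \<mapsto> Y J\<close> is then an orthogonal map of the space of
  \<open>m \<times> p\<close> matrices.  After it the integral is a product of one dimensional Gaussian integrals, in which every
  eigenvalue occurs once for each of the \<open>m\<close> rows.
\<close>

lemma nn_integral_matrix_normal_density:
  fixes \<Theta> :: "real^'p^'m"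
  assumes "pos_def \<Sigma>"
  shows "(\<integral>\<^sup>+X. ennreal (matrix_normal_density \<Theta> (mat 1) \<Sigma> X) \<partial>lborel) = 1"
proof -
  let ?P = "matrix_inv \<Sigma>"
  define c where "c = (2 * pi) powr (- (real CARD('m) * real CARD('p) / 2))
      * det \<Sigma> powr (- (real CARD('m) / 2))"
  note P = pos_def_matrix_inv[OF assms]
  have "pos_def (mat 1 :: real^'p^'p)" by (simp add: pos_def_def)
  from simultaneous_diagonalization[OF this P(3)] obtain J L :: "real^'p^'p" and d where
    JL: "J ** L = mat 1" "L ** J = mat 1" and JJ: "mat 1 = transpose J ** J"
    and PJ: "?P = transpose J ** diag d ** J" by metis
  have JJt: "J ** transpose J = mat 1" using JJ matrix_left_right_inverse by metis
  have d: "d $ j > 0" for j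
    using P(4) diagonal_entry_of_congruence[OF JL(1) PJ, of j] unfolding pos_def_def by metis
  have detJ: "det J * det J = 1" using arg_cong[OF JJ, of det] by (simp add: det_mul)
  have "det ?P = (\<Prod>j\<in>UNIV. d $ j)"
    unfolding PJ using detJ by (simp add: det_mul det_diag)
  moreover have "det \<Sigma> * det ?P = 1" using arg_cong[OF P(1), of det] by (simp add: det_mul)
  ultimately have det: "det \<Sigma> = 1 / (\<Prod>j\<in>UNIV. d $ j)"
    by (metis eq_divide_imp mult_zero_right zero_neq_one)
  have dpos: "(\<Prod>j\<in>UNIV. d $ j) > 0" using d by (intro prod_pos) auto
  define T where "T = (\<lambda>Y::real^'p^'m. Y ** J)"
  have T: "orthogonal_transformation T"
    unfolding orthogonal_transformation_def T_def
  proof (intro conjI allI)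
    show "linear (\<lambda>Y::real^'p^'m. Y ** J)"
      using bounded_linear.linear[OF mmul.bounded_linear_left] .
    show "(v ** J) \<bullet> (w ** J) = v \<bullet> w" for v w :: "real^'p^'m"
      by (simp add: inner_mult_left matrix_mul_assoc[symmetric] JJt)
  qed
  have bd: "axis i (axis j 1) \<bullet> (axis i (axis j 1) ** diag d) = d $ j" for i :: 'm and j
  proof -
    let ?b = "axis i (axis j 1) :: real^'p^'m"
    have "?b \<bullet> (?b ** diag d) = (\<Sum>k\<in>UNIV. if k = i then d $ j else 0)"
      unfolding inner_mult_right_rows[OF transpose_diag]
      by (intro sum.cong) (auto simp: axis_def[of i] inner_diag_axis)
    then show ?thesis by simp
  qed
  have diag_form: "T Y \<bullet> (T Y ** ?P) = (\<Sum>b\<in>Basis. (b \<bullet> (b ** diag d)) * (Y \<bullet> b)\<^sup>2)" for Y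
  proof -
    have "T Y \<bullet> (T Y ** ?P) = Y \<bullet> (Y ** (J ** transpose J) ** diag d ** (J ** transpose J))"
      unfolding T_def PJ inner_mult_left by (simp only: matrix_mul_assoc)
    also have "\<dots> = (\<Sum>i\<in>UNIV. \<Sum>j\<in>UNIV. d $ j * (Y $ i $ j)\<^sup>2)"
      by (simp add: JJt inner_mult_right_rows[OF transpose_diag] inner_diag)
    also have "\<dots> = (\<Sum>b\<in>Basis. (b \<bullet> (b ** diag d)) * (Y \<bullet> b)\<^sup>2)"
      unfolding sum_Basis_matrix
    proof (intro sum.cong refl)
      fix i j
      let ?b = "axis i (axis j 1) :: real^'p^'m"
      have "?b \<bullet> (?b ** diag d) = d $ j" by (rule bd)
      moreover have "Y \<bullet> ?b = Y $ i $ j" by (simp add: inner_axis)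
      ultimately show "d $ j * (Y $ i $ j)\<^sup>2 = (?b \<bullet> (?b ** diag d)) * (Y \<bullet> ?b)\<^sup>2" by simp
    qed
    finally show ?thesis .
  qed
  have mP [measurable]: "(\<lambda>X::real^'p^'m. X ** ?P) \<in> borel_measurable borel"
    by (intro borel_measurable_continuous_onI linear_continuous_on mmul.bounded_linear_left)
  have "(\<integral>\<^sup>+X. ennreal (matrix_normal_density \<Theta> (mat 1) \<Sigma> X) \<partial>lborel)
     = (\<integral>\<^sup>+X. ennreal c * ennreal (exp (- ((X - \<Theta>) \<bullet> ((X - \<Theta>) ** ?P)) / 2)) \<partial>lborel)"
    by (simp add: matrix_normal_density_eq c_def ennreal_mult)
  also have "\<dots> = ennreal c * (\<integral>\<^sup>+X. ennreal (exp (- ((X - \<Theta>) \<bullet> ((X - \<Theta>) ** ?P)) / 2)) \<partial>lborel)"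
    by (rule nn_integral_cmult) measurable
  also have "(\<integral>\<^sup>+X. ennreal (exp (- ((X - \<Theta>) \<bullet> ((X - \<Theta>) ** ?P)) / 2)) \<partial>lborel)
     = (\<integral>\<^sup>+(X::real^'p^'m). ennreal (exp (- (X \<bullet> (X ** ?P)) / 2)) \<partial>lborel)"
    using nn_integral_lborel_shift[of "\<lambda>X. ennreal (exp (- (X \<bullet> (X ** ?P)) / 2))" "- \<Theta>"] by simp
  also have "\<dots> = (\<integral>\<^sup>+X. ennreal (exp (- (T X \<bullet> (T X ** ?P)) / 2)) \<partial>lborel)"
    by (rule nn_integral_lborel_orthogonal[OF T, symmetric]) measurable
  also have "\<dots> = ennreal (\<Prod>b\<in>(Basis::(real^'p^'m) set). sqrt (2 * pi / (b \<bullet> (b ** diag d))))"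
    unfolding diag_form
    by (rule nn_integral_gaussian_diagonal) (auto simp: Basis_vec_def bd d)
  also have "(\<Prod>b\<in>(Basis::(real^'p^'m) set). sqrt (2 * pi / (b \<bullet> (b ** diag d))))
      = (\<Prod>j\<in>UNIV. sqrt (2 * pi / d $ j)) ^ CARD('m)"
    by (simp add: prod_Basis_matrix bd)
  also have "(\<Prod>j\<in>UNIV. sqrt (2 * pi / d $ j)) = sqrt ((2 * pi) ^ CARD('p) * det \<Sigma>)"
  proof -
    have sp: "(\<Prod>j\<in>A. sqrt (f j)) = sqrt (\<Prod>j\<in>A. f j)" for A and f :: "'p \<Rightarrow> real"
      by (induction A rule: infinite_finite_induct) (auto simp: real_sqrt_mult)
    show ?thesis by (simp add: sp prod_dividef det)
  qed
  also have "sqrt ((2 * pi) ^ CARD('p) * det \<Sigma>) ^ CARD('m) = 1 / c"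
  proof -
    have ds: "det \<Sigma> > 0" using det dpos by simp
    have "sqrt ((2 * pi) ^ CARD('p) * det \<Sigma>) ^ CARD('m)
      = (((2 * pi) powr CARD('p) * det \<Sigma>) powr (1/2)) powr CARD('m)"
      using ds by (simp add: powr_half_sqrt powr_realpow)
    also have "\<dots> = (2 * pi) powr (real CARD('m) * real CARD('p) / 2) * det \<Sigma> powr (real CARD('m) / 2)"
      using ds by (simp add: powr_powr powr_mult mult_ac)
    finally show ?thesis by (simp add: c_def powr_minus_divide)
  qed
  also have "ennreal c * ennreal (1 / c) = 1"
  proof -
    have "c > 0" using P(5) pos_def_matrix_inv(5)[OF assms] by (simp add: c_def)
    then show ?thesis by (simp add: ennreal_mult[symmetric])
  qed
  finally show ?thesis .
qed

lemma matrix_normal_density_nonneg: "matrix_normal_density \<Theta> A \<Sigma> X \<ge> 0"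
  by (simp add: matrix_normal_density_def)

lemma continuous_on_matrix_normal_density:
  fixes \<Theta> :: "real^'p^'m"
  shows "continuous_on UNIV (matrix_normal_density \<Theta> (mat 1) \<Sigma>)"
proof -
  have "continuous_on UNIV (\<lambda>X::real^'p^'m. (X - \<Theta>) ** matrix_inv \<Sigma>)"
    by (intro mmul.continuous_on continuous_intros)
  then have "continuous_on UNIV (\<lambda>X::real^'p^'m. matrix_normal_density \<Theta> (mat 1) \<Sigma> X)"
    unfolding matrix_normal_density_eq by (intro continuous_intros) auto
  then show ?thesis by (simp add: eta_contract_eq)
qed

lemma borel_measurable_matrix_normal_density [measurable]:
  fixes \<Theta> :: "real^'p^'m"
  shows "matrix_normal_density \<Theta> (mat 1) \<Sigma> \<in> borel_measurable borel"
  by (rule borel_measurable_continuous_onI[OF continuous_on_matrix_normal_density])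

lemma sets_matrix_normal [simp, measurable_cong]: "sets (matrix_normal \<Theta> A \<Sigma>) = sets borel"
  and space_matrix_normal [simp]: "space (matrix_normal \<Theta> A \<Sigma>) = UNIV"
  by (simp_all add: matrix_normal_def)

lemma prob_space_matrix_normal:
  fixes \<Theta> :: "real^'p^'m"
  assumes "pos_def \<Sigma>"
  shows "prob_space (matrix_normal \<Theta> (mat 1) \<Sigma>)"
proof
  show "emeasure (matrix_normal \<Theta> (mat 1) \<Sigma>) (space (matrix_normal \<Theta> (mat 1) \<Sigma>)) = 1"
    using nn_integral_matrix_normal_density[OF assms, of \<Theta>]
    by (simp add: matrix_normal_def emeasure_density)
qed

lemma density_gaussian_bound:
  fixes \<Theta> :: "real^'p^'m"
  assumes "pos_def \<Sigma>"
  obtains C c where "C \<ge> 0" "c > 0"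
    "\<And>X. matrix_normal_density \<Theta> (mat 1) \<Sigma> X \<le> C * exp (- (c * (norm X)\<^sup>2))"
proof -
  let ?P = "matrix_inv \<Sigma>"
  note P = pos_def_matrix_inv[OF assms]
  obtain l where l: "l > 0" "\<And>x. l * (norm x)\<^sup>2 \<le> x \<bullet> (?P *v x)"
    using pos_def_lower_bound[OF P(4)] by blast
  define k where "k = (2 * pi) powr (- (real CARD('m) * real CARD('p) / 2))
      * det \<Sigma> powr (- (real CARD('m) / 2))"
  have low: "l * (norm Y)\<^sup>2 \<le> Y \<bullet> (Y ** ?P)" for Y :: "real^'p^'m"
  proof -
    have "(norm Y)\<^sup>2 = (\<Sum>i\<in>UNIV. (norm (Y $ i))\<^sup>2)"
      by (simp add: power2_norm_eq_inner inner_vec_def[of Y])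
    then show ?thesis
      unfolding inner_mult_right_rows[OF P(3)] by (simp add: sum_distrib_left l(2) sum_mono)
  qed
  show ?thesis
  proof
    show "k * exp (l * (norm \<Theta>)\<^sup>2 / 2) \<ge> 0" by (simp add: k_def)
    show "l / 4 > 0" using l by simp
    fix X
    have "(norm X)\<^sup>2 \<le> 2 * (norm (X - \<Theta>))\<^sup>2 + 2 * (norm \<Theta>)\<^sup>2" by (rule norm_sq_le_shift)
    then have "l * (norm X)\<^sup>2 \<le> l * (2 * (norm (X - \<Theta>))\<^sup>2 + 2 * (norm \<Theta>)\<^sup>2)"
      using l(1) by (intro mult_left_mono) auto
    then have "- ((X - \<Theta>) \<bullet> ((X - \<Theta>) ** ?P) / 2) \<le> l * (norm \<Theta>)\<^sup>2 / 2 - l / 4 * (norm X)\<^sup>2"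
      using low[of "X - \<Theta>"] by (simp only: distrib_left)
    then have "exp (- ((X - \<Theta>) \<bullet> ((X - \<Theta>) ** ?P) / 2))
        \<le> exp (l * (norm \<Theta>)\<^sup>2 / 2) * exp (- (l / 4 * (norm X)\<^sup>2))"
      by (simp add: exp_add[symmetric])
    then have "k * exp (- ((X - \<Theta>) \<bullet> ((X - \<Theta>) ** ?P) / 2))
        \<le> k * (exp (l * (norm \<Theta>)\<^sup>2 / 2) * exp (- (l / 4 * (norm X)\<^sup>2)))"
      by (intro mult_left_mono) (auto simp: k_def)
    then show "matrix_normal_density \<Theta> (mat 1) \<Sigma> X
        \<le> k * exp (l * (norm \<Theta>)\<^sup>2 / 2) * exp (- (l / 4 * (norm X)\<^sup>2))"
      by (simp add: matrix_normal_density_eq k_def mult_ac)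
  qed
qed

lemma integrable_density_poly_growth:
  fixes f :: "real^'p^'m \<Rightarrow> real"
  assumes "pos_def \<Sigma>" and cont: "continuous_on UNIV f" and "poly_growth f"
  shows "integrable lborel (\<lambda>X. matrix_normal_density \<Theta> (mat 1) \<Sigma> X * f X)"
proof -
  obtain C c where C: "C \<ge> 0" "c > 0"
    "\<And>X. matrix_normal_density \<Theta> (mat 1) \<Sigma> X \<le> C * exp (- (c * (norm X)\<^sup>2))"
    using density_gaussian_bound[OF assms(1)] by blast
  obtain D k where D: "D \<ge> 0" "\<And>x. norm (f x) \<le> D * (1 + norm x) ^ k"
    using poly_growthE[OF assms(3)] by blast
  define K where "K = C * D * exp ((real k)\<^sup>2 / (2 * c))"
  have [measurable]: "f \<in> borel_measurable borel" using cont by (rule borel_measurable_continuous_onI)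
  show ?thesis
  proof (rule Bochner_Integration.integrable_bound)
    show "integrable lborel (\<lambda>X::real^'p^'m. K * exp (- (c / 2 * (norm X)\<^sup>2)))"
      by (intro integrable_mult_right integrable_gaussian) (use C in simp)
    show "AE X in lborel. norm (matrix_normal_density \<Theta> (mat 1) \<Sigma> X * f X)
        \<le> norm (K * exp (- (c / 2 * (norm X)\<^sup>2)))"
    proof (rule AE_I2)
      fix X :: "real^'p^'m"
      have "(1 + norm X) ^ k \<le> exp (norm X) ^ k"
        by (intro power_mono) (auto simp: add_nonneg_nonneg exp_ge_add_one_self)
      also have "\<dots> = exp (k * norm X)" by (simp add: exp_of_nat_mult)
      also have "\<dots> \<le> exp (c / 2 * (norm X)\<^sup>2 + (real k)\<^sup>2 / (2 * c))"
      proof -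
        have "0 \<le> (c * norm X - real k)\<^sup>2 / (2 * c)" using C by simp
        also have "\<dots> = c / 2 * (norm X)\<^sup>2 + (real k)\<^sup>2 / (2 * c) - k * norm X"
          using C(2) by (simp add: power2_diff field_simps power2_eq_square)
        finally show ?thesis by simp
      qed
      finally have 1: "(1 + norm X) ^ k \<le> exp (c / 2 * (norm X)\<^sup>2) * exp ((real k)\<^sup>2 / (2 * c))"
        by (simp add: exp_add)
      have "norm (matrix_normal_density \<Theta> (mat 1) \<Sigma> X * f X)
          = matrix_normal_density \<Theta> (mat 1) \<Sigma> X * norm (f X)"
        by (simp add: abs_mult matrix_normal_density_nonneg)
      also have "\<dots> \<le> (C * exp (- (c * (norm X)\<^sup>2))) * (D * (1 + norm X) ^ k)"
        using C D by (intro mult_mono) (auto intro: matrix_normal_density_nonneg)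
      also have "\<dots> \<le> (C * exp (- (c * (norm X)\<^sup>2)))
          * (D * (exp (c / 2 * (norm X)\<^sup>2) * exp ((real k)\<^sup>2 / (2 * c))))"
        using C D 1 by (intro mult_left_mono) auto
      also have "\<dots> = K * (exp (- (c * (norm X)\<^sup>2)) * exp (c / 2 * (norm X)\<^sup>2))"
        by (simp add: K_def)
      also have "\<dots> = K * exp (- (c / 2 * (norm X)\<^sup>2))"
        by (simp add: exp_add[symmetric] algebra_simps)
      finally show "norm (matrix_normal_density \<Theta> (mat 1) \<Sigma> X * f X)
        \<le> norm (K * exp (- (c / 2 * (norm X)\<^sup>2)))" by simp
    qed
  qed measurable
qed

lemma integral_matrix_normal:
  fixes f :: "real^'p^'m \<Rightarrow> real"
  assumes "f \<in> borel_measurable borel"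
  shows "(\<integral>X. f X \<partial>matrix_normal \<Theta> (mat 1) \<Sigma>)
       = (\<integral>X. matrix_normal_density \<Theta> (mat 1) \<Sigma> X * f X \<partial>lborel)"
  unfolding matrix_normal_def using assms
  by (subst integral_density) (auto intro: matrix_normal_density_nonneg)

lemma integrable_matrix_normal_poly_growth:
  fixes f :: "real^'p^'m \<Rightarrow> real"
  assumes "pos_def \<Sigma>" and cont: "continuous_on UNIV f" and "poly_growth f"
  shows "integrable (matrix_normal \<Theta> (mat 1) \<Sigma>) f"
proof -
  have [measurable]: "f \<in> borel_measurable borel" using cont by (rule borel_measurable_continuous_onI)
  show ?thesis
    unfolding matrix_normal_def using integrable_density_poly_growth[OF assms]
    by (subst integrable_density) (auto intro: matrix_normal_density_nonneg)
qed

text \<open>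
  The density \<open>\<phi>\<close> satisfies \<open>\<partial>\<^sub>b \<phi> = - (((X - \<Theta>) \<Sigma>\<^sup>-\<^sup>1) \<bullet> b) \<phi>\<close>.  For each coordinate direction \<open>b\<close> the
  integral of \<open>\<partial>\<^sub>b (\<phi> (H \<bullet> b))\<close> vanishes, and the sum over \<open>b\<close> is the claim: the right hand side is
  the expected divergence of \<open>H\<close>.
\<close>

lemma stein_identity:
  fixes H :: "real^'p^'m \<Rightarrow> real^'p^'m" and H' :: "real^'p^'m \<Rightarrow> real^'p^'m \<Rightarrow> real^'p^'m"
  assumes \<Sigma>: "pos_def \<Sigma>"
    and der: "\<And>b X. b \<in> Basis \<Longrightarrow> ((\<lambda>t. H (X + t *\<^sub>R b)) has_vector_derivative H' b X) (at 0)"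
    and cH: "continuous_on UNIV H" and cH': "\<And>b. b \<in> Basis \<Longrightarrow> continuous_on UNIV (H' b)"
    and gH: "poly_growth H" and gH': "\<And>b. b \<in> Basis \<Longrightarrow> poly_growth (H' b)"
  shows "(\<integral>X. ((X - \<Theta>) ** matrix_inv \<Sigma>) \<bullet> H X \<partial>matrix_normal \<Theta> (mat 1) \<Sigma>)
       = (\<integral>X. (\<Sum>b\<in>Basis. H' b X \<bullet> b) \<partial>matrix_normal \<Theta> (mat 1) \<Sigma>)"
proof -
  let ?P = "matrix_inv \<Sigma>"
  let ?\<phi> = "matrix_normal_density \<Theta> (mat 1) \<Sigma>"
  note P = pos_def_matrix_inv[OF \<Sigma>]
  have cP: "continuous_on UNIV (\<lambda>X::real^'p^'m. (X - \<Theta>) ** ?P)"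
    by (intro mmul.continuous_on continuous_intros)
  have cU: "continuous_on UNIV (\<lambda>X. ((X - \<Theta>) ** ?P) \<bullet> b * (H X \<bullet> b))" for b
    by (intro continuous_intros cP cH)
  have gU: "poly_growth (\<lambda>X. ((X - \<Theta>) ** ?P) \<bullet> b * (H X \<bullet> b))" for b
    by (intro poly_growth_mult poly_growth_inner poly_growth_matrix_mult poly_growth_diff
        poly_growth_ident poly_growth_const gH)
  have cV: "continuous_on UNIV (\<lambda>X. H' b X \<bullet> b)" if "b \<in> Basis" for b
    using cH'[OF that] by (intro continuous_intros)
  have gV: "poly_growth (\<lambda>X. H' b X \<bullet> b)" if "b \<in> Basis" for b
    using gH'[OF that] by (intro poly_growth_inner poly_growth_const)
  have coord: "(\<integral>X. ((X - \<Theta>) ** ?P) \<bullet> b * (H X \<bullet> b) \<partial>matrix_normal \<Theta> (mat 1) \<Sigma>)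
      = (\<integral>X. H' b X \<bullet> b \<partial>matrix_normal \<Theta> (mat 1) \<Sigma>)" if b: "b \<in> Basis" for b
  proof -
    define D where "D = (\<lambda>X. ?\<phi> X * (H' b X \<bullet> b) - ?\<phi> X * (((X - \<Theta>) ** ?P) \<bullet> b * (H X \<bullet> b)))"
    have "(\<integral>X. D X \<partial>lborel) = 0"
    proof (rule integral_directional_derivative_eq_0[where e=b and F="\<lambda>X. ?\<phi> X * (H X \<bullet> b)"])
      fix X
      have q: "((\<lambda>t. (X + t *\<^sub>R b - \<Theta>) \<bullet> ((X + t *\<^sub>R b - \<Theta>) ** ?P))
          has_real_derivative 2 * (((X - \<Theta>) ** ?P) \<bullet> b)) (at 0)"
      proof -
        define Y where "Y = X - \<Theta>"
        have Yt: "X + t *\<^sub>R b - \<Theta> = Y + t *\<^sub>R b" for t by (simp add: Y_def)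
        have "Y \<bullet> (b ** ?P) = (Y ** ?P) \<bullet> b"
          using inner_mult_left[of Y ?P b] P(3) by simp
        then have "(Y + t *\<^sub>R b) \<bullet> ((Y + t *\<^sub>R b) ** ?P)
          = Y \<bullet> (Y ** ?P) + t * (2 * ((Y ** ?P) \<bullet> b)) + t\<^sup>2 * (b \<bullet> (b ** ?P))" for t
          by (simp only: mat_linear inner_add_left inner_add_right inner_scaleR_left inner_scaleR_right)
            (simp add: inner_commute[of b "Y ** ?P"] power2_eq_square algebra_simps)
        note form = this
        have "((\<lambda>t. (X + t *\<^sub>R b - \<Theta>) \<bullet> ((X + t *\<^sub>R b - \<Theta>) ** ?P))
          has_real_derivative 2 * ((Y ** ?P) \<bullet> b)) (at 0)"
          unfolding Yt form by (auto intro!: derivative_eq_intros)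
        then show ?thesis by (simp only: Y_def)
      qed
      have "((\<lambda>t. ?\<phi> (X + t *\<^sub>R b)) has_real_derivative - ?\<phi> X * (((X - \<Theta>) ** ?P) \<bullet> b)) (at 0)"
        unfolding matrix_normal_density_eq
        by (rule derivative_eq_intros q refl | simp)+
      moreover have "((\<lambda>t. H (X + t *\<^sub>R b) \<bullet> b) has_real_derivative H' b X \<bullet> b) (at 0)"
        unfolding has_real_derivative_iff_has_vector_derivative
        by (rule bounded_linear.has_vector_derivative[OF bounded_linear_inner_left der[OF b]])
      ultimately show "((\<lambda>t. ?\<phi> (X + t *\<^sub>R b) * (H (X + t *\<^sub>R b) \<bullet> b)) has_real_derivative D X) (at 0)"
        by (rule DERIV_mult[THEN DERIV_cong]) (simp add: D_def algebra_simps)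
    next
      show "continuous_on UNIV D" unfolding D_def
        by (intro continuous_intros cV[OF b] cU cP cH
            continuous_on_compose2[OF continuous_on_matrix_normal_density]) auto
      show "integrable lborel (\<lambda>X. ?\<phi> X * (H X \<bullet> b))"
        by (intro integrable_density_poly_growth \<Sigma> continuous_intros cH poly_growth_inner gH poly_growth_const)
      show "integrable lborel D" unfolding D_def
        by (intro Bochner_Integration.integrable_diff integrable_density_poly_growth \<Sigma> cV gV cU gU b)
    qed
    then have "(\<integral>X. ?\<phi> X * (H' b X \<bullet> b) \<partial>lborel)
        = (\<integral>X. ?\<phi> X * (((X - \<Theta>) ** ?P) \<bullet> b * (H X \<bullet> b)) \<partial>lborel)"
      unfolding D_def
      by (subst (asm) Bochner_Integration.integral_diff)
         (auto intro!: integrable_density_poly_growth \<Sigma> cV gV cU gU b)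
    then show ?thesis
      using cU[of b] cV[OF b] by (simp add: integral_matrix_normal borel_measurable_continuous_onI)
  qed
  have "(\<integral>X. ((X - \<Theta>) ** ?P) \<bullet> H X \<partial>matrix_normal \<Theta> (mat 1) \<Sigma>)
      = (\<integral>X. (\<Sum>b\<in>Basis. ((X - \<Theta>) ** ?P) \<bullet> b * (H X \<bullet> b)) \<partial>matrix_normal \<Theta> (mat 1) \<Sigma>)"
    by (subst euclidean_inner) simp
  also have "\<dots> = (\<Sum>b\<in>Basis. \<integral>X. ((X - \<Theta>) ** ?P) \<bullet> b * (H X \<bullet> b) \<partial>matrix_normal \<Theta> (mat 1) \<Sigma>)"
    by (intro Bochner_Integration.integral_sum integrable_matrix_normal_poly_growth \<Sigma> cU gU)
  also have "\<dots> = (\<Sum>b\<in>Basis. \<integral>X. H' b X \<bullet> b \<partial>matrix_normal \<Theta> (mat 1) \<Sigma>)"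
    using coord by simp
  also have "\<dots> = (\<integral>X. (\<Sum>b\<in>Basis. H' b X \<bullet> b) \<partial>matrix_normal \<Theta> (mat 1) \<Sigma>)"
    by (intro Bochner_Integration.integral_sum[symmetric] integrable_matrix_normal_poly_growth \<Sigma> cV gV)
  finally show ?thesis .
qed


section \<open>The Kullback-Leibler loss in closed form\<close>

lemma inner_axis_axis_nth: "(A::real^'p^'m) \<bullet> axis i (axis j 1) = A $ i $ j"
  by (simp add: inner_axis)

text \<open>
  The two sums below are the divergences of the linear fields \<open>Y \<mapsto> C Y D\<close> and \<open>Y \<mapsto> C Y\<^sup>T D\<close>; every
  divergence in the sequel is reduced to them.
\<close>

lemma sum_Basis_sandwich:
  fixes C :: "real^'m^'m" and D :: "real^'p^'p"
  shows "(\<Sum>b\<in>Basis. (C ** b ** D) \<bullet> b) = trace C * trace D"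
proof -
  have "(C ** axis i (axis j 1) ** D) $ i $ j = C $ i $ i * D $ j $ j" for i j
  proof -
    have "(C ** axis i (axis j 1)) $ i $ k = (if k = j then C $ i $ i else 0)" for k
    proof -
      have "(\<Sum>l\<in>UNIV. C $ i $ l * (axis i (axis j 1) :: real^'p^'m) $ l $ k)
         = (\<Sum>l\<in>UNIV. if l = i then (if k = j then C $ i $ i else 0) else 0)"
        by (intro sum.cong) (auto simp: axis_def)
      then show ?thesis by (simp add: matrix_matrix_mult_def)
    qed
    note entry = this
    have "(C ** axis i (axis j 1) ** D) $ i $ j
        = (\<Sum>k\<in>UNIV. (C ** axis i (axis j 1)) $ i $ k * D $ k $ j)"
      by (simp add: matrix_matrix_mult_def[of "C ** _"])
    also have "\<dots> = (\<Sum>k\<in>UNIV. if k = j then C $ i $ i * D $ j $ j else 0)"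
      by (intro sum.cong) (simp_all add: entry)
    finally show ?thesis by simp
  qed
  then show ?thesis
    by (simp add: sum_Basis_matrix inner_axis_axis_nth trace_def sum_product)
qed

lemma sum_Basis_sandwich_transpose:
  fixes C D :: "real^'p^'m"
  shows "(\<Sum>b\<in>Basis. (C ** transpose b ** D) \<bullet> b) = C \<bullet> D"
proof -
  have "(C ** transpose (axis i (axis j 1)) ** D) $ i $ j = C $ i $ j * D $ i $ j" for i j
  proof -
    have "(C ** transpose (axis i (axis j 1))) $ i $ k = (if k = i then C $ i $ j else 0)" for k
    proof -
      have "(\<Sum>l\<in>UNIV. C $ i $ l * (axis i (axis j 1) :: real^'p^'m) $ k $ l)
         = (\<Sum>l\<in>UNIV. if l = j then (if k = i then C $ i $ j else 0) else 0)"
        by (intro sum.cong) (auto simp: axis_def)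
      then show ?thesis by (simp add: matrix_matrix_mult_def transpose_def)
    qed
    note entry = this
    have "(C ** transpose (axis i (axis j 1)) ** D) $ i $ j
        = (\<Sum>k\<in>UNIV. (C ** transpose (axis i (axis j 1))) $ i $ k * D $ k $ j)"
      by (simp add: matrix_matrix_mult_def[of "C ** _"])
    also have "\<dots> = (\<Sum>k\<in>UNIV. if k = i then C $ i $ j * D $ i $ j else 0)"
      by (intro sum.cong) (simp_all add: entry)
    finally show ?thesis by simp
  qed
  then show ?thesis
    by (simp add: sum_Basis_matrix inner_axis_axis_nth) (simp add: inner_vec_def)
qed

lemma quadratic_form_add:
  fixes A D :: "real^'p^'m"
  assumes "transpose P = P"
  shows "(A + D) \<bullet> ((A + D) ** P) = A \<bullet> (A ** P) + 2 * (A \<bullet> (D ** P)) + D \<bullet> (D ** P)"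
proof -
  have "D \<bullet> (A ** P) = A \<bullet> (D ** P)"
    using inner_mult_left[of D P A] assms by (simp add: inner_commute)
  then show ?thesis by (simp add: mmul.add_left inner_add_left inner_add_right)
qed

lemma has_vector_derivative_line: "((\<lambda>t. X + t *\<^sub>R b) has_vector_derivative b) (at t)"
  by (auto intro!: derivative_eq_intros)

text \<open>
  The identity of Stein for the field \<open>Y \<mapsto> (Y - \<Theta>) Q \<Sigma>\<close>, whose divergence is the constant
  \<open>m tr (Q \<Sigma>)\<close>.
\<close>

lemma matrix_normal_quadratic_moment:
  fixes \<Theta> :: "real^'p^'m"
  assumes \<Sigma>: "pos_def \<Sigma>"
  shows "(\<integral>Y. (Y - \<Theta>) \<bullet> ((Y - \<Theta>) ** Q) \<partial>matrix_normal \<Theta> (mat 1) \<Sigma>)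
    = real CARD('m) * trace (Q ** \<Sigma>)"
proof -
  note P = pos_def_matrix_inv[OF \<Sigma>]
  have eq: "((Y - \<Theta>) ** matrix_inv \<Sigma>) \<bullet> ((Y - \<Theta>) ** (Q ** \<Sigma>)) = (Y - \<Theta>) \<bullet> ((Y - \<Theta>) ** Q)" for Y
    unfolding inner_mult_left P(3) using P(1) by (simp add: matrix_mul_assoc[symmetric])
  have "(\<integral>Y. ((Y - \<Theta>) ** matrix_inv \<Sigma>) \<bullet> ((Y - \<Theta>) ** (Q ** \<Sigma>)) \<partial>matrix_normal \<Theta> (mat 1) \<Sigma>)
    = (\<integral>Y. (\<Sum>b\<in>(Basis::(real^'p^'m) set). (b ** (Q ** \<Sigma>)) \<bullet> b) \<partial>matrix_normal \<Theta> (mat 1) \<Sigma>)"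
  proof (rule stein_identity[OF \<Sigma>, where H="\<lambda>Y. (Y - \<Theta>) ** (Q ** \<Sigma>)" and H'="\<lambda>b Y. b ** (Q ** \<Sigma>)"])
    fix b X :: "real^'p^'m"
    have "((\<lambda>t. (X + t *\<^sub>R b - \<Theta>)) has_vector_derivative b) (at 0)"
      by (auto intro!: derivative_eq_intros)
    from bounded_linear.has_vector_derivative[OF mmul.bounded_linear_left this]
    show "((\<lambda>t. (X + t *\<^sub>R b - \<Theta>) ** (Q ** \<Sigma>)) has_vector_derivative b ** (Q ** \<Sigma>)) (at 0)" .
    show "poly_growth (\<lambda>Y. (Y - \<Theta>) ** (Q ** \<Sigma>))"
      by (intro poly_growth_matrix_mult poly_growth_diff poly_growth_ident poly_growth_const)
  qed (auto intro!: mmul.continuous_on continuous_intros)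
  also have "\<dots> = real CARD('m) * trace (Q ** \<Sigma>)"
  proof -
    interpret prob_space "matrix_normal \<Theta> (mat 1) \<Sigma>" by (rule prob_space_matrix_normal[OF \<Sigma>])
    show ?thesis
      using sum_Basis_sandwich[of "mat 1 :: real^'m^'m" "Q ** \<Sigma>"] prob_space
      by (simp add: trace_I)
  qed
  finally show ?thesis unfolding eq .
qed

lemma matrix_normal_first_moment:
  fixes \<Theta> :: "real^'p^'m"
  assumes \<Sigma>: "pos_def \<Sigma>"
  shows "(\<integral>Y. (Y - \<Theta>) \<bullet> Q \<partial>matrix_normal \<Theta> (mat 1) \<Sigma>) = 0"
proof -
  note P = pos_def_matrix_inv[OF \<Sigma>]
  have eq: "((Y - \<Theta>) ** matrix_inv \<Sigma>) \<bullet> (Q ** \<Sigma>) = (Y - \<Theta>) \<bullet> Q" for Y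
    unfolding inner_mult_left P(3) using P(1) by (simp add: matrix_mul_assoc[symmetric])
  have "(\<integral>Y. ((Y - \<Theta>) ** matrix_inv \<Sigma>) \<bullet> (Q ** \<Sigma>) \<partial>matrix_normal \<Theta> (mat 1) \<Sigma>)
    = (\<integral>Y. (\<Sum>b\<in>Basis. 0 \<bullet> (b :: real^'p^'m)) \<partial>matrix_normal \<Theta> (mat 1) \<Sigma>)"
    by (rule stein_identity[OF \<Sigma>, where H="\<lambda>Y. Q ** \<Sigma>" and H'="\<lambda>b Y. 0"])
       (auto intro!: derivative_eq_intros)
  then show ?thesis unfolding eq by simp
qed

text \<open>
  The logarithm of the quotient of the densities is a quadratic polynomial in \<open>Y - \<Theta>h\<close>, so the first two
  moments determine its integral.
\<close>

lemma KL_loss_eq: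
  fixes \<Theta> :: "real^'p^'m"
  assumes \<Sigma>: "pos_def \<Sigma>" and \<Sigma>h: "pos_def \<Sigma>h"
  shows "KL_loss (\<Theta>h, \<Sigma>h) \<Theta> \<Sigma>
     = real CARD('m) / 2 * (trace (matrix_inv \<Sigma> ** \<Sigma>h) - ln (det \<Sigma>h / det \<Sigma>) - real CARD('p))
       + (\<Theta>h - \<Theta>) \<bullet> ((\<Theta>h - \<Theta>) ** matrix_inv \<Sigma>) / 2"
proof -
  let ?P = "matrix_inv \<Sigma>" and ?Q = "matrix_inv \<Sigma>h" and ?N = "matrix_normal \<Theta>h (mat 1) \<Sigma>h"
  note P = pos_def_matrix_inv[OF \<Sigma>] and Q = pos_def_matrix_inv[OF \<Sigma>h]
  interpret prob_space ?N by (rule prob_space_matrix_normal[OF \<Sigma>h])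
  let ?D = "\<Theta>h - \<Theta>"
  define C where "C = - (real CARD('m) / 2 * ln (det \<Sigma>h / det \<Sigma>)) + ?D \<bullet> (?D ** ?P) / 2"
  define f where "f = (\<lambda>Y. C - (Y - \<Theta>h) \<bullet> ((Y - \<Theta>h) ** ?Q) / 2
      + (Y - \<Theta>h) \<bullet> ((Y - \<Theta>h) ** ?P) / 2 + (Y - \<Theta>h) \<bullet> (?D ** ?P))"
  have lnphi: "ln (phi Y \<Theta>h \<Sigma>h / phi Y \<Theta> \<Sigma>) = f Y" for Y
  proof -
    define c0 where "c0 = (2 * pi) powr (- (real CARD('m) * real CARD('p) / 2))"
    have c0: "c0 > 0" by (simp add: c0_def)
    have l: "ln (phi Y T V) = ln c0 - real CARD('m) / 2 * ln (det V)
        - (Y - T) \<bullet> ((Y - T) ** matrix_inv V) / 2" "phi Y T V > 0"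
      if "det V > 0" for T :: "real^'p^'m" and V
      using that c0 unfolding phi_def matrix_normal_density_eq c0_def[symmetric]
      by (simp_all add: ln_mult ln_powr)
    have "Y - \<Theta> = (Y - \<Theta>h) + ?D" by simp
    then have "(Y - \<Theta>) \<bullet> ((Y - \<Theta>) ** ?P) = ((Y - \<Theta>h) + ?D) \<bullet> (((Y - \<Theta>h) + ?D) ** ?P)" by simp
    also have "\<dots> = (Y - \<Theta>h) \<bullet> ((Y - \<Theta>h) ** ?P) + 2 * ((Y - \<Theta>h) \<bullet> (?D ** ?P)) + ?D \<bullet> (?D ** ?P)"
      by (rule quadratic_form_add[OF P(3)])
    finally have "(Y - \<Theta>) \<bullet> ((Y - \<Theta>) ** ?P) = \<dots>" .
    then show ?thesis
      using l[OF P(5), of \<Theta>] l[OF Q(5), of \<Theta>h] P(5) Q(5)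
      by (simp add: ln_div f_def C_def field_simps)
  qed
  have i1: "integrable ?N (\<lambda>Y. (Y - \<Theta>h) \<bullet> ((Y - \<Theta>h) ** R))" for R
    by (intro integrable_matrix_normal_poly_growth \<Sigma>h poly_growth_inner poly_growth_matrix_mult
        poly_growth_diff poly_growth_ident poly_growth_const continuous_intros mmul.continuous_on)
  have i2: "integrable ?N (\<lambda>Y. (Y - \<Theta>h) \<bullet> R)" for R
    by (intro integrable_matrix_normal_poly_growth \<Sigma>h poly_growth_inner
        poly_growth_diff poly_growth_ident poly_growth_const continuous_intros)
  have mf: "f \<in> borel_measurable borel"
    unfolding f_def by (intro borel_measurable_continuous_onI continuous_intros mmul.continuous_on) auto
  have "KL_loss (\<Theta>h, \<Sigma>h) \<Theta> \<Sigma> = (\<integral>Y. f Y \<partial>?N)"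
    unfolding KL_loss_def prod.case lnphi
    by (simp add: integral_matrix_normal[OF mf] phi_def mult.commute)
  also have "\<dots> = C - real CARD('m) * trace (?Q ** \<Sigma>h) / 2 + real CARD('m) * trace (?P ** \<Sigma>h) / 2"
    unfolding f_def using i1 i2
    by (simp add: matrix_normal_quadratic_moment[OF \<Sigma>h] matrix_normal_first_moment[OF \<Sigma>h] prob_space[simplified])
  finally show ?thesis
    using Q by (simp add: C_def trace_I algebra_simps)
qed

text \<open>
  In coordinates that diagonalize the pencil \<open>(\<Sigma>, \<Sigma>h)\<close> this is the sum of \<open>d - 1 - ln d \<ge> 0\<close> over the eigenvalues.
\<close>

lemma KL_covariance_part_nonneg:
  fixes \<Sigma> \<Sigma>h :: "real^'p^'p"
  assumes \<Sigma>: "pos_def \<Sigma>" and \<Sigma>h: "pos_def \<Sigma>h"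
  shows "0 \<le> trace (matrix_inv \<Sigma> ** \<Sigma>h) - ln (det \<Sigma>h / det \<Sigma>) - real CARD('p)"
proof -
  obtain J L :: "real^'p^'p" and d where JL: "J ** L = mat 1" "L ** J = mat 1"
    and S: "\<Sigma> = transpose J ** J" and W: "\<Sigma>h = transpose J ** diag d ** J"
    using simultaneous_diagonalization[OF \<Sigma> pos_def_sym[OF \<Sigma>h]] by metis
  have JLt: "transpose J ** transpose L = mat 1" "transpose L ** transpose J = mat 1"
    using JL by (metis matrix_transpose_mul transpose_mat)+
  have inv: "matrix_inv \<Sigma> = L ** transpose L"
    by (rule matrix_inv_eqI) (metis JL JLt S matrix_mul_assoc matrix_mul_lid)
  have d: "d $ j > 0" for j
    using \<Sigma>h diagonal_entry_of_congruence[OF JL(1) W, of j] unfolding pos_def_def by metis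
  have "matrix_inv \<Sigma> ** \<Sigma>h = L ** (transpose L ** transpose J) ** diag d ** J"
    unfolding inv W by (simp only: matrix_mul_assoc)
  then have "matrix_inv \<Sigma> ** \<Sigma>h = (L ** diag d) ** J" by (simp add: JLt)
  then have "trace (matrix_inv \<Sigma> ** \<Sigma>h) = trace (J ** (L ** diag d))"
    using trace_mul_sym[of "L ** diag d" J] by simp
  then have tr: "trace (matrix_inv \<Sigma> ** \<Sigma>h) = (\<Sum>j\<in>UNIV. d $ j)"
    by (simp add: matrix_mul_assoc JL trace_diag)
  have "det J \<noteq> 0" using JL by (metis det_I det_mul mult_zero_left zero_neq_one)
  then have "det \<Sigma>h / det \<Sigma> = (\<Prod>j\<in>UNIV. d $ j)" by (simp add: S W det_mul det_diag)
  then have "ln (det \<Sigma>h / det \<Sigma>) = (\<Sum>j\<in>UNIV. ln (d $ j))"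
    using d ln_prod[of UNIV "\<lambda>j. d $ j"] by (simp add: less_imp_neq[THEN not_sym])
  also have "\<dots> \<le> (\<Sum>j\<in>UNIV. d $ j - 1)" using d by (intro sum_mono ln_le_minus_one)
  finally show ?thesis by (simp add: tr sum_subtractf)
qed

section \<open>Derivatives of Gram matrices and of inverses\<close>

definition gram :: "real^'p^'m \<Rightarrow> real^'p^'p" where "gram Y = transpose Y ** Y"

lemma transpose_gram: "transpose (gram Y) = gram Y"
  by (simp add: gram_def matrix_transpose_mul)

lemma inner_gram: "x \<bullet> (gram Y *v x) = (norm (Y *v x))\<^sup>2"
  unfolding gram_def power2_norm_eq_inner
  by (metis inner_commute inner_transpose_left matrix_vector_mul_assoc)

lemma poly_growth_gram: "poly_growth gram"
proof -
  have "poly_growth (\<lambda>Y::real^'p^'m. transpose Y ** Y)"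
    by (intro poly_growth_matrix_mult poly_growth_transpose poly_growth_ident)
  then show ?thesis by (simp add: gram_def[abs_def])
qed

lemma continuous_on_gram: "continuous_on UNIV gram"
  unfolding gram_def[abs_def]
  by (intro mmul.continuous_on bounded_linear.continuous_on[OF bounded_linear_transpose] continuous_intros)

lemma has_vector_derivative_gram:
  "((\<lambda>t. gram (Y + t *\<^sub>R b)) has_vector_derivative (transpose b ** Y + transpose Y ** b)) (at 0)"
proof -
  have 1: "((\<lambda>t. Y + t *\<^sub>R b) has_vector_derivative b) (at 0)" by (rule has_vector_derivative_line)
  have 2: "((\<lambda>t. transpose (Y + t *\<^sub>R b)) has_vector_derivative transpose b) (at 0)"
    by (rule bounded_linear.has_vector_derivative[OF bounded_linear_transpose 1])
  show ?thesis using mmul.has_vector_derivative[OF 2 1] by (simp add: gram_def add.commute)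
qed

lemma has_vector_derivative_at_0_iff:
  fixes f :: "real \<Rightarrow> 'a::real_normed_vector"
  shows "(f has_vector_derivative f') (at 0) \<longleftrightarrow> ((\<lambda>t. (f t - f 0) /\<^sub>R t) \<longlongrightarrow> f') (at 0)"
proof -
  have "norm (f y - f 0 - (y - 0) *\<^sub>R f') / norm (y - 0) = norm ((f y - f 0) /\<^sub>R y - f')" if "y \<noteq> 0" for y
  proof -
    have "(f y - f 0) /\<^sub>R y - f' = (f y - f 0 - y *\<^sub>R f') /\<^sub>R y"
      using that by (simp add: scaleR_diff_right)
    then show ?thesis by (simp add: divide_inverse mult.commute)
  qed
  then have "((\<lambda>y. norm (f y - f 0 - (y - 0) *\<^sub>R f') / norm (y - 0)) \<longlongrightarrow> 0) (at 0)
      \<longleftrightarrow> ((\<lambda>y. norm ((f y - f 0) /\<^sub>R y - f')) \<longlongrightarrow> 0) (at 0)"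
    by (intro filterlim_cong refl) (auto simp: eventually_at_filter)
  then show ?thesis
    by (simp add: has_vector_derivative_def has_derivative_iff_norm bounded_linear_scaleR_left
        tendsto_norm_zero_iff LIM_zero_iff)
qed

text \<open>
  The resolvent identity.  Together with a uniform bound on the inverses it gives their continuity, and then
  their derivative \<open>- B M' B\<close>.
\<close>

lemma inverse_difference:
  fixes B0 B1 M0 M1 :: "real^'p^'p"
  assumes "B1 ** M1 = mat 1" "M0 ** B0 = mat 1"
  shows "B1 - B0 = - (B1 ** (M1 - M0) ** B0)"
  using assms by (simp add: mmul.diff_left mmul.diff_right matrix_mul_assoc[symmetric])

lemma tendsto_inverse_matrix:
  fixes M B :: "'a \<Rightarrow> real^'p^'p"
  assumes inv: "\<And>x. B x ** M x = mat 1" "M0 ** B0 = mat 1"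
    and bnd: "\<And>x. norm (B x) \<le> C" and M: "(M \<longlongrightarrow> M0) F"
  shows "(B \<longlongrightarrow> B0) F"
proof -
  obtain K where K: "K > 0" "\<And>A B. norm ((A::real^'p^'p) ** (B::real^'p^'p)) \<le> norm A * norm B * K"
    using mmul.pos_bounded by blast
  have bound: "norm (B x - B0) \<le> C * K * norm (M x - M0) * norm B0 * K" for x
  proof -
    have "norm (B x - B0) \<le> norm (B x ** (M x - M0)) * norm B0 * K"
      unfolding inverse_difference[OF inv] norm_minus_cancel by (rule K)
    also have "\<dots> \<le> (norm (B x) * norm (M x - M0) * K) * norm B0 * K"
      using K by (intro mult_right_mono) auto
    also have "\<dots> \<le> (C * norm (M x - M0) * K) * norm B0 * K"
      using K bnd by (intro mult_right_mono) auto
    finally show ?thesis by (simp add: mult_ac)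
  qed
  have "((\<lambda>x. C * K * norm (M x - M0) * norm B0 * K) \<longlongrightarrow> C * K * 0 * norm B0 * K) F"
    by (intro tendsto_intros tendsto_norm_zero LIM_zero M)
  then have "((\<lambda>x. C * K * norm (M x - M0) * norm B0 * K) \<longlongrightarrow> 0) F" by simp
  then have "((\<lambda>x. B x - B0) \<longlongrightarrow> 0) F"
    by (rule Lim_null_comparison[rotated]) (simp add: bound)
  then show ?thesis by (rule LIM_zero_cancel)
qed

lemma has_vector_derivative_matrix_inv:
  fixes M :: "real \<Rightarrow> real^'p^'p"
  assumes M: "(M has_vector_derivative M') (at 0)"
    and inv: "\<And>t. M t ** B t = mat 1" "\<And>t. B t ** M t = mat 1"
    and bnd: "\<And>t. norm (B t) \<le> C"
  shows "(B has_vector_derivative - (B 0 ** M' ** B 0)) (at 0)"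
proof -
  have "(M \<longlongrightarrow> M 0) (at 0)"
    using has_vector_derivative_continuous[OF M] by (simp add: isCont_def)
  then have B0: "(B \<longlongrightarrow> B 0) (at 0)" by (rule tendsto_inverse_matrix[OF inv(2) inv(1) bnd])
  have lim: "((\<lambda>t. (M t - M 0) /\<^sub>R t) \<longlongrightarrow> M') (at 0)"
    using M by (simp add: has_vector_derivative_at_0_iff)
  have "((\<lambda>t. - (B t ** ((M t - M 0) /\<^sub>R t) ** B 0)) \<longlongrightarrow> - (B 0 ** M' ** B 0)) (at 0)"
    by (intro tendsto_minus mmul.tendsto tendsto_const B0 lim)
  moreover have "- (B t ** ((M t - M 0) /\<^sub>R t) ** B 0) = (B t - B 0) /\<^sub>R t" for t
    unfolding inverse_difference[OF inv(2) inv(1)] by (simp add: mmul.scaleR_left mmul.scaleR_right)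
  ultimately show ?thesis by (simp add: has_vector_derivative_at_0_iff)
qed


section \<open>Divergence of the shrinkage field\<close>

lemma norm_matrix_le_sum_rows: "norm (B::real^'p^'m) \<le> (\<Sum>i\<in>UNIV. norm (B $ i))"
  unfolding norm_vec_def[of B] by (rule L2_set_le_sum) simp

lemma norm_sym_matrix_le:
  fixes B :: "real^'p^'p"
  assumes "transpose B = B" and "\<And>x. norm (B *v x) \<le> c * norm x"
  shows "norm B \<le> real CARD('p) * c"
proof -
  have "B $ i = B *v axis i 1" for i
    by (subst assms(1)[symmetric])
      (simp add: matrix_vector_mul_component vec_eq_iff inner_axis transpose_def)
  then have "norm (B $ i) \<le> c" for i using assms(2)[of "axis i 1"] by simp
  then have "(\<Sum>i\<in>UNIV. norm (B $ i)) \<le> (\<Sum>i\<in>(UNIV::'p set). c)" by (intro sum_mono)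
  then show ?thesis using norm_matrix_le_sum_rows[of B] by simp
qed

text \<open>
  One computation serves two purposes.  With \<open>\<rho> = r\<close>, \<open>\<sigma> = 0\<close>, \<open>A = S0 = S\<close> the variable \<open>Y\<close> is the observation
  \<open>X\<close> for a fixed scatter matrix.  With \<open>\<rho> = \<sigma> = 1\<close> the variable \<open>Y\<close> is one row of the sample that makes
  up the scatter matrix, \<open>S0\<close> collects the other rows and \<open>A = S0 + r X\<^sup>T X\<close>.  Because \<open>A\<close> is positive definite,
  the inverse of \<open>A + \<rho> Y\<^sup>T Y\<close> is bounded uniformly in \<open>Y\<close>, which makes every function below smooth with
  polynomial growth.
\<close>

context
  fixes A S0 :: "real^'p^'p" and \<rho> \<sigma> :: real
  assumes A: "pos_def A" and S0: "transpose S0 = S0" and \<rho>: "\<rho> \<ge> 0"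
begin

definition shrink_M :: "real^'p^'m \<Rightarrow> real^'p^'p" where "shrink_M Y = A + \<rho> *\<^sub>R gram Y"
definition shrink_S :: "real^'p^'m \<Rightarrow> real^'p^'p" where "shrink_S Y = S0 + \<sigma> *\<^sub>R gram Y"
definition shrink_B :: "real^'p^'m \<Rightarrow> real^'p^'p" where "shrink_B Y = matrix_inv (shrink_M Y)"
definition shrink_U :: "real^'p^'m \<Rightarrow> real^'p^'p" where "shrink_U Y = shrink_B Y ** shrink_S Y"
text \<open>
  This matrix arises from differentiation: along a direction \<open>b\<close> the derivative of \<open>U = B S\<close> is
  \<open>- B (\<rho> G') B S + B (\<sigma> G') = B G' (\<sigma> - \<rho> U)\<close>, where \<open>G' = b\<^sup>T Y + Y\<^sup>T b\<close> is the derivative of the Gram matrix.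
\<close>

definition shrink_K :: "real^'p^'m \<Rightarrow> real^'p^'p" where "shrink_K Y = \<sigma> *\<^sub>R mat 1 - \<rho> *\<^sub>R shrink_U Y"

lemma quad_shrink_M: "x \<bullet> (shrink_M Y *v x) = x \<bullet> (A *v x) + \<rho> * (norm (Y *v x))\<^sup>2"
  by (simp add: shrink_M_def matrix_vector_mult_add_rdistrib scaleR_matrix_vector_assoc[symmetric]
      inner_add_right inner_gram)

lemma pos_def_shrink_M: "pos_def (shrink_M Y)"
  unfolding pos_def_def quad_shrink_M
proof (intro conjI allI impI)
  show "transpose (shrink_M Y) = shrink_M Y"
    using pos_def_sym[OF A] by (simp add: shrink_M_def transpose_linear transpose_gram)
  show "0 < x \<bullet> (A *v x) + \<rho> * (norm (Y *v x))\<^sup>2" if "x \<noteq> 0" for x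
    using A that \<rho> by (intro add_pos_nonneg) (auto simp: pos_def_def)
qed

lemmas shrink_B_inverse = pos_def_matrix_inv[OF pos_def_shrink_M, folded shrink_B_def]

lemma norm_shrink_B_bounded: "\<exists>C. \<forall>Y::real^'p^'m. norm (shrink_B Y) \<le> C"
proof -
  obtain c where c: "c > 0" "\<And>x. c * (norm x)\<^sup>2 \<le> x \<bullet> (A *v x)"
    using pos_def_lower_bound[OF A] by blast
  have "norm (shrink_B Y *v x) \<le> 1 / c * norm x" for Y :: "real^'p^'m" and x
  proof -
    let ?v = "shrink_B Y *v x"
    have Mv: "shrink_M Y *v ?v = x"
      by (simp add: matrix_vector_mul_assoc shrink_B_inverse)
    have "c * (norm ?v)\<^sup>2 \<le> ?v \<bullet> (shrink_M Y *v ?v)"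
      using c(2)[of ?v] \<rho> by (simp add: quad_shrink_M add_increasing2)
    also have "\<dots> \<le> norm ?v * norm x" unfolding Mv by (rule norm_cauchy_schwarz)
    finally have "norm ?v * (c * norm ?v) \<le> norm ?v * norm x" by (simp add: power2_eq_square mult_ac)
    then have "c * norm ?v \<le> norm x" by (cases "norm ?v = 0") auto
    then show ?thesis using c(1) by (simp add: field_simps)
  qed
  then have "norm (shrink_B Y) \<le> real CARD('p) * (1 / c)" for Y :: "real^'p^'m"
    by (intro norm_sym_matrix_le shrink_B_inverse)
  then show ?thesis by blast
qed

lemma has_vector_derivative_shrink_U:
  fixes Y :: "real^'p^'m"
  shows "((\<lambda>t. shrink_U (Y + t *\<^sub>R b)) has_vector_derivative
     shrink_B Y ** (transpose b ** Y + transpose Y ** b) ** shrink_K Y) (at 0)"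
proof -
  let ?G' = "transpose b ** Y + transpose Y ** b"
  obtain C where C: "\<And>Y::real^'p^'m. norm (shrink_B Y) \<le> C" using norm_shrink_B_bounded by blast
  have M: "((\<lambda>t. shrink_M (Y + t *\<^sub>R b)) has_vector_derivative \<rho> *\<^sub>R ?G') (at 0)"
    unfolding shrink_M_def by (auto intro!: derivative_eq_intros has_vector_derivative_gram)
  have S: "((\<lambda>t. shrink_S (Y + t *\<^sub>R b)) has_vector_derivative \<sigma> *\<^sub>R ?G') (at 0)"
    unfolding shrink_S_def by (auto intro!: derivative_eq_intros has_vector_derivative_gram)
  have B: "((\<lambda>t. shrink_B (Y + t *\<^sub>R b)) has_vector_derivative - (shrink_B Y ** (\<rho> *\<^sub>R ?G') ** shrink_B Y)) (at 0)"
    using has_vector_derivative_matrix_inv[OF M shrink_B_inverse(1,2) C] by simp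
  show ?thesis
    using mmul.has_vector_derivative[OF B S]
    by (simp add: shrink_U_def shrink_K_def mmul.diff_right mmul.scaleR_left mmul.scaleR_right
        mmul.minus_left matrix_mul_assoc)
qed

lemma continuous_on_shrink_M: "continuous_on UNIV (shrink_M :: real^'p^'m \<Rightarrow> _)"
  and continuous_on_shrink_S: "continuous_on UNIV (shrink_S :: real^'p^'m \<Rightarrow> _)"
  unfolding shrink_M_def[abs_def] shrink_S_def[abs_def]
  by (intro continuous_intros continuous_on_gram)+

lemma continuous_on_shrink_B: "continuous_on UNIV (shrink_B :: real^'p^'m \<Rightarrow> _)"
proof -
  obtain C where C: "\<And>Y::real^'p^'m. norm (shrink_B Y) \<le> C" using norm_shrink_B_bounded by blast
  have M: "continuous_on UNIV (shrink_M :: real^'p^'m \<Rightarrow> _)" by (rule continuous_on_shrink_M)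
  show ?thesis unfolding continuous_on_def
  proof
    fix X :: "real^'p^'m"
    have "(shrink_M \<longlongrightarrow> shrink_M X) (at X)" using M by (simp add: continuous_on_def)
    then show "(shrink_B \<longlongrightarrow> shrink_B X) (at X within UNIV)"
      by (rule tendsto_inverse_matrix[OF shrink_B_inverse(2) shrink_B_inverse(1) C])
  qed
qed

lemma continuous_on_shrink_U: "continuous_on UNIV (shrink_U :: real^'p^'m \<Rightarrow> _)"
  unfolding shrink_U_def[abs_def]
  by (intro mmul.continuous_on continuous_on_shrink_B continuous_on_shrink_S)

lemma continuous_on_shrink_K: "continuous_on UNIV (shrink_K :: real^'p^'m \<Rightarrow> _)"
  unfolding shrink_K_def[abs_def] by (intro continuous_intros continuous_on_shrink_U)

lemma poly_growth_shrink_B: "poly_growth (shrink_B :: real^'p^'m \<Rightarrow> _)"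
proof -
  obtain C where C: "\<And>Y::real^'p^'m. norm (shrink_B Y) \<le> C" using norm_shrink_B_bounded by blast
  show ?thesis by (rule poly_growthI[of _ C 0]) (simp add: C)
qed

lemma poly_growth_shrink_U: "poly_growth (shrink_U :: real^'p^'m \<Rightarrow> _)"
  unfolding shrink_U_def[abs_def] shrink_S_def
  by (intro poly_growth_matrix_mult poly_growth_shrink_B poly_growth_add poly_growth_const
      poly_growth_scaleR poly_growth_gram)

lemma poly_growth_shrink_K: "poly_growth (shrink_K :: real^'p^'m \<Rightarrow> _)"
  unfolding shrink_K_def[abs_def]
  by (intro poly_growth_diff poly_growth_const poly_growth_scaleR poly_growth_shrink_U)

text \<open>
  \<open>U B = B S B\<close> is symmetric although \<open>U\<close> is not; the divergence formula below requires a symmetric factor.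
\<close>

lemma transpose_shrink_UB: "transpose (shrink_U Y ** shrink_B Y) = shrink_U Y ** shrink_B Y"
proof -
  have "transpose (shrink_S Y) = shrink_S Y"
    by (simp add: shrink_S_def transpose_linear transpose_gram S0)
  then show ?thesis
    by (simp add: shrink_U_def matrix_transpose_mul shrink_B_inverse matrix_mul_assoc)
qed

text \<open>
  The divergence contributed by one factor \<open>B G' D\<close> of a derivative, where \<open>G' = b\<^sup>T Y + Y\<^sup>T b\<close>.
  The result is linear in the Gram matrix, so that contributions of several rows add up to the scatter matrix.
\<close>

lemma sum_Basis_gram_derivative:
  fixes Y :: "real^'p^'m"
  assumes "transpose B = B"
  shows "(\<Sum>b\<in>Basis. (Y ** (B ** (transpose b ** Y + transpose Y ** b) ** D)) \<bullet> b)
     = trace (B ** gram Y ** D) + trace (B ** gram Y) * trace D"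
proof -
  have "(\<Sum>b\<in>Basis. (Y ** (B ** (transpose b ** Y + transpose Y ** b) ** D)) \<bullet> b)
    = (\<Sum>b\<in>Basis. ((Y ** B) ** transpose b ** (Y ** D)) \<bullet> b)
      + (\<Sum>b\<in>Basis. ((Y ** B ** transpose Y) ** b ** D) \<bullet> b)"
    by (simp add: mat_linear inner_add_left sum.distrib matrix_mul_assoc)
  also have "(\<Sum>b\<in>Basis. ((Y ** B) ** transpose b ** (Y ** D)) \<bullet> b) = trace (B ** gram Y ** D)"
    unfolding sum_Basis_sandwich_transpose
    by (simp add: inner_eq_trace matrix_transpose_mul assms gram_def matrix_mul_assoc)
  also have "(\<Sum>b\<in>Basis. ((Y ** B ** transpose Y) ** b ** D) \<bullet> b) = trace (B ** gram Y) * trace D"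
  proof -
    have "trace (Y ** (B ** transpose Y)) = trace ((B ** transpose Y) ** Y)" by (rule trace_mul_sym)
    then show ?thesis unfolding sum_Basis_sandwich by (simp add: gram_def matrix_mul_assoc)
  qed
  finally show ?thesis .
qed

lemma sum_Basis_mult_right:
  "(\<Sum>b\<in>(Basis::(real^'p^'m) set). (b ** D) \<bullet> b) = real CARD('m) * trace D"
  using sum_Basis_sandwich[of "mat 1 :: real^'m^'m" D] by (simp add: trace_I)

text \<open>
  The divergence of the field \<open>Y \<mapsto> Y U\<close>; the next definition is that of \<open>Y \<mapsto> Y U\<^sup>2\<close>.
\<close>

definition shrink_div1 :: "real^'p^'m \<Rightarrow> real" where
  "shrink_div1 Y = real CARD('m) * trace (shrink_U Y) + trace (shrink_B Y ** gram Y ** shrink_K Y)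
     + trace (shrink_B Y ** gram Y) * trace (shrink_K Y)"

definition shrink_div2 :: "real^'p^'m \<Rightarrow> real" where
  "shrink_div2 Y = real CARD('m) * trace (shrink_U Y ** shrink_U Y)
     + trace (shrink_B Y ** gram Y ** (shrink_K Y ** shrink_U Y))
     + trace (shrink_B Y ** gram Y) * trace (shrink_K Y ** shrink_U Y)
     + trace (shrink_U Y ** shrink_B Y ** gram Y ** shrink_K Y)
     + trace (shrink_U Y ** shrink_B Y ** gram Y) * trace (shrink_K Y)"

lemma has_vector_derivative_mult_shrink_U:
  assumes "(F has_vector_derivative F') (at 0)"
  shows "((\<lambda>t. F t ** shrink_U (Y + t *\<^sub>R b)) has_vector_derivative
     F' ** shrink_U Y + F 0 ** (shrink_B Y ** (transpose b ** Y + transpose Y ** b) ** shrink_K Y)) (at 0)"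
  using mmul.has_vector_derivative[OF assms has_vector_derivative_shrink_U[of Y b]]
  by (simp add: add.commute)

lemma stein_shrink1:
  assumes \<Sigma>: "pos_def \<Sigma>"
  shows "(\<integral>Y. ((Y - \<Theta>) ** matrix_inv \<Sigma>) \<bullet> (Y ** shrink_U Y) \<partial>matrix_normal \<Theta> (mat 1) \<Sigma>)
    = (\<integral>Y. shrink_div1 Y \<partial>matrix_normal (\<Theta>::real^'p^'m) (mat 1) \<Sigma>)"
proof -
  define H' where "H' = (\<lambda>b Y::real^'p^'m. b ** shrink_U Y
      + Y ** (shrink_B Y ** (transpose b ** Y + transpose Y ** b) ** shrink_K Y))"
  have div: "(\<Sum>b\<in>Basis. H' b Y \<bullet> b) = shrink_div1 Y" for Y
    unfolding H'_def inner_add_left sum.distrib sum_Basis_mult_right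
      sum_Basis_gram_derivative[OF shrink_B_inverse(3)] shrink_div1_def by simp
  show ?thesis
    unfolding div[symmetric]
  proof (rule stein_identity[OF \<Sigma>])
    fix b X :: "real^'p^'m"
    show "((\<lambda>t. (X + t *\<^sub>R b) ** shrink_U (X + t *\<^sub>R b)) has_vector_derivative H' b X) (at 0)"
      using has_vector_derivative_mult_shrink_U[OF has_vector_derivative_line, of X b X b]
      by (simp add: H'_def)
    show "continuous_on UNIV (\<lambda>Y::real^'p^'m. Y ** shrink_U Y)"
      by (intro mmul.continuous_on continuous_on_shrink_U continuous_intros)
    show "continuous_on UNIV (H' b)" unfolding H'_def
      by (intro mmul.continuous_on continuous_intros continuous_on_shrink_U continuous_on_shrink_B
          continuous_on_shrink_K bounded_linear.continuous_on[OF bounded_linear_transpose])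
    show "poly_growth (\<lambda>Y::real^'p^'m. Y ** shrink_U Y)"
      by (intro poly_growth_matrix_mult poly_growth_ident poly_growth_shrink_U)
    show "poly_growth (H' b)" unfolding H'_def
      by (intro poly_growth_add poly_growth_matrix_mult poly_growth_ident poly_growth_const
          poly_growth_transpose poly_growth_shrink_U poly_growth_shrink_B poly_growth_shrink_K)
  qed
qed

lemma stein_shrink2:
  assumes \<Sigma>: "pos_def \<Sigma>"
  shows "(\<integral>Y. ((Y - \<Theta>) ** matrix_inv \<Sigma>) \<bullet> (Y ** shrink_U Y ** shrink_U Y) \<partial>matrix_normal \<Theta> (mat 1) \<Sigma>)
    = (\<integral>Y. shrink_div2 Y \<partial>matrix_normal (\<Theta>::real^'p^'m) (mat 1) \<Sigma>)"
proof -
  define H' where "H' = (\<lambda>b Y::real^'p^'m. b ** (shrink_U Y ** shrink_U Y)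
      + Y ** (shrink_B Y ** (transpose b ** Y + transpose Y ** b) ** (shrink_K Y ** shrink_U Y))
      + Y ** ((shrink_U Y ** shrink_B Y) ** (transpose b ** Y + transpose Y ** b) ** shrink_K Y))"
  have div: "(\<Sum>b\<in>Basis. H' b Y \<bullet> b) = shrink_div2 Y" for Y
    unfolding H'_def inner_add_left sum.distrib sum_Basis_mult_right
      sum_Basis_gram_derivative[OF shrink_B_inverse(3)] sum_Basis_gram_derivative[OF transpose_shrink_UB]
      shrink_div2_def by simp
  show ?thesis
    unfolding div[symmetric]
  proof (rule stein_identity[OF \<Sigma>])
    fix b X :: "real^'p^'m"
    show "((\<lambda>t. (X + t *\<^sub>R b) ** shrink_U (X + t *\<^sub>R b) ** shrink_U (X + t *\<^sub>R b))
        has_vector_derivative H' b X) (at 0)"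
      using has_vector_derivative_mult_shrink_U[OF has_vector_derivative_mult_shrink_U[OF
          has_vector_derivative_line], of X b X b X b]
      by (simp add: H'_def mmul.add_left matrix_mul_assoc add.assoc)
    show "continuous_on UNIV (\<lambda>Y::real^'p^'m. Y ** shrink_U Y ** shrink_U Y)"
      by (intro mmul.continuous_on continuous_on_shrink_U continuous_intros)
    show "continuous_on UNIV (H' b)" unfolding H'_def
      by (intro mmul.continuous_on continuous_intros continuous_on_shrink_U continuous_on_shrink_B
          continuous_on_shrink_K bounded_linear.continuous_on[OF bounded_linear_transpose])
    show "poly_growth (\<lambda>Y::real^'p^'m. Y ** shrink_U Y ** shrink_U Y)"
      by (intro poly_growth_matrix_mult poly_growth_ident poly_growth_shrink_U)
    show "poly_growth (H' b)" unfolding H'_def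
      by (intro poly_growth_add poly_growth_matrix_mult poly_growth_ident poly_growth_const
          poly_growth_transpose poly_growth_shrink_U poly_growth_shrink_B poly_growth_shrink_K)
  qed
qed

end


section \<open>The inequality for the eigenvalues\<close>

text \<open>
  Two steps.  With \<open>u = sqrt (1 - k g)\<close>, the inequality \<open>- 2 ln u \<le> 1 / u - u\<close> bounds the left side by
  \<open>k g / u\<close>.  The convex function \<open>g \<mapsto> 1 / sqrt (1 - k g)\<close> lies below its chord over \<open>[0,1]\<close>.  The bound must
  stay good up to \<open>k = 8 / 9\<close>: the cruder \<open>k g + (k g)\<^sup>2 / (2 (1 - k))\<close> is too weak for
  small \<open>n\<close> and large \<open>m\<close>.
\<close>

lemma neg_ln_one_minus_le:
  fixes g k :: real
  assumes g: "0 < g" "g \<le> 1" and k: "0 < k" "k < 1"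
  shows "- ln (1 - k * g) \<le> k * g + k * g\<^sup>2 * (1 / sqrt (1 - k) - 1)"
proof -
  define u y where "u = sqrt (1 - k * g)" and "y = sqrt (1 - k)"
  have kg: "k * g \<le> k" "0 < k * g" using g k by auto
  have y: "0 < y" "y \<le> u" using k kg by (auto simp: u_def y_def)
  have u: "0 < u" "u < 1" using y(1,2) kg by (auto simp: u_def simp del: real_sqrt_gt_0_iff)
  have y1: "y < 1" using y u by linarith
  have "k * g \<le> 1" using kg k by linarith
  then have u2: "u\<^sup>2 = 1 - k * g" by (simp add: u_def)
  have y2: "y\<^sup>2 = 1 - k" using k by (simp add: y_def)
  have ln_bound: "- ln (1 - k * g) \<le> 1 / u - u"
  proof -
    have "x - 1 / x \<le> 2 * ln x" if "0 < x" "x \<le> 1" for x :: real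
    proof -
      have "(\<lambda>t. 2 * ln t - t + 1 / t) 1 \<le> (\<lambda>t. 2 * ln t - t + 1 / t) x"
      proof (rule DERIV_nonpos_imp_nonincreasing[OF that(2)])
        fix t assume t: "x \<le> t" "t \<le> 1"
        have "((\<lambda>t. 2 * ln t - t + 1 / t) has_real_derivative (2 / t - 1 - 1 / t\<^sup>2)) (at t)"
          using t that by (auto intro!: derivative_eq_intros simp: power2_eq_square)
        moreover have "2 / t - 1 - 1 / t\<^sup>2 = - ((1 - 1 / t)\<^sup>2)"
          using t that by (simp add: power2_diff power_divide)
        ultimately show "\<exists>D. ((\<lambda>t. 2 * ln t - t + 1 / t) has_real_derivative D) (at t) \<and> D \<le> 0"
          by (metis neg_le_0_iff_le zero_le_power2)
      qed
      then show ?thesis by simp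
    qed
    from this[of u] u have "u - 1 / u \<le> 2 * ln u" by simp
    moreover have "2 * ln u = ln (1 - k * g)"
      using u2 u(1) by (metis ln_realpow of_nat_numeral)
    ultimately show ?thesis by linarith
  qed
  have conv: "1 / u - 1 \<le> g * (1 / y - 1)"
  proof -
    have eq: "g * (1 - y\<^sup>2) = 1 - u\<^sup>2" by (simp add: u2 y2)
    have "y * (1 + y) \<le> u * (1 + u)" using y u by (intro mult_mono) auto
    then have "(1 - u) * (y * (1 + y)) \<le> (1 - u) * (u * (1 + u))" using u by (intro mult_left_mono) auto
    also have "\<dots> = u * (1 - u\<^sup>2)" by (simp add: power2_eq_square algebra_simps)
    also have "\<dots> = (g * u * (1 - y)) * (1 + y)" unfolding eq[symmetric] by (simp add: power2_eq_square algebra_simps)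
    finally have "((1 - u) * y) * (1 + y) \<le> (g * u * (1 - y)) * (1 + y)" by (simp add: mult_ac)
    then have "(1 - u) * y \<le> g * u * (1 - y)" using y by (simp add: mult_le_cancel_right)
    then have "(1 - u) / u \<le> g * (1 - y) / y" using u y by (simp add: field_simps)
    then show ?thesis using u y by (simp add: diff_divide_distrib right_diff_distrib)
  qed
  have "1 / u - u = (1 - u\<^sup>2) + (1 - u\<^sup>2) * (1 / u - 1)"
    using u by (simp add: field_simps power2_eq_square)
  also have "\<dots> = k * g + k * g * (1 / u - 1)" by (simp add: u2)
  also have "\<dots> \<le> k * g + k * g * (g * (1 / y - 1))"
    using conv kg by (intro add_left_mono mult_left_mono) auto
  finally show ?thesis using ln_bound by (simp add: y_def power2_eq_square mult_ac)
qed

text \<open>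
  Here \<open>T1\<close>, \<open>T2\<close>, \<open>T3\<close> are the power sums of the eigenvalues of the shrinkage matrix and \<open>\<Lambda>\<close> is the logarithmic term.
  Let \<open>K = 2 n (p + 1) + d (n + p + 1)\<close> and \<open>y = 2 n + 2 - d / 2\<close>.  The hypothesis on \<open>d\<close> says \<open>K \<le> m y\<close>; in
  particular \<open>d < 4 n + 4 \<le> 8 n\<close>, which means \<open>s < 3\<close>.  Splitting off four nonnegative terms leaves
  \<open>m n (3 - s) T2 + (m - 2 n) (p T2 - T1\<^sup>2)\<close>.  The second summand can only be negative for \<open>m < 2 n\<close>, and then
  \<open>p T2 - T1\<^sup>2 \<le> (p - 1) T2\<close> reduces the claim to \<open>2 n (p - 1) < m n (3 - s) + m (p - 1)\<close>.
  For \<open>p \<ge> 3\<close> this follows from \<open>n (3 - s) \<ge> y - 2\<close> and \<open>m y \<ge> K\<close>, for \<open>p = 1\<close> it is immediate, and for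
  \<open>p = 2\<close> the hypothesis excludes \<open>m = 2\<close>, after which \<open>s < 7 / 3 + 1 / n\<close> suffices.
\<close>

lemma risk_bound_scalar:
  fixes m n p :: nat and d s T1 T2 T3 \<Lambda> :: real
  assumes p1: "1 \<le> p" and pn: "p \<le> n" and pm: "p \<le> m"
    and d: "real p - 1 < d"
    and hyp: "d * (real n + real m / 2 + real p + 1) \<le> 2 * real n * (real m - real p - 1) + 2 * real m"
    and s: "s \<ge> 1" "s\<^sup>2 = 1 + d / real n"
    and T: "0 < T2" "T2 \<le> T1" "T3 \<le> T2" "T2 \<le> T1\<^sup>2" "T1\<^sup>2 \<le> real p * T2"
    and \<Lambda>: "- (real n * T1 + real n * T2 * (s - 1)) \<le> \<Lambda>"
  shows "0 < real m * ((real n + real p + 1) * T1 - T2 - T1\<^sup>2) + real m * \<Lambda>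
     + 2 * real n * ((real m - real p - 1) * T1 + T2 + T1\<^sup>2)
     + d * (- (real n + real p + 1) * T1 + (real n + real p + 3) * T2 + 2 * T1\<^sup>2 - 2 * T3 - 2 * (T1 * T2))"
    (is "0 < ?F")
proof -
  let ?n = "real n" and ?m = "real m" and ?p = "real p"
  have n1: "?n \<ge> 1" using p1 pn by simp
  have p1': "?p \<ge> 1" using p1 by simp
  have m1: "?m \<ge> 1" using p1 pm by simp
  have d0: "d > 0" using d p1' by linarith
  define K where "K = 2 * ?n * (?p + 1) + d * (?n + ?p + 1)"
  define y where "y = 2 * ?n + 2 - d / 2"
  have Kpos: "K > 0" unfolding K_def using d0 n1 p1' by (intro add_pos_pos mult_pos_pos) auto
  have Ky: "K \<le> ?m * y" using hyp by (simp add: K_def y_def algebra_simps)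
  have y: "y > 0" using Kpos Ky m1 by (smt (verit) zero_less_mult_iff)
  have "d / ?n < 8" using y n1 by (simp add: y_def field_simps)
  then have "s\<^sup>2 < 3\<^sup>2" using s by simp
  then have s3: "s < 3" by (rule power2_less_imp_less) simp
  have T1: "T1 > 0" using T by linarith
  have TT: "T1 * T2 \<le> T1\<^sup>2" using T T1 by (simp add: power2_eq_square)
  define Q where "Q = T1\<^sup>2"
  define P where "P = T1 * T2"
  have A: "0 \<le> d * (2 * (T2 - T3) + 2 * (Q - P))"
    using T(3) TT d0 by (simp add: Q_def P_def)
  have B: "0 \<le> ?m * (\<Lambda> + ?n * T1 + ?n * T2 * (s - 1))" using \<Lambda> m1 by simp
  have C: "0 \<le> (?m * y - K) * (T1 - T2)" using Ky T by simp
  have D: "0 \<le> ?m * ((?p - 1 + d / 2) * (T1 - T2))" using T d0 p1' by simp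
  have "?F = (?m * ?n * (3 - s) * T2 + (?m - 2 * ?n) * (?p * T2 - Q))
    + d * (2 * (T2 - T3) + 2 * (Q - P)) + ?m * (\<Lambda> + ?n * T1 + ?n * T2 * (s - 1))
    + (?m * y - K) * (T1 - T2) + ?m * ((?p - 1 + d / 2) * (T1 - T2))"
    unfolding Q_def[symmetric] P_def[symmetric] K_def y_def by (simp add: algebra_simps)
  then have F3: "?m * ?n * (3 - s) * T2 + (?m - 2 * ?n) * (?p * T2 - T1\<^sup>2) \<le> ?F"
    using A B C D unfolding Q_def[symmetric] P_def[symmetric] by linarith
  have pos: "?m * ?n * (3 - s) * T2 > 0" using m1 n1 s3 T by simp
  have "?m * ?n * (3 - s) * T2 + (?m - 2 * ?n) * (?p * T2 - T1\<^sup>2) > 0"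
  proof (cases "?m \<ge> 2 * ?n")
    case True
    then have "(?m - 2 * ?n) * (?p * T2 - T1\<^sup>2) \<ge> 0" using T by simp
    then show ?thesis using pos by linarith
  next
    case False
    have key: "2 * ?n * (?p - 1) < ?m * ?n * (3 - s) + ?m * (?p - 1)"
    proof -
      consider "p = 1" | "p = 2" | "p \<ge> 3" using p1 by linarith
      then show ?thesis
      proof cases
        case 1 then show ?thesis using m1 n1 s3 by simp
      next
        case 2
        have n2: "?n \<ge> 2" using 2 pn by simp
        have "m \<noteq> 2"
        proof
          assume "m = 2"
          then have "d * (?n + 4) \<le> 4 - 2 * ?n" using hyp 2 by (simp add: algebra_simps)
          moreover have "d * (?n + 4) > 0" using d0 n1 by simp
          ultimately show False using n2 by simp
        qed
        then have m3: "?m \<ge> 3" using pm 2 by simp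
        have "d / ?n < 4 + 4 / ?n" using y n1 by (simp add: y_def field_simps)
        then have "s\<^sup>2 < 5 + 4 / ?n" using s by simp
        also have "\<dots> \<le> (7 / 3 + 1 / ?n)\<^sup>2"
        proof -
          define x where "x = 1 / ?n"
          have "x > 0" using n1 by (simp add: x_def)
          moreover have "(7 / 3 + x)\<^sup>2 = 49 / 9 + 14 / 3 * x + x\<^sup>2" by (simp add: power2_eq_square algebra_simps)
          ultimately have "5 + 4 * x \<le> (7 / 3 + x)\<^sup>2" using zero_le_power2[of x] by linarith
          then show ?thesis by (simp add: x_def)
        qed
        finally have "s < 7 / 3 + 1 / ?n" by (rule power2_less_imp_less) (use n1 in simp)
        then have "?n * s < 7 / 3 * ?n + 1" using n1 by (simp add: field_simps)
        then have "2 / 3 * ?n < ?n * (3 - s) + 1" by (simp add: algebra_simps)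
        then have "3 * (2 / 3 * ?n) < 3 * (?n * (3 - s) + 1)" by simp
        also have "\<dots> \<le> ?m * (?n * (3 - s) + 1)" using m3 n1 s3 by (intro mult_right_mono) auto
        finally show ?thesis using 2 by (simp add: algebra_simps)
      next
        case 3
        have "s\<^sup>2 \<le> (1 + d / (2 * ?n))\<^sup>2"
          using s d0 n1 by (simp add: power2_sum)
        then have "s \<le> 1 + d / (2 * ?n)" by (rule power2_le_imp_le) (use d0 n1 in simp)
        then have "?n * s \<le> ?n * (1 + d / (2 * ?n))" using n1 by (intro mult_left_mono) auto
        moreover have "?n * (1 + d / (2 * ?n)) = ?n + d / 2" using n1 by (simp add: field_simps)
        moreover have "?n * (3 - s) = 3 * ?n - ?n * s" by (simp add: algebra_simps)
        ultimately have "y - 2 \<le> ?n * (3 - s)" unfolding y_def by linarith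
        then have "?m * (y - 2) \<le> ?m * (?n * (3 - s))" by (intro mult_left_mono) auto
        moreover have "?m * 2 \<le> ?m * (?p - 1)" using 3 by (intro mult_left_mono) auto
        moreover have "2 * ?n * (?p - 1) < K"
        proof -
          have "2 * ?n * (?p - 1) < 2 * ?n * (?p + 1)" using n1 by simp
          moreover have "d * (?n + ?p + 1) > 0" using d0 n1 p1' by simp
          ultimately show ?thesis unfolding K_def by linarith
        qed
        ultimately show ?thesis using Ky by (simp add: algebra_simps)
      qed
    qed
    have "(2 * ?n - ?m) * (?p * T2 - T1\<^sup>2) \<le> (2 * ?n - ?m) * ((?p - 1) * T2)"
      using False T by (intro mult_left_mono) (auto simp: algebra_simps)
    moreover have "2 * ?n * (?p - 1) * T2 < (?m * ?n * (3 - s) + ?m * (?p - 1)) * T2"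
      using key T by (intro mult_strict_right_mono) auto
    ultimately show ?thesis by (simp add: algebra_simps)
  qed
  then show ?thesis using F3 by linarith
qed

lemma risk_difference_pos:
  fixes m n :: nat and d k :: real and g :: "real^'p"
  assumes pn: "CARD('p) \<le> n" and pm: "CARD('p) \<le> m"
    and d: "real CARD('p) - 1 < d"
    and hyp: "d * (real n + real m / 2 + real CARD('p) + 1)
      \<le> 2 * real n * (real m - real CARD('p) - 1) + 2 * real m"
    and k: "k = d / (real n + d)"
    and g: "\<And>i. 0 < g $ i" "\<And>i. g $ i \<le> 1"
  defines "T1 \<equiv> \<Sum>i\<in>UNIV. g $ i" and "T2 \<equiv> \<Sum>i\<in>UNIV. (g $ i)\<^sup>2" and "T3 \<equiv> \<Sum>i\<in>UNIV. (g $ i) ^ 3"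
  shows "0 < real m * ((real n + real CARD('p) + 1) * T1 - T2 - T1\<^sup>2)
     + real m * (real n / k * (\<Sum>i\<in>UNIV. ln (1 - k * g $ i)))
     + 2 * real n * ((real m - real CARD('p) - 1) * T1 + T2 + T1\<^sup>2)
     + d * (- (real n + real CARD('p) + 1) * T1 + (real n + real CARD('p) + 3) * T2 + 2 * T1\<^sup>2 - 2 * T3 - 2 * (T1 * T2))"
proof (rule risk_bound_scalar[where s="sqrt (1 + d / real n)"])
  have p1: "1 \<le> CARD('p)" using one_le_card_finite by simp
  then show "1 \<le> CARD('p)" .
  have p1': "1 \<le> real CARD('p)" using p1 by simp
  have n: "real n \<ge> 1" using order_trans[OF p1 pn] by simp
  have d0: "d > 0" using d p1' by linarith
  have k01: "0 < k" "k < 1" using k d0 n by auto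
  show "1 \<le> sqrt (1 + d / real n)" "(sqrt (1 + d / real n))\<^sup>2 = 1 + d / real n" using d0 n by auto
  have g0: "0 \<le> g $ i" for i using g(1)[of i] by simp
  show "0 < T2" unfolding T2_def using g by (intro sum_pos) (auto simp: less_imp_neq[THEN not_sym])
  show "T2 \<le> T1" unfolding T1_def T2_def using g g0
    by (intro sum_mono) (simp add: power2_eq_square mult_left_le)
  show "T3 \<le> T2" unfolding T3_def T2_def using g g0
    by (intro sum_mono power_decreasing) auto
  show "T1\<^sup>2 \<le> real CARD('p) * T2"
    unfolding T1_def T2_def using Cauchy_Schwarz_ineq_sum[of "\<lambda>i. 1" "\<lambda>i. g $ i" UNIV] by simp
  show "T2 \<le> T1\<^sup>2"
  proof -
    have "T1\<^sup>2 = (\<Sum>i\<in>UNIV. \<Sum>j\<in>UNIV. g $ i * g $ j)"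
      by (simp add: T1_def power2_eq_square sum_product)
    moreover have "(g $ i)\<^sup>2 \<le> (\<Sum>j\<in>UNIV. g $ i * g $ j)" for i
      unfolding power2_eq_square using g0
      by (intro member_le_sum[of i UNIV "\<lambda>j. g $ i * g $ j"]) auto
    ultimately show ?thesis unfolding T2_def by (simp add: sum_mono)
  qed
  let ?s = "sqrt (1 + d / real n)"
  have s: "?s = 1 / sqrt (1 - k)"
  proof -
    have "1 - k = 1 / (1 + d / real n)" using n d0 by (simp add: k field_simps)
    then show ?thesis by (simp add: real_sqrt_divide)
  qed
  have "- (real n * g $ i + real n * (g $ i)\<^sup>2 * (?s - 1)) \<le> real n / k * ln (1 - k * g $ i)" for i
  proof -
    have "real n / k * (- ln (1 - k * g $ i)) \<le> real n / k * (k * g $ i + k * (g $ i)\<^sup>2 * (?s - 1))"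
      unfolding s using n k01 g by (intro mult_left_mono neg_ln_one_minus_le) auto
    also have "\<dots> = real n * g $ i + real n * (g $ i)\<^sup>2 * (?s - 1)"
      using k01 by (simp add: field_simps)
    finally show ?thesis by simp
  qed
  then have "(\<Sum>i\<in>UNIV. - (real n * g $ i + real n * (g $ i)\<^sup>2 * (?s - 1)))
      \<le> (\<Sum>i\<in>UNIV. real n / k * ln (1 - k * g $ i))" by (intro sum_mono)
  then show "- (real n * T1 + real n * T2 * (?s - 1)) \<le> real n / k * (\<Sum>i\<in>UNIV. ln (1 - k * g $ i))"
    by (simp add: T1_def T2_def sum_distrib_left sum_distrib_right sum_negf sum.distrib sum_subtractf)
qed (use assms in auto)


section \<open>Coordinates that diagonalize the shrinkage matrix\<close>

definition pos_semidef :: "real^'n^'n \<Rightarrow> bool" where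
  "pos_semidef A \<longleftrightarrow> transpose A = A \<and> (\<forall>x. 0 \<le> x \<bullet> (A *v x))"

lemma pos_semidef_gram: "pos_semidef (gram Y)"
  by (simp add: pos_semidef_def transpose_gram inner_gram)

lemma pos_semidef_add: "pos_semidef A \<Longrightarrow> pos_semidef B \<Longrightarrow> pos_semidef (A + B)"
  by (simp add: pos_semidef_def transpose_linear matrix_vector_mult_add_rdistrib inner_add_right)

lemma pos_semidef_0: "pos_semidef 0"
  by (simp add: pos_semidef_def transpose_def vec_eq_iff)

lemma pos_semidef_sum: "(\<And>i. i \<in> I \<Longrightarrow> pos_semidef (A i)) \<Longrightarrow> pos_semidef (\<Sum>i\<in>I. A i)"
  by (induction I rule: infinite_finite_induct) (auto intro: pos_semidef_add pos_semidef_0)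

lemma pos_def_add_semidef:
  "pos_def A \<Longrightarrow> pos_semidef B \<Longrightarrow> r \<ge> 0 \<Longrightarrow> pos_def (A + r *\<^sub>R B)"
  by (auto simp: pos_def_def pos_semidef_def transpose_linear matrix_vector_mult_add_rdistrib
      inner_add_right scaleR_matrix_vector_assoc[symmetric] intro!: add_pos_nonneg)

definition ridge_inv :: "real \<Rightarrow> real^'p^'p \<Rightarrow> real^'p^'p \<Rightarrow> real^'p^'p" where
  "ridge_inv r S W = matrix_inv (S + r *\<^sub>R W)"

text \<open>
  \<open>(S + r W)\<^sup>-\<^sup>1 S = (1 + r S\<^sup>-\<^sup>1 W)\<^sup>-\<^sup>1\<close>: the matrix inverse that both estimators contain, written without the inverse
  of \<open>S\<close>.
\<close>

definition shrinkage :: "real \<Rightarrow> real^'p^'p \<Rightarrow> real^'p^'p \<Rightarrow> real^'p^'p" where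
  "shrinkage r S W = ridge_inv r S W ** S"

lemma left_cancel: "A ** B = mat 1 \<Longrightarrow> A ** (B ** X) = X"
  for A :: "real^'p^'q" and X :: "real^'s^'q"
  by (metis matrix_mul_assoc matrix_mul_lid)

lemma diag_mult_left: "diag a ** (diag b ** X) = diag (a * b) ** X" for X :: "real^'s^'p"
  by (simp add: matrix_mul_assoc diag_mult)

lemma norm_sq_columns: "(norm (A::real^'p^'m))\<^sup>2 = (\<Sum>j\<in>UNIV. (norm (A *v axis j 1))\<^sup>2)"
proof -
  have "(norm A)\<^sup>2 = trace (gram A)" by (simp add: power2_norm_eq_inner inner_eq_trace gram_def)
  also have "\<dots> = (\<Sum>j\<in>UNIV. axis j 1 \<bullet> (gram A *v axis j 1))"
    by (simp add: trace_def inner_axis' matrix_vector_mul_component inner_axis)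
  finally show ?thesis by (simp add: inner_gram)
qed

lemma diag_axis: "diag a *v axis j 1 = a $ j *\<^sub>R axis j 1"
  by (auto simp: vec_eq_iff matrix_vector_mul_component inner_axis diag_def) (auto simp: axis_def)

lemma norm_sq_mult_diag:
  "(norm ((A::real^'p^'m) ** diag a))\<^sup>2 = (\<Sum>j\<in>UNIV. (a $ j)\<^sup>2 * (norm (A *v axis j 1))\<^sup>2)"
  by (simp add: norm_sq_columns matrix_vector_mul_assoc[symmetric] diag_axis matrix_vector_mult_scaleR
      power_mult_distrib)

text \<open>
  In the coordinates given by \<open>J = L\<^sup>-\<^sup>1\<close> the form \<open>S\<close> is the identity, \<open>r W\<close> is diagonal with entries
  \<open>1 / g - 1\<close>, and the shrinkage matrix \<open>L diag g J\<close> has the eigenvalues \<open>g\<close>.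
\<close>

locale coords =
  fixes r :: real and S W J L :: "real^'p^'p" and g :: "real^'p"
  assumes r: "r > 0" and S: "pos_def S" and W: "pos_semidef W"
    and JL: "J ** L = mat 1" and LJ: "L ** J = mat 1"
    and SJ: "S = transpose J ** J"
    and g: "\<And>i. 0 < g $ i" "\<And>i. g $ i \<le> 1"
    and BL: "ridge_inv r S W = L ** diag g ** transpose L"
begin

lemma trans_inv: "transpose J ** transpose L = mat 1" "transpose L ** transpose J = mat 1"
  using JL LJ by (metis matrix_transpose_mul transpose_mat)+

lemmas cancel = JL LJ trans_inv left_cancel[OF JL] left_cancel[OF LJ]
  left_cancel[OF trans_inv(1)] left_cancel[OF trans_inv(2)]

lemma UL: "shrinkage r S W = L ** diag g ** J"
  unfolding shrinkage_def BL by (simp add: SJ matrix_mul_assoc[symmetric] cancel)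

lemma pos_def_M: "pos_def (S + r *\<^sub>R W)"
  using S W r by (intro pos_def_add_semidef) auto

lemma B_inverse: "ridge_inv r S W ** (S + r *\<^sub>R W) = mat 1" "(S + r *\<^sub>R W) ** ridge_inv r S W = mat 1"
  using pos_def_matrix_inv[OF pos_def_M] by (simp_all add: ridge_inv_def)

lemma BW: "r *\<^sub>R (ridge_inv r S W ** W) = mat 1 - shrinkage r S W"
  using B_inverse(1) by (simp add: shrinkage_def mmul.add_right mmul.scaleR_right algebra_simps)

lemma trace_coords: "trace (L ** diag a ** J) = (\<Sum>i\<in>UNIV. a $ i)"
proof -
  have "trace ((L ** diag a) ** J) = trace (J ** (L ** diag a))" by (rule trace_mul_sym)
  then show ?thesis by (simp add: cancel trace_diag)
qed

lemma coords_mult: "(L ** diag a ** J) ** (L ** diag b ** J) = L ** diag (a * b) ** J"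
  by (simp add: matrix_mul_assoc[symmetric] cancel diag_mult_left)

lemma trace_U: "trace (shrinkage r S W) = (\<Sum>i\<in>UNIV. g $ i)"
  "trace (shrinkage r S W ** shrinkage r S W) = (\<Sum>i\<in>UNIV. (g $ i)\<^sup>2)"
  "trace (shrinkage r S W ** shrinkage r S W ** shrinkage r S W) = (\<Sum>i\<in>UNIV. (g $ i) ^ 3)"
  unfolding UL coords_mult trace_coords
  by (simp_all add: power2_eq_square power3_eq_cube)

lemma norm_J: "(norm J)\<^sup>2 = trace S"
  by (simp add: power2_norm_eq_inner inner_eq_trace SJ)

text \<open>
  The hypothesis says that the Gram matrix of \<open>Y\<close> is at most \<open>S\<close>, which is the identity in the new coordinates.
\<close>

lemma column_bound:
  fixes Y :: "real^'p^'m"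
  assumes "\<And>x. (norm (Y *v x))\<^sup>2 \<le> x \<bullet> (S *v x)"
  shows "(norm ((Y ** L) *v axis j 1))\<^sup>2 \<le> 1"
proof -
  have "(norm ((Y ** L) *v axis j 1))\<^sup>2 \<le> (L *v axis j 1) \<bullet> (S *v (L *v axis j 1))"
    using assms[of "L *v axis j 1"] by (simp add: matrix_vector_mul_assoc)
  also have "\<dots> = (norm (J *v (L *v axis j 1)))\<^sup>2"
    using inner_gram[of _ J] by (simp add: SJ gram_def)
  also have "\<dots> = 1" by (simp add: matrix_vector_mul_assoc JL)
  finally show ?thesis .
qed

text \<open>
  The shrinkage matrix itself may have a large norm.  Its product with a matrix whose Gram matrix is at most \<open>S\<close>
  is controlled: such a matrix has bounded coordinates, and only the passage back from the coordinates costs the factor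
  \<open>norm J = sqrt (trace S)\<close>.
\<close>

lemma norm_mult_U_le:
  fixes Y :: "real^'p^'m"
  assumes Y: "\<And>x. (norm (Y *v x))\<^sup>2 \<le> x \<bullet> (S *v x)"
    and K: "\<And>A B. norm ((A::real^'p^'m) ** (B::real^'p^'p)) \<le> norm A * norm B * K" "K \<ge> 0"
  shows "norm (Y ** shrinkage r S W) \<le> sqrt CARD('p) * sqrt (trace S) * K"
    "norm (Y ** shrinkage r S W ** shrinkage r S W) \<le> sqrt CARD('p) * sqrt (trace S) * K"
proof -
  have nJ: "norm J = sqrt (trace S)" using norm_J by (metis norm_ge_zero real_sqrt_unique)
  have *: "norm (Y ** L ** diag a ** J) \<le> sqrt CARD('p) * sqrt (trace S) * K"
    if a: "\<And>j. 0 \<le> a $ j" "\<And>j. a $ j \<le> 1" for a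
  proof -
    have "(norm (Y ** L ** diag a))\<^sup>2 \<le> (\<Sum>j\<in>(UNIV::'p set). 1)"
      unfolding norm_sq_mult_diag
    proof (intro sum_mono)
      fix j :: 'p
      have "(a $ j)\<^sup>2 * (norm ((Y ** L) *v axis j 1))\<^sup>2 \<le> 1 * 1"
        using a column_bound[OF Y, of j] by (intro mult_mono) (auto simp: power_le_one)
      then show "(a $ j)\<^sup>2 * (norm ((Y ** L) *v axis j 1))\<^sup>2 \<le> 1" by simp
    qed
    then have "norm (Y ** L ** diag a) \<le> sqrt CARD('p)" by (simp add: real_le_rsqrt)
    then have "norm (Y ** L ** diag a) * norm J * K \<le> sqrt CARD('p) * norm J * K"
      using K(2) by (intro mult_right_mono) auto
    then show ?thesis using K(1)[of "Y ** L ** diag a" J] nJ by simp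
  qed
  have g': "0 \<le> g $ j" for j using g(1)[of j] by simp
  show "norm (Y ** shrinkage r S W) \<le> sqrt CARD('p) * sqrt (trace S) * K"
    using *[of g] g g' by (simp add: UL matrix_mul_assoc)
  have "Y ** shrinkage r S W ** shrinkage r S W = Y ** L ** diag (g * g) ** J"
    unfolding matrix_mul_assoc[symmetric, of Y] UL coords_mult by (simp add: matrix_mul_assoc)
  then show "norm (Y ** shrinkage r S W ** shrinkage r S W) \<le> sqrt CARD('p) * sqrt (trace S) * K"
    using *[of "g * g"] g g' by (simp add: mult_le_one)
qed

lemma WL: "transpose L ** W ** L = diag (\<chi> i. (1 / g $ i - 1) / r)"
proof -
  let ?M = "S + r *\<^sub>R W"
  have 1: "(transpose L ** ?M ** L) ** diag g = mat 1"
  proof -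
    have "transpose L ** (?M ** (L ** diag g ** transpose L)) ** transpose J = transpose L ** mat 1 ** transpose J"
      using B_inverse(2) unfolding BL by simp
    then show ?thesis by (simp add: matrix_mul_assoc[symmetric] cancel)
  qed
  have gd: "diag g ** diag (\<chi> i. 1 / g $ i) = mat 1"
  proof -
    have "g * (\<chi> i. 1 / g $ i) = 1" using g(1) by (simp add: vec_eq_iff less_imp_neq[THEN not_sym])
    then show ?thesis by (simp add: diag_mult diag_linear(4))
  qed
  have "transpose L ** ?M ** L = diag (\<chi> i. 1 / g $ i)"
    using arg_cong[OF 1, of "\<lambda>A. A ** diag (\<chi> i. 1 / g $ i)"]
    by (simp add: matrix_mul_assoc[symmetric] gd)
  moreover have "transpose L ** ?M ** L = mat 1 + r *\<^sub>R (transpose L ** W ** L)"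
    by (simp add: mmul.add_left mmul.add_right mmul.scaleR_left mmul.scaleR_right SJ
        matrix_mul_assoc[symmetric] cancel)
  ultimately have "r *\<^sub>R (transpose L ** W ** L) = diag (\<chi> i. 1 / g $ i) - mat 1"
    by (simp add: algebra_simps)
  then have "(1 / r) *\<^sub>R (r *\<^sub>R (transpose L ** W ** L)) = (1 / r) *\<^sub>R (diag (\<chi> i. 1 / g $ i) - mat 1)"
    by simp
  then show ?thesis using r by (auto simp: diag_def mat_def vec_eq_iff)
qed

text \<open>
  The same for the observation matrix.  Its coordinates are unbounded, but they are damped by \<open>g\<close>:
  \<open>g\<^sup>2 (1 / g - 1) = g (1 - g) \<le> 1\<close>.
\<close>

lemma norm_mult_U_le':
  fixes X :: "real^'p^'m"
  assumes WX: "W = gram X"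
    and K: "\<And>A B. norm ((A::real^'p^'m) ** (B::real^'p^'p)) \<le> norm A * norm B * K" "K \<ge> 0"
  shows "norm (X ** shrinkage r S W) \<le> sqrt (CARD('p) / r) * sqrt (trace S) * K"
proof -
  have nJ: "norm J = sqrt (trace S)" using norm_J by (metis norm_ge_zero real_sqrt_unique)
  have col: "(norm ((X ** L) *v axis j 1))\<^sup>2 = (1 / g $ j - 1) / r" for j
  proof -
    have "(norm ((X ** L) *v axis j 1))\<^sup>2 = axis j 1 \<bullet> (gram (X ** L) *v axis j 1)"
      by (simp add: inner_gram)
    also have "gram (X ** L) = transpose L ** W ** L"
      by (simp add: gram_def WX matrix_transpose_mul matrix_mul_assoc)
    finally show ?thesis by (simp add: WL inner_diag_axis)
  qed
  have "(norm (X ** L ** diag g))\<^sup>2 \<le> (\<Sum>j\<in>(UNIV::'p set). 1 / r)"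
    unfolding norm_sq_mult_diag col
  proof (intro sum_mono)
    fix j
    have "(g $ j)\<^sup>2 * ((1 / g $ j - 1) / r) = g $ j * (1 - g $ j) / r"
      using g(1)[of j] r by (simp add: power2_eq_square field_simps)
    also have "g $ j * (1 - g $ j) \<le> 1 * 1" using g(1)[of j] g(2)[of j] by (intro mult_mono) auto
    then have "g $ j * (1 - g $ j) / r \<le> 1 / r" using r by (intro divide_right_mono) auto
    finally show "(g $ j)\<^sup>2 * ((1 / g $ j - 1) / r) \<le> 1 / r" .
  qed
  then have "norm (X ** L ** diag g) \<le> sqrt (CARD('p) / r)" by (simp add: real_le_rsqrt)
  then have "norm (X ** L ** diag g) * norm J * K \<le> sqrt (CARD('p) / r) * norm J * K"
    using K(2) by (intro mult_right_mono) auto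
  then show ?thesis using K(1)[of "X ** L ** diag g" J] nJ by (simp add: UL matrix_mul_assoc)
qed

lemma trace_gram_bound:
  fixes Y :: "real^'p^'m"
  assumes Y: "\<And>x. (norm (Y *v x))\<^sup>2 \<le> x \<bullet> (S *v x)"
    and ab: "\<And>j. \<bar>a $ j * b $ j\<bar> \<le> 1"
  shows "\<bar>trace ((L ** diag a ** transpose L) ** gram Y ** (L ** diag b ** J))\<bar> \<le> CARD('p)"
proof -
  have "trace ((L ** diag a ** transpose L) ** gram Y ** (L ** diag b ** J))
    = trace ((L ** diag a ** transpose L ** gram Y ** L ** diag b) ** J)"
    by (simp add: matrix_mul_assoc)
  also have "\<dots> = trace (J ** (L ** diag a ** transpose L ** gram Y ** L ** diag b))"
    by (rule trace_mul_sym)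
  also have "\<dots> = trace ((diag a ** gram (Y ** L)) ** diag b)"
    by (simp add: matrix_mul_assoc[symmetric] cancel gram_def matrix_transpose_mul)
  also have "\<dots> = trace (diag b ** (diag a ** gram (Y ** L)))" by (rule trace_mul_sym)
  also have "\<dots> = (\<Sum>j\<in>UNIV. (b * a) $ j * (norm ((Y ** L) *v axis j 1))\<^sup>2)"
  proof -
    have "(diag c ** G) $ j $ j = c $ j * G $ j $ j" for c :: "real^'p" and G :: "real^'p^'p" and j
    proof -
      have "(\<Sum>k\<in>UNIV. diag c $ j $ k * G $ k $ j) = (\<Sum>k\<in>UNIV. if k = j then c $ j * G $ j $ j else 0)"
        by (intro sum.cong) (auto simp: diag_def)
      then show ?thesis by (simp add: matrix_matrix_mult_def)
    qed
    moreover have "gram (Y ** L) $ j $ j = axis j 1 \<bullet> (gram (Y ** L) *v axis j 1)" for j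
      by (simp add: inner_axis' matrix_vector_mul_component inner_axis)
    ultimately show ?thesis
      by (simp add: diag_mult_left trace_def inner_gram)
  qed
  also have "\<bar>\<dots>\<bar> \<le> (\<Sum>j\<in>(UNIV::'p set). 1)"
  proof (rule order_trans[OF sum_abs sum_mono])
    fix j
    have "\<bar>a $ j * b $ j\<bar> * (norm ((Y ** L) *v axis j 1))\<^sup>2 \<le> 1 * 1"
      using ab column_bound[OF Y, of j] by (intro mult_mono) auto
    then show "\<bar>(b * a) $ j * (norm ((Y ** L) *v axis j 1))\<^sup>2\<bar> \<le> 1"
      by (simp add: abs_mult mult_ac)
  qed
  finally show ?thesis by simp
qed

lemma abs_trace_coords_le:
  assumes "\<And>j. \<bar>a $ j\<bar> \<le> 1"
  shows "\<bar>trace (L ** diag a ** J)\<bar> \<le> CARD('p)"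
proof -
  have "\<bar>\<Sum>j\<in>UNIV. a $ j\<bar> \<le> (\<Sum>j\<in>(UNIV::'p set). 1)"
    by (intro order_trans[OF sum_abs sum_mono] assms)
  then show ?thesis by (simp add: trace_coords)
qed

lemma trace_U_bounds:
  "\<bar>trace (shrinkage r S W)\<bar> \<le> CARD('p)"
  "\<bar>trace (shrinkage r S W ** shrinkage r S W)\<bar> \<le> CARD('p)"
  "\<bar>trace (shrinkage r S W ** shrinkage r S W ** shrinkage r S W)\<bar> \<le> CARD('p)"
  unfolding UL coords_mult using g
  by (intro abs_trace_coords_le; simp add: abs_mult mult_le_one less_imp_le)+

lemma det_shrunk:
  "det (S - k *\<^sub>R (S ** shrinkage r S W)) = det S * (\<Prod>i\<in>UNIV. 1 - k * g $ i)"
  "0 < k \<Longrightarrow> k < 1 \<Longrightarrow> pos_def (S - k *\<^sub>R (S ** shrinkage r S W))"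
proof -
  have eq: "S - k *\<^sub>R (S ** shrinkage r S W) = transpose J ** diag (1 - k *\<^sub>R g) ** J"
    unfolding UL by (simp add: diag_linear mmul.diff_left mmul.diff_right mmul.scaleR_left mmul.scaleR_right
        SJ matrix_mul_assoc[symmetric] cancel)
      (simp add: diag_linear(4)[symmetric])
  show "det (S - k *\<^sub>R (S ** shrinkage r S W)) = det S * (\<Prod>i\<in>UNIV. 1 - k * g $ i)"
    unfolding eq by (simp add: det_mul det_diag SJ)
  show "pos_def (S - k *\<^sub>R (S ** shrinkage r S W))" if k: "0 < k" "k < 1"
    unfolding pos_def_def
  proof (intro conjI allI impI)
    show "transpose (S - k *\<^sub>R (S ** shrinkage r S W)) = S - k *\<^sub>R (S ** shrinkage r S W)"
      unfolding eq by (simp add: matrix_transpose_mul transpose_diag matrix_mul_assoc)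
    fix x :: "real^'p" assume "x \<noteq> 0"
    then have Jx: "J *v x \<noteq> 0"
      using LJ by (metis matrix_vector_mul_assoc matrix_vector_mul_lid matrix_vector_mult_0_right)
    then obtain i where i: "(J *v x) $ i \<noteq> 0" by (auto simp: vec_eq_iff)
    have kg: "k * g $ i < 1" for i
      using k g(1)[of i] g(2)[of i] by (smt (verit) mult_left_le)
    have "x \<bullet> ((S - k *\<^sub>R (S ** shrinkage r S W)) *v x) = (J *v x) \<bullet> (diag (1 - k *\<^sub>R g) *v (J *v x))"
      unfolding eq by (metis inner_commute inner_transpose_left matrix_vector_mul_assoc)
    also have "\<dots> = (\<Sum>i\<in>UNIV. (1 - k * g $ i) * ((J *v x) $ i)\<^sup>2)" by (simp add: inner_diag)
    also have "\<dots> > 0"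
      using i kg by (intro sum_pos2[of UNIV i]) (auto simp: less_imp_le)
    finally show "0 < x \<bullet> ((S - k *\<^sub>R (S ** shrinkage r S W)) *v x)" .
  qed
qed

lemma kg_less_1: "0 < k \<Longrightarrow> k < 1 \<Longrightarrow> 0 < 1 - k * g $ i"
  using g(1)[of i] g(2)[of i] by (smt (verit) mult_left_le)

end

lemma coords_exist:
  fixes S W :: "real^'p^'p"
  assumes r: "r > 0" and S: "pos_def S" and W: "pos_semidef W"
  obtains J L g where "coords r S W J L g"
proof -
  have "transpose W = W" using W by (simp add: pos_semidef_def)
  from simultaneous_diagonalization[OF S this] obtain J L :: "real^'p^'p" and d where
    J: "J ** L = mat 1" "L ** J = mat 1" "S = transpose J ** J" "W = transpose J ** diag d ** J" by metis
  have t: "transpose J ** transpose L = mat 1" using J by (metis matrix_transpose_mul transpose_mat)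
  have d: "d $ j \<ge> 0" for j
    using W diagonal_entry_of_congruence[OF J(1,4), of j] unfolding pos_semidef_def by metis
  define g :: "real^'p" where "g = (\<chi> i. 1 / (1 + r * d $ i))"
  have pos: "1 + r * d $ i > 0" for i using d[of i] r by (simp add: add_pos_nonneg)
  have gd: "diag (1 + r *\<^sub>R d) ** diag g = mat 1"
  proof -
    have "(1 + r *\<^sub>R d) * g = 1" using pos by (simp add: vec_eq_iff g_def less_imp_neq[THEN not_sym])
    then show ?thesis by (simp add: diag_mult diag_linear(4))
  qed
  have "S + r *\<^sub>R W = transpose J ** diag (1 + r *\<^sub>R d) ** J"
    unfolding diag_linear(1,3) diag_linear(4)[symmetric]
    by (simp add: J(3,4) mmul.add_left mmul.add_right mmul.scaleR_left mmul.scaleR_right)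
  then have "(S + r *\<^sub>R W) ** (L ** diag g ** transpose L) = mat 1"
    by (simp add: matrix_mul_assoc[symmetric] left_cancel[OF J(1)] left_cancel[OF gd] t)
  then have "ridge_inv r S W = L ** diag g ** transpose L"
    unfolding ridge_inv_def by (rule matrix_inv_eqI)
  then have "coords r S W J L g"
    using J r S W pos d by unfold_locales (auto simp: g_def)
  then show ?thesis by (rule that)
qed


section \<open>Measurability and nonsingularity of Gram matrices\<close>

lemma borel_measurable_matrix_nth [measurable]:
  "(\<lambda>A::real^'p^'m. A $ i $ j) \<in> borel_measurable borel"
  by (intro borel_measurable_continuous_onI continuous_intros)

lemma borel_measurable_matrixI:
  fixes f :: "'a \<Rightarrow> real^'p^'m"
  assumes "\<And>i j. (\<lambda>x. f x $ i $ j) \<in> borel_measurable M"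
  shows "f \<in> borel_measurable M"
  by (rule borel_measurable_euclidean_space[THEN iffD2]) (use assms in \<open>auto simp: Basis_vec_def inner_axis\<close>)

lemma borel_measurable_matrix_mult [measurable (raw)]:
  fixes f :: "'a \<Rightarrow> real^'n^'m" and g :: "'a \<Rightarrow> real^'p^'n"
  assumes "f \<in> borel_measurable M" "g \<in> borel_measurable M"
  shows "(\<lambda>x. f x ** g x) \<in> borel_measurable M"
  by (rule borel_measurable_continuous_Pair[OF assms]) (intro mmul.continuous_on continuous_intros)

lemma borel_measurable_matrix_transpose [measurable (raw)]:
  fixes f :: "'a \<Rightarrow> real^'n^'m"
  assumes "f \<in> borel_measurable M"
  shows "(\<lambda>x. transpose (f x)) \<in> borel_measurable M"
  by (rule measurable_compose[OF assms borel_measurable_continuous_onI])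
     (rule linear_continuous_on[OF bounded_linear_transpose])

lemma borel_measurable_matrix_trace [measurable (raw)]:
  fixes f :: "'a \<Rightarrow> real^'n^'n"
  assumes "f \<in> borel_measurable M"
  shows "(\<lambda>x. trace (f x)) \<in> borel_measurable M"
  by (rule measurable_compose[OF assms borel_measurable_continuous_onI])
     (rule linear_continuous_on[OF bounded_linear_trace])

lemma borel_measurable_matrix_det [measurable (raw)]:
  fixes f :: "'a \<Rightarrow> real^'n^'n"
  assumes f: "f \<in> borel_measurable M"
  shows "(\<lambda>x. det (f x)) \<in> borel_measurable M"
proof -
  have "(\<lambda>A::real^'n^'n. det A) \<in> borel_measurable borel"
    unfolding det_def by measurable
  then show ?thesis by (rule measurable_compose[OF f])
qed

lemma borel_measurable_gram [measurable (raw)]: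
  fixes f :: "'a \<Rightarrow> real^'n^'m"
  assumes "f \<in> borel_measurable M"
  shows "(\<lambda>x. gram (f x)) \<in> borel_measurable M"
  unfolding gram_def using assms by measurable

text \<open>
  On nonsingular matrices the entries of the inverse are given by the rule of Cramer.  On singular matrices
  \<open>matrix_inv\<close> is a choice from the empty predicate, hence constant.
\<close>

lemma borel_measurable_matrix_inv [measurable (raw)]:
  fixes f :: "'a \<Rightarrow> real^'n^'n"
  assumes f: "f \<in> borel_measurable M"
  shows "(\<lambda>x. matrix_inv (f x)) \<in> borel_measurable M"
proof -
  let ?C = "\<lambda>A::real^'n^'n. \<lambda>i j. det (\<chi> k l. if l = i then axis j 1 $ k else A $ k $ l) / det A"
  have entry: "matrix_inv A $ i $ j = ?C A i j" if "det A \<noteq> 0" for A i j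
  proof -
    have inv: "A ** matrix_inv A = mat 1"
      using that by (metis invertible_det_nz invertible_right_inverse matrix_inv_eqI)
    then have "A *v (matrix_inv A *v axis j 1) = axis j 1" by (simp add: matrix_vector_mul_assoc)
    then have "matrix_inv A *v axis j 1 = (\<chi> i. ?C A i j)" using cramer[OF that] by blast
    then show ?thesis by (simp add: vec_eq_iff matrix_vector_mul_component inner_axis)
  qed
  have sing: "matrix_inv A = (SOME A'. False)" if "det A = 0" for A :: "real^'n^'n"
  proof -
    have "\<not> (\<exists>A'. A ** A' = mat 1)" using that by (metis det_I det_mul mult_zero_left zero_neq_one)
    then have "(\<lambda>A'. A ** A' = mat 1 \<and> A' ** A = mat 1) = (\<lambda>A'. False)" by auto
    then show ?thesis unfolding matrix_inv_def by simp
  qed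
  have "(\<lambda>A::real^'n^'n. matrix_inv A) \<in> borel_measurable borel"
  proof (rule borel_measurable_matrixI)
    fix i j
    have "(\<lambda>A::real^'n^'n. matrix_inv A $ i $ j)
       = (\<lambda>A. if det A = 0 then (SOME A'::real^'n^'n. False) $ i $ j else ?C A i j)"
      by (auto simp: entry sing)
    moreover have "(\<lambda>A::real^'n^'n. (\<chi> k l. if l = i then axis j (1::real) $ k else A $ k $ l) :: real^'n^'n) \<in> borel_measurable borel"
    proof (rule borel_measurable_matrixI)
      fix k l
      show "(\<lambda>A::real^'n^'n. (\<chi> k l. if l = i then axis j (1::real) $ k else A $ k $ l) $ k $ l) \<in> borel_measurable borel"
        by (cases "l = i") (simp_all add: borel_measurable_matrix_nth)
    qed
    ultimately show "(\<lambda>A::real^'n^'n. matrix_inv A $ i $ j) \<in> borel_measurable borel" by simp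
  qed
  then show ?thesis by (rule measurable_compose[OF f])
qed

lemma pos_semidef_nonsingular_imp_pos_def:
  fixes A :: "real^'p^'p"
  assumes A: "pos_semidef A" and "det A \<noteq> 0"
  shows "pos_def A"
  unfolding pos_def_def
proof (intro conjI allI impI)
  show t: "transpose A = A" using A by (simp add: pos_semidef_def)
  fix x :: "real^'p" assume "x \<noteq> 0"
  show "0 < x \<bullet> (A *v x)"
  proof (rule ccontr)
    assume "\<not> 0 < x \<bullet> (A *v x)"
    then have x0: "x \<bullet> (A *v x) = 0" using A by (force simp: pos_semidef_def intro: antisym)
    have "y \<bullet> (A *v x) = 0" for y
    proof -
      have "- (y \<bullet> (A *v x)) = 0"
      proof (rule quadratic_nonpos_imp_linear_zero[where b="- (y \<bullet> (A *v y))"])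
        fix s
        have "0 \<le> (x + s *\<^sub>R y) \<bullet> (A *v (x + s *\<^sub>R y))" using A by (simp add: pos_semidef_def)
        moreover have "x \<bullet> (A *v y) = y \<bullet> (A *v x)"
          by (metis t inner_commute inner_transpose_left)
        ultimately show "2 * s * - (y \<bullet> (A *v x)) + s\<^sup>2 * - (y \<bullet> (A *v y)) \<le> 0"
          using x0 by (simp add: matrix_vector_right_distrib matrix_vector_mult_scaleR inner_add_left
              inner_add_right power2_eq_square algebra_simps)
      qed
      then show ?thesis by simp
    qed
    then have "A *v x = 0" by (metis inner_eq_zero_iff)
    moreover obtain B where "B ** A = mat 1"
      using assms(2) by (metis invertible_det_nz invertible_left_inverse)
    ultimately have "x = 0"
      by (metis matrix_vector_mul_assoc matrix_vector_mul_lid matrix_vector_mult_0_right)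
    then show False using \<open>x \<noteq> 0\<close> by simp
  qed
qed

lemma pos_def_imp_semidef: "pos_def A \<Longrightarrow> pos_semidef A"
  unfolding pos_def_def pos_semidef_def by (metis inner_zero_left less_imp_le order_refl)

lemma det_add_semidef_ge:
  fixes A R :: "real^'p^'p"
  assumes A: "pos_def A" and R: "pos_semidef R"
  shows "det A \<le> det (A + R)"
proof -
  have t: "transpose R = R" using R by (simp add: pos_semidef_def)
  from simultaneous_diagonalization[OF A t] obtain J L :: "real^'p^'p" and d where
    J: "J ** L = mat 1" "L ** J = mat 1" "A = transpose J ** J" "R = transpose J ** diag d ** J" by metis
  have d: "d $ j \<ge> 0" for j
    using R diagonal_entry_of_congruence[OF J(1,4), of j] unfolding pos_semidef_def by metis
  have "A + R = transpose J ** diag (1 + d) ** J"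
    unfolding diag_linear(1) diag_linear(4)[symmetric]
    by (simp add: J(3,4) mmul.add_left mmul.add_right)
  then have "det (A + R) = det A * (\<Prod>i\<in>UNIV. 1 + d $ i)"
    by (simp add: det_mul det_diag J(3))
  moreover have "1 \<le> (\<Prod>i\<in>UNIV. 1 + d $ i)" using d by (intro prod_ge_1) auto
  ultimately show ?thesis
    using pos_def_matrix_inv(5)[OF A] by (simp add: mult_le_cancel_left1)
qed

text \<open>
  Choose \<open>E\<close> with \<open>E\<^sup>T E = 1\<close>, which is possible for \<open>p \<le> m\<close>.  On every line \<open>t \<mapsto> X + t E\<close> the determinant
  of the Gram matrix is a polynomial in \<open>t\<close> that is positive for large \<open>t\<close>, so it has finitely many zeros.
  Averaging the translates by \<open>t E\<close> over \<open>t \<in> [0,1]\<close> shows that the zero set is a null set.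
\<close>

lemma AE_pos_def_gram:
  assumes pm: "CARD('p) \<le> CARD('m)"
  shows "AE X in (lborel :: (real^'p^'m) measure). pos_def (gram X)"
proof -
  obtain \<iota> :: "'p \<Rightarrow> 'm" where \<iota>: "inj \<iota>"
    using pm by (metis card_le_inj finite_class.finite_UNIV)
  define E :: "real^'p^'m" where "E = (\<chi> i j. if i = \<iota> j then 1 else 0)"
  have normE: "norm (E *v x) = norm x" for x
  proof -
    have "gram E = mat 1"
    proof -
      have "gram E $ j $ k = (mat 1 :: real^'p^'p) $ j $ k" for j k
      proof -
        have "gram E $ j $ k = (\<Sum>i\<in>UNIV. E $ i $ j * E $ i $ k)"
          by (simp add: gram_def matrix_matrix_mult_def transpose_def)
        also have "\<dots> = (\<Sum>i\<in>UNIV. if i = \<iota> j then (if j = k then 1 else 0) else 0)"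
          using \<iota> by (intro sum.cong) (auto simp: E_def dest: injD)
        finally have "gram E $ j $ k = (\<Sum>i\<in>UNIV. if i = \<iota> j then (if j = k then 1 else 0) else 0)" .
        then show ?thesis by (simp add: mat_def)
      qed
      then show ?thesis by (simp add: vec_eq_iff)
    qed
    then have "(norm (E *v x))\<^sup>2 = (norm x)\<^sup>2"
      using inner_gram[of x E] by (simp add: power2_norm_eq_inner)
    then show ?thesis by (rule power2_eq_imp_eq) auto
  qed
  have fin: "finite {t. det (gram (X + t *\<^sub>R E)) = 0}" for X
  proof -
    have "real_polynomial_function (\<lambda>t. det (gram (X + t *\<^sub>R E)))"
      unfolding det_def gram_def matrix_matrix_mult_def transpose_def
      by (simp, intro real_polynomial_function_sum real_polynomial_function_prod
          real_polynomial_function.intros(2,3,4) finite_permutations finite_class.finite_UNIV)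
        (auto intro: real_polynomial_function.intros(1) bounded_linear_ident)
    then obtain a N where aN: "(\<lambda>t. det (gram (X + t *\<^sub>R E))) = (\<lambda>t. \<Sum>i\<le>N. a i * t ^ i)"
      by (auto simp: real_polynomial_function_iff_sum)
    have "\<exists>i\<le>N. a i \<noteq> 0"
    proof (rule ccontr)
      assume "\<not> (\<exists>i\<le>N. a i \<noteq> 0)"
      then have 0: "det (gram (X + t *\<^sub>R E)) = 0" for t using fun_cong[OF aN, of t] by simp
      obtain K where K: "K > 0" "\<And>x. norm (X *v x) \<le> norm x * K"
        using bounded_linear.pos_bounded[of "\<lambda>x. X *v x"] by (auto simp: linear_linear)
      have "pos_def (gram (X + (K + 1) *\<^sub>R E))"
        unfolding pos_def_def
      proof (intro conjI allI impI transpose_gram)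
        fix x :: "real^'p" assume "x \<noteq> 0"
        have "(X + (K + 1) *\<^sub>R E) *v x \<noteq> 0"
        proof
          assume "(X + (K + 1) *\<^sub>R E) *v x = 0"
          then have "norm ((K + 1) *\<^sub>R (E *v x)) = norm (X *v x)"
            by (metis add_eq_0_iff matrix_vector_mult_add_rdistrib norm_minus_cancel scaleR_matrix_vector_assoc)
          then have "(K + 1) * norm x \<le> norm x * K" using K(1) K(2)[of x] by (simp add: normE)
          then show False using \<open>x \<noteq> 0\<close> by (simp add: algebra_simps)
        qed
        then show "0 < x \<bullet> (gram (X + (K + 1) *\<^sub>R E) *v x)" by (simp add: inner_gram)
      qed
      then show False using 0 pos_def_matrix_inv(5) by (metis less_irrefl)
    qed
    then show ?thesis using polyfun_finite_roots[of a N] fun_cong[OF aN] by simp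
  qed
  define A where "A = {X::real^'p^'m. det (gram X) = 0}"
  have [measurable]: "A \<in> sets borel" unfolding A_def by measurable
  have "emeasure lborel A = (\<integral>\<^sup>+(X::real^'p^'m). indicator A X \<partial>lborel)" by simp
  also have "\<dots> = (\<integral>\<^sup>+t. indicator {0..1::real} t * (\<integral>\<^sup>+(X::real^'p^'m). indicator A X \<partial>lborel) \<partial>lborel)"
    by (subst nn_integral_multc) auto
  also have "\<dots> = (\<integral>\<^sup>+t. (\<integral>\<^sup>+(X::real^'p^'m). indicator {0..1::real} t * indicator A (X + t *\<^sub>R E) \<partial>lborel) \<partial>lborel)"
    by (intro nn_integral_cong) (simp add: nn_integral_cmult nn_integral_lborel_shift)
  also have "\<dots> = (\<integral>\<^sup>+(X::real^'p^'m). (\<integral>\<^sup>+t. indicator {0..1::real} t * indicator A (X + t *\<^sub>R E) \<partial>lborel) \<partial>lborel)"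
    by (rule lborel_pair.Fubini') measurable
  also have "\<dots> = (\<integral>\<^sup>+(X::real^'p^'m). 0 \<partial>lborel)"
  proof (intro nn_integral_cong)
    fix X :: "real^'p^'m"
    have "AE t in lborel. t \<notin> {t. det (gram (X + t *\<^sub>R E)) = 0}"
      by (intro AE_not_in finite_imp_null_set_lborel fin)
    then have "AE t in lborel. (indicator {0..1::real} t * indicator A (X + t *\<^sub>R E) :: ennreal) = 0"
      by eventually_elim (simp add: A_def)
    then show "(\<integral>\<^sup>+t. indicator {0..1::real} t * indicator A (X + t *\<^sub>R E) \<partial>lborel) = 0"
      by (simp add: nn_integral_0_iff_AE)
  qed
  finally have "A \<in> null_sets lborel" by (auto simp: null_sets_def)
  then have "AE X in lborel. X \<notin> A" by (rule AE_not_in)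
  then show ?thesis
    by eventually_elim (auto simp: A_def intro: pos_semidef_nonsingular_imp_pos_def pos_semidef_gram)
qed

lemma AE_matrix_normalI:
  assumes "AE X in lborel. P X"
  shows "AE X in matrix_normal \<Theta> (mat 1) \<Sigma>. P X"
  unfolding matrix_normal_def using assms by (subst AE_density) auto


section \<open>An inverse moment of a Gaussian determinant\<close>

text \<open>
  The value at \<open>0\<close> is \<open>\<infinity>\<close>, so that a finite integral also shows that the argument is almost surely
  nonzero.
\<close>

definition inv_sqrt :: "real \<Rightarrow> ennreal" where
  "inv_sqrt u = inverse (ennreal (sqrt \<bar>u\<bar>))"

lemma borel_measurable_inv_sqrt [measurable]: "inv_sqrt \<in> borel_measurable borel"
  unfolding inv_sqrt_def by measurable

lemma inv_sqrt_mult: "inv_sqrt (a * b) = inv_sqrt a * inv_sqrt b"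
  by (simp add: inv_sqrt_def abs_mult real_sqrt_mult ennreal_mult ennreal_inverse_mult)

lemma inv_sqrt_antimono:
  assumes "\<bar>a\<bar> \<le> \<bar>b\<bar>"
  shows "inv_sqrt b \<le> inv_sqrt a"
proof (cases "a = 0")
  case False
  then have "inverse (sqrt \<bar>b\<bar>) \<le> inverse (sqrt \<bar>a\<bar>)"
    using assms by (intro le_imp_inverse_le) auto
  then show ?thesis
    using assms False by (simp add: inv_sqrt_def inverse_ennreal)
qed (simp add: inv_sqrt_def)

lemma inv_sqrt_le_1: "1 \<le> \<bar>u\<bar> \<Longrightarrow> inv_sqrt u \<le> 1"
  using inv_sqrt_antimono[of 1 u] by (simp add: inv_sqrt_def)

lemma nn_integral_inv_sqrt_finite:
  "(\<integral>\<^sup>+v. inv_sqrt v * indicator {-1..1} v \<partial>lborel) < \<infinity>"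
proof -
  define h where "h = (\<lambda>v::real. if v \<in> {0..1} then v powr (-1/2) else 0)"
  have hm [measurable]: "h \<in> borel_measurable borel" unfolding h_def by measurable
  have h: "(\<integral>\<^sup>+v. ennreal (h v) \<partial>lborel) = ennreal 2"
  proof (rule nn_integral_has_integral_lborel)
    show "(h has_integral 2) UNIV"
      unfolding h_def has_integral_restrict_UNIV using has_integral_powr_from_0[of "-1/2" 1] by simp
  qed (auto simp: h_def)
  have le: "AE v in lborel. inv_sqrt v * indicator {-1..1} v \<le> ennreal (h v) + ennreal (h (- v))"
  proof -
    have "inv_sqrt v * indicator {-1..1} v \<le> ennreal (h v) + ennreal (h (- v))" if "v \<noteq> 0" for v
    proof (cases "v \<in> {-1..1}")
      case True
      have "inv_sqrt v = ennreal (\<bar>v\<bar> powr (-1/2))"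
        using that by (simp add: inv_sqrt_def inverse_ennreal powr_minus powr_half_sqrt)
      also have "\<bar>v\<bar> powr (-1/2) \<le> h v + h (- v)"
        using True by (auto simp: h_def abs_if)
      finally have "inv_sqrt v \<le> ennreal (h v + h (- v))" by (simp add: ennreal_leI)
      moreover have "h v \<ge> 0" "h (- v) \<ge> 0" by (simp_all add: h_def)
      ultimately show ?thesis using True by (simp only: ennreal_plus indicator_simps mult_1_right)
    qed simp
    with AE_lborel_singleton[of "0::real"] show ?thesis by (auto elim: eventually_mono)
  qed
  have "(\<integral>\<^sup>+v. inv_sqrt v * indicator {-1..1} v \<partial>lborel) \<le> (\<integral>\<^sup>+v. ennreal (h v) + ennreal (h (- v)) \<partial>lborel)"
    by (rule nn_integral_mono_AE[OF le])
  also have "\<dots> = (\<integral>\<^sup>+v. ennreal (h v) \<partial>lborel) + (\<integral>\<^sup>+v. ennreal (h (- v)) \<partial>lborel)"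
    by (rule nn_integral_add) measurable
  also have "(\<integral>\<^sup>+v. ennreal (h (- v)) \<partial>lborel) = (\<integral>\<^sup>+v. ennreal (h v) \<partial>lborel)"
    by (rule nn_integral_lborel_reflect[of "\<lambda>v. ennreal (h v)"]) measurable
  finally show ?thesis unfolding h by (auto simp: less_top[symmetric] top_unique)
qed

text \<open>
  The density is at most a Gaussian weight \<open>w\<close>.  Average the integral against \<open>w\<close> over the translations by \<open>s E\<close>, \<open>s \<in> [0,1]\<close>,
  where \<open>E\<close> is the unit vector in the direction \<open>c\<close>.  The translated weight is bounded by another Gaussian weight
  \<open>w'\<close>, and the average over \<open>s\<close> of \<open>inv_sqrt (u + s)\<close> is bounded uniformly in \<open>u\<close> because the singularity is
  integrable.
\<close>

lemma nn_integral_inv_sqrt_linear_form: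
  assumes \<Sigma>: "pos_def (\<Sigma> :: real^'p^'p)"
  obtains C where "C < \<infinity>" "C \<ge> 1" "\<And>c. c \<noteq> 0 \<Longrightarrow>
    (\<integral>\<^sup>+y. inv_sqrt ((y $ 1) \<bullet> c) \<partial>matrix_normal (0 :: real^'p^1) (mat 1) \<Sigma>) \<le> C * inv_sqrt (norm c)"
proof -
  let ?\<phi> = "matrix_normal_density (0 :: real^'p^1) (mat 1) \<Sigma>"
  obtain D a where D: "D \<ge> 0" "a > 0" "\<And>X. ?\<phi> X \<le> D * exp (- (a * (norm X)\<^sup>2))"
    using density_gaussian_bound[OF \<Sigma>] by blast
  define w where "w = (\<lambda>y::real^'p^1. D * exp (- (a * (norm y)\<^sup>2)))"
  define w' where "w' = (\<lambda>y::real^'p^1. D * exp a * exp (- (a / 2 * (norm y)\<^sup>2)))"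
  have [measurable]: "w \<in> borel_measurable borel" "w' \<in> borel_measurable borel"
    unfolding w_def w'_def by measurable
  have w0: "w y \<ge> 0" "w' y \<ge> 0" for y using D by (auto simp: w_def w'_def)
  have w'fin: "(\<integral>\<^sup>+y. ennreal (w' y) \<partial>lborel) < \<infinity>"
  proof -
    have "integrable lborel w'" unfolding w'_def
      by (intro integrable_mult_right integrable_gaussian) (use D in simp)
    then show ?thesis using w0 by (auto simp: integrable_iff_bounded)
  qed
\<comment> \<open>the summand \<open>1\<close> covers the points at which \<open>inv_sqrt \<le> 1\<close>\<close>
  define I where "I = (\<integral>\<^sup>+v. inv_sqrt v * indicator {-1..1} v \<partial>lborel) + 1"
  have I: "I < \<infinity>" using nn_integral_inv_sqrt_finite by (simp add: I_def)
  have line: "(\<integral>\<^sup>+s. indicator {0..1} s * inv_sqrt (u + s) \<partial>lborel) \<le> I" for u :: real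
  proof -
    have "(\<integral>\<^sup>+s. indicator {0..1} s * inv_sqrt (u + s) \<partial>lborel)
      \<le> (\<integral>\<^sup>+s. inv_sqrt (s + u) * indicator {-1..1} (s + u) + indicator {0..1} s \<partial>lborel)"
    proof (rule nn_integral_mono)
      fix s :: real
      show "indicator {0..1} s * inv_sqrt (u + s) \<le> inv_sqrt (s + u) * indicator {-1..1} (s + u) + indicator {0..1} s"
        using inv_sqrt_le_1[of "s + u"] by (auto simp: indicator_def add.commute abs_if split: if_splits)
    qed
    also have "\<dots> = (\<integral>\<^sup>+s. inv_sqrt (s + u) * indicator {-1..1} (s + u) \<partial>lborel) + (\<integral>\<^sup>+s. indicator {0..1::real} s \<partial>lborel)"
      by (rule nn_integral_add) measurable
    also have "(\<integral>\<^sup>+s. inv_sqrt (s + u) * indicator {-1..1} (s + u) \<partial>lborel) = (\<integral>\<^sup>+v. inv_sqrt v * indicator {-1..1} v \<partial>lborel)"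
      by (rule nn_integral_lborel_shift[of "\<lambda>v. inv_sqrt v * indicator {-1..1} v"]) measurable
    finally show ?thesis by (simp add: I_def)
  qed
  define C where "C = max 1 (I * (\<integral>\<^sup>+y. ennreal (w' y) \<partial>lborel))"
  have "C < \<infinity>" using I w'fin by (simp add: C_def ennreal_mult_less_top)
  moreover have "C \<ge> 1" by (simp add: C_def)
  moreover have "(\<integral>\<^sup>+y. inv_sqrt ((y $ 1) \<bullet> c) \<partial>matrix_normal (0 :: real^'p^1) (mat 1) \<Sigma>) \<le> C * inv_sqrt (norm c)"
    if c: "c \<noteq> 0" for c
  proof -
    define E :: "real^'p^1" where "E = (\<chi> i. c /\<^sub>R norm c)"
    have "norm E = norm (E $ 1)" unfolding norm_vec_def[of E] by (simp add: L2_set_def)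
    then have nE: "norm E = 1" using c by (simp add: E_def)
    have sh: "((y + s *\<^sub>R E) $ 1) \<bullet> c = norm c * ((y $ 1) \<bullet> (c /\<^sub>R norm c) + s)" for y s
      using c by (simp add: E_def inner_add_left power2_norm_eq_inner[symmetric] power2_eq_square field_simps)
    have wsh: "w (y + s *\<^sub>R E) \<le> w' y" if "s \<in> {0..1}" for y s
    proof -
      have "(norm y)\<^sup>2 \<le> 2 * (norm (y + s *\<^sub>R E))\<^sup>2 + 2 * s\<^sup>2"
        using norm_sq_le_shift[of y "- (s *\<^sub>R E)"] nE by simp
      also have "\<dots> \<le> 2 * (norm (y + s *\<^sub>R E))\<^sup>2 + 2"
        using that by (simp add: power_le_one)
      finally have "a * (norm y)\<^sup>2 \<le> a * (2 * (norm (y + s *\<^sub>R E))\<^sup>2 + 2)"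
        using D(2) by (intro mult_left_mono) auto
      then have "- (a * (norm (y + s *\<^sub>R E))\<^sup>2) \<le> a + - (a / 2 * (norm y)\<^sup>2)" by (simp add: algebra_simps)
      then have "exp (- (a * (norm (y + s *\<^sub>R E))\<^sup>2)) \<le> exp a * exp (- (a / 2 * (norm y)\<^sup>2))"
        by (simp add: exp_add[symmetric])
      then have "D * exp (- (a * (norm (y + s *\<^sub>R E))\<^sup>2)) \<le> D * (exp a * exp (- (a / 2 * (norm y)\<^sup>2)))"
        using D(1) by (rule mult_left_mono)
      then show ?thesis by (simp add: w_def w'_def)
    qed
    have m1 [measurable]: "(\<lambda>y::real^'p^1. inv_sqrt ((y $ 1) \<bullet> c)) \<in> borel_measurable borel"
      by (rule measurable_compose[OF _ borel_measurable_inv_sqrt])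
        (intro borel_measurable_continuous_onI continuous_intros)
    have m2 [measurable]: "(\<lambda>y::real^'p^1. (y $ 1) \<bullet> (c /\<^sub>R norm c)) \<in> borel_measurable borel"
      by (intro borel_measurable_continuous_onI continuous_intros)
    let ?W = "\<integral>\<^sup>+y. inv_sqrt ((y $ 1) \<bullet> c) * ennreal (w y) \<partial>lborel"
    have "(\<integral>\<^sup>+y. inv_sqrt ((y $ 1) \<bullet> c) \<partial>matrix_normal (0 :: real^'p^1) (mat 1) \<Sigma>)
      = (\<integral>\<^sup>+y. ennreal (?\<phi> y) * inv_sqrt ((y $ 1) \<bullet> c) \<partial>lborel)"
      unfolding matrix_normal_def by (rule nn_integral_density) measurable
    also have "\<dots> \<le> ?W"
      by (intro nn_integral_mono) (auto simp: w_def mult.commute intro!: mult_left_mono ennreal_leI D)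
    also have "?W = (\<integral>\<^sup>+s. indicator {0..1::real} s * ?W \<partial>lborel)"
      by (subst nn_integral_multc) auto
    also have "\<dots> = (\<integral>\<^sup>+s. (\<integral>\<^sup>+y. indicator {0..1::real} s * (inv_sqrt (((y + s *\<^sub>R E) $ 1) \<bullet> c) * ennreal (w (y + s *\<^sub>R E))) \<partial>lborel) \<partial>lborel)"
    proof (intro nn_integral_cong)
      fix s :: real
      have "(\<integral>\<^sup>+y. inv_sqrt (((y + s *\<^sub>R E) $ 1) \<bullet> c) * ennreal (w (y + s *\<^sub>R E)) \<partial>lborel) = ?W"
        by (rule nn_integral_lborel_shift[of "\<lambda>y. inv_sqrt ((y $ 1) \<bullet> c) * ennreal (w y)"]) measurable
      then show "indicator {0..1} s * ?W = (\<integral>\<^sup>+y. indicator {0..1::real} s * (inv_sqrt (((y + s *\<^sub>R E) $ 1) \<bullet> c) * ennreal (w (y + s *\<^sub>R E))) \<partial>lborel)"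
        by (cases "s \<in> {0..1}") simp_all
    qed
    also have "\<dots> \<le> (\<integral>\<^sup>+s. (\<integral>\<^sup>+y. inv_sqrt (norm c) * ennreal (w' y) * (indicator {0..1::real} s * inv_sqrt ((y $ 1) \<bullet> (c /\<^sub>R norm c) + s)) \<partial>lborel) \<partial>lborel)"
    proof (intro nn_integral_mono)
      fix s :: real and y :: "real^'p^1"
      show "indicator {0..1::real} s * (inv_sqrt (((y + s *\<^sub>R E) $ 1) \<bullet> c) * ennreal (w (y + s *\<^sub>R E)))
        \<le> inv_sqrt (norm c) * ennreal (w' y) * (indicator {0..1::real} s * inv_sqrt ((y $ 1) \<bullet> (c /\<^sub>R norm c) + s))"
      proof (cases "s \<in> {0..1}")
        case True
        have "inv_sqrt (norm c) * inv_sqrt ((y $ 1) \<bullet> (c /\<^sub>R norm c) + s) * ennreal (w (y + s *\<^sub>R E))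
          \<le> inv_sqrt (norm c) * inv_sqrt ((y $ 1) \<bullet> (c /\<^sub>R norm c) + s) * ennreal (w' y)"
          by (intro mult_left_mono ennreal_leI wsh True) auto
        then show ?thesis using True unfolding sh inv_sqrt_mult by (simp add: mult_ac)
      qed simp
    qed
    also have "\<dots> = (\<integral>\<^sup>+y. (\<integral>\<^sup>+s. inv_sqrt (norm c) * ennreal (w' y) * (indicator {0..1::real} s * inv_sqrt ((y $ 1) \<bullet> (c /\<^sub>R norm c) + s)) \<partial>lborel) \<partial>lborel)"
      by (rule lborel_pair.Fubini') measurable
    also have "\<dots> = (\<integral>\<^sup>+y. inv_sqrt (norm c) * ennreal (w' y) * (\<integral>\<^sup>+s. (indicator {0..1::real} s * inv_sqrt ((y $ 1) \<bullet> (c /\<^sub>R norm c) + s)) \<partial>lborel) \<partial>lborel)"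
      by (intro nn_integral_cong nn_integral_cmult) measurable
    also have "\<dots> \<le> (\<integral>\<^sup>+y. inv_sqrt (norm c) * I * ennreal (w' y) \<partial>lborel)"
    proof (intro nn_integral_mono)
      fix y :: "real^'p^1"
      have "inv_sqrt (norm c) * ennreal (w' y) * (\<integral>\<^sup>+s. (indicator {0..1::real} s * inv_sqrt ((y $ 1) \<bullet> (c /\<^sub>R norm c) + s)) \<partial>lborel)
        \<le> inv_sqrt (norm c) * ennreal (w' y) * I"
        by (intro mult_left_mono line) simp
      also have "\<dots> = inv_sqrt (norm c) * I * ennreal (w' y)" by (simp only: mult_ac)
      finally show "inv_sqrt (norm c) * ennreal (w' y) * (\<integral>\<^sup>+s. (indicator {0..1::real} s * inv_sqrt ((y $ 1) \<bullet> (c /\<^sub>R norm c) + s)) \<partial>lborel)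
        \<le> inv_sqrt (norm c) * I * ennreal (w' y)" .
    qed
    also have "\<dots> = inv_sqrt (norm c) * I * (\<integral>\<^sup>+y. ennreal (w' y) \<partial>lborel)"
      by (rule nn_integral_cmult) measurable
    also have "\<dots> = (I * (\<integral>\<^sup>+y. ennreal (w' y) \<partial>lborel)) * inv_sqrt (norm c)" by (simp add: mult_ac)
    also have "\<dots> \<le> C * inv_sqrt (norm c)" unfolding C_def by (intro mult_right_mono) auto
    finally show ?thesis .
  qed
  ultimately show ?thesis by (rule that)
qed

lemma det_row_linear:
  fixes A :: "'p::finite \<Rightarrow> real^'p"
  obtains c where "\<And>v. det (\<chi> k. if k = i then v else A k) = v \<bullet> c"
proof -
  let ?f = "\<lambda>v. det (\<chi> k. if k = i then v else A k)"
  have "linear ?f"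
  proof (rule linearI)
    show "?f (x + y) = ?f x + ?f y" for x y using det_row_add[of i "\<lambda>_. x" "\<lambda>_. y" A] by simp
    show "?f (s *\<^sub>R x) = s *\<^sub>R ?f x" for s x
      using det_row_mul[of i s "\<lambda>_. x" A, unfolded scalar_mult_eq_scaleR] by simp
  qed
  then have "?f v = v \<bullet> adjoint ?f 1" for v using adjoint_works[of ?f v 1] by simp
  then show ?thesis by (rule that)
qed

text \<open>
  Rows of the identity matrix are replaced by Gaussian rows one at a time.  As a function of the new row the
  determinant is a linear form \<open>y \<bullet> c\<close>, and \<open>norm c\<close> is at least the previous determinant, which is \<open>c\<close> evaluated
  at a unit vector.  Hence each replacement multiplies the integral at most by a constant.  Indices of \<open>I\<close>
  outside the range of \<open>\<iota>\<close> belong to rows that do not enter the determinant.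
\<close>

lemma nn_integral_inv_sqrt_det_finite:
  fixes \<iota> :: "'p::finite \<Rightarrow> nat"
  assumes \<Sigma>: "pos_def (\<Sigma> :: real^'p^'p)" and \<iota>: "inj \<iota>" and "finite I"
  shows "(\<integral>\<^sup>+z. inv_sqrt (det (\<chi> k. if \<iota> k \<in> I then z (\<iota> k) $ 1 else axis k 1))
     \<partial>(\<Pi>\<^sub>M i\<in>I. matrix_normal (0 :: real^'p^1) (mat 1) \<Sigma>)) < \<infinity>"
proof -
  let ?N = "matrix_normal (0 :: real^'p^1) (mat 1) \<Sigma>"
  interpret N: prob_space ?N by (rule prob_space_matrix_normal[OF \<Sigma>])
  interpret product_sigma_finite "\<lambda>i::nat. ?N" ..
  obtain C where C: "C < \<infinity>" "C \<ge> 1" "\<And>c. c \<noteq> 0 \<Longrightarrow>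
    (\<integral>\<^sup>+y. inv_sqrt ((y $ 1) \<bullet> c) \<partial>?N) \<le> C * inv_sqrt (norm c)"
    using nn_integral_inv_sqrt_linear_form[OF \<Sigma>] by blast
  define D where "D = (\<lambda>I (z :: nat \<Rightarrow> real^'p^1). det (\<chi> k. if \<iota> k \<in> I then z (\<iota> k) $ 1 else (axis k 1 :: real^'p)))"
  have row1: "(\<lambda>y::real^'p^1. y $ 1) \<in> borel_measurable borel"
    by (intro borel_measurable_continuous_onI continuous_intros)
  have mD: "(\<lambda>z. D I z) \<in> borel_measurable (\<Pi>\<^sub>M i\<in>I. ?N)" for I
    unfolding D_def
  proof (intro borel_measurable_matrix_det borel_measurable_matrixI)
    fix k l
    show "(\<lambda>z. (\<chi> k. if \<iota> k \<in> I then z (\<iota> k) $ 1 else (axis k 1 :: real^'p)) $ k $ l) \<in> borel_measurable (\<Pi>\<^sub>M i\<in>I. ?N)"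
    proof (cases "\<iota> k \<in> I")
      case True
      have "(\<lambda>z. z (\<iota> k)) \<in> (\<Pi>\<^sub>M i\<in>I. ?N) \<rightarrow>\<^sub>M ?N" by (rule measurable_component_singleton[OF True])
      then have "(\<lambda>z. z (\<iota> k)) \<in> borel_measurable (\<Pi>\<^sub>M i\<in>I. ?N)"
        by (simp cong: measurable_cong_sets)
      from measurable_compose[OF this borel_measurable_matrix_nth] show ?thesis using True by simp
    qed simp
  qed
  have "(\<integral>\<^sup>+z. inv_sqrt (D I z) \<partial>(\<Pi>\<^sub>M i\<in>I. ?N)) \<le> C ^ card I"
    using \<open>finite I\<close>
  proof (induction I rule: finite_induct)
    case empty
    have "(\<chi> k. axis k 1) = (mat 1 :: real^'p^'p)" by (auto simp: vec_eq_iff mat_def axis_def)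
    then have "inv_sqrt (D {} z) = 1" for z by (simp add: D_def inv_sqrt_def)
    then show ?case by (simp add: PiM_empty)
  next
    case (insert l I)
    have step: "(\<integral>\<^sup>+y. inv_sqrt (D (insert l I) (z(l := y))) \<partial>?N) \<le> C * inv_sqrt (D I z)" for z
    proof (cases "l \<in> range \<iota>")
      case False
      then have "D (insert l I) (z(l := y)) = D I z" for y
        unfolding D_def by (intro arg_cong[where f=det]) (auto simp: vec_eq_iff)
      then have "(\<integral>\<^sup>+y. inv_sqrt (D (insert l I) (z(l := y))) \<partial>?N) = inv_sqrt (D I z)"
        by (simp add: N.emeasure_space_1[simplified])
      also have "\<dots> \<le> C * inv_sqrt (D I z)" using mult_right_mono[OF C(2), of "inv_sqrt (D I z)"] by simp
      finally show ?thesis .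
    next
      case True
      then obtain i where l: "l = \<iota> i" by blast
      define A where "A = (\<lambda>k. if \<iota> k \<in> I then z (\<iota> k) $ 1 else (axis k 1 :: real^'p))"
      obtain c where c: "\<And>v. det (\<chi> k. if k = i then v else A k) = v \<bullet> c"
        using det_row_linear[of i A] by blast
      have 1: "D (insert l I) (z(l := y)) = (y $ 1) \<bullet> c" for y
        unfolding D_def c[symmetric] l using \<iota>
        by (intro arg_cong[where f=det]) (auto simp: vec_eq_iff A_def dest: injD)
      have 2: "D I z = axis i 1 \<bullet> c"
        unfolding D_def c[symmetric] using insert.hyps(2) l
        by (intro arg_cong[where f=det]) (auto simp: vec_eq_iff A_def)
      have le: "\<bar>D I z\<bar> \<le> norm c"
        unfolding 2 using Cauchy_Schwarz_ineq2[of "axis i 1" c] by simp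
      show ?thesis
      proof (cases "c = 0")
        case True
        then have "D I z = 0" using le by simp
        then have "C * inv_sqrt (D I z) = \<infinity>"
          using C(2) by (auto simp: inv_sqrt_def ennreal_mult_top)
        then show ?thesis by simp
      next
        case False
        have "(\<integral>\<^sup>+y. inv_sqrt (D (insert l I) (z(l := y))) \<partial>?N) \<le> C * inv_sqrt (norm c)"
          unfolding 1 by (rule C(3)[OF False])
        also have "\<dots> \<le> C * inv_sqrt (D I z)"
          using le by (intro mult_left_mono inv_sqrt_antimono) auto
        finally show ?thesis .
      qed
    qed
    have "(\<integral>\<^sup>+z. inv_sqrt (D (insert l I) z) \<partial>(\<Pi>\<^sub>M i\<in>insert l I. ?N))
       = (\<integral>\<^sup>+z. (\<integral>\<^sup>+y. inv_sqrt (D (insert l I) (z(l := y))) \<partial>?N) \<partial>(\<Pi>\<^sub>M i\<in>I. ?N))"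
      using insert.hyps mD by (intro product_nn_integral_insert measurable_compose[OF _ borel_measurable_inv_sqrt]) auto
    also have "\<dots> \<le> (\<integral>\<^sup>+z. C * inv_sqrt (D I z) \<partial>(\<Pi>\<^sub>M i\<in>I. ?N))"
      by (intro nn_integral_mono step)
    also have "\<dots> = C * (\<integral>\<^sup>+z. inv_sqrt (D I z) \<partial>(\<Pi>\<^sub>M i\<in>I. ?N))"
      by (intro nn_integral_cmult measurable_compose[OF mD borel_measurable_inv_sqrt])
    also have "\<dots> \<le> C * C ^ card I" by (intro mult_left_mono insert.IH) auto
    finally show ?case using insert.hyps by simp
  qed
  also have "C ^ card I < \<infinity>" using C(1) by (simp add: power_less_top_ennreal)
  finally show ?thesis by (simp add: D_def)
qed


section \<open>The joint distribution of the observation and the scatter matrix\<close>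

lemma pos_def_iff_semidef_nonsingular: "pos_def A \<longleftrightarrow> pos_semidef A \<and> det A \<noteq> 0"
  using pos_semidef_nonsingular_imp_pos_def pos_def_imp_semidef pos_def_matrix_inv(5)
  by (metis less_irrefl)

lemma closed_pos_semidef: "closed {A::real^'p^'p. pos_semidef A}"
proof -
  have "linear (\<lambda>A::real^'p^'p. x \<bullet> (A *v x))" for x
    by (simp add: linear_iff matrix_vector_mult_add_rdistrib inner_add_right scaleR_matrix_vector_assoc[symmetric])
  then have c: "continuous_on UNIV (\<lambda>A::real^'p^'p. x \<bullet> (A *v x))" for x
    by (intro linear_continuous_on) (simp add: linear_linear)
  have "{A::real^'p^'p. pos_semidef A} = {A. transpose A = A} \<inter> (\<Inter>x. {A. 0 \<le> x \<bullet> (A *v x)})"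
    by (auto simp: pos_semidef_def)
  moreover have "closed {A::real^'p^'p. transpose A = A}"
    by (intro closed_Collect_eq continuous_intros linear_continuous_on[OF bounded_linear_transpose])
  moreover have "closed (\<Inter>x. {A::real^'p^'p. 0 \<le> x \<bullet> (A *v x)})"
    by (intro closed_INT ballI closed_Collect_le continuous_intros c)
  ultimately show ?thesis by auto
qed

lemma pred_pos_def [measurable]: "Measurable.pred borel (pos_def :: real^'p^'p \<Rightarrow> bool)"
proof -
  have [measurable]: "{A::real^'p^'p. pos_semidef A} \<in> sets borel" by (rule borel_closed[OF closed_pos_semidef])
  have [measurable]: "Measurable.pred borel (pos_semidef :: real^'p^'p \<Rightarrow> bool)" by (simp add: pred_def)
  show ?thesis unfolding pos_def_iff_semidef_nonsingular[abs_def] by measurable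
qed

lemma gram_row_quadratic: "(z ** ip) \<bullet> (z ** V) = trace (transpose ip ** gram z ** V)"
  by (simp add: inner_eq_trace matrix_transpose_mul gram_def matrix_mul_assoc)

text \<open>
  The sample space carries the observation \<open>X\<close> and the \<open>n\<close> Gaussian rows whose scatter matrix has the Wishart
  distribution.  Working with the rows, both Stein identities are instances of the Gaussian one.
\<close>

locale wishart_model =
  fixes n :: nat and \<Theta> :: "real^'p^'m" and \<Sigma> :: "real^'p^'p" and r :: real
  assumes \<Sigma>: "pos_def \<Sigma>" and pn: "CARD('p) \<le> n" and pm: "CARD('p) \<le> CARD('m)" and r: "0 < r"
begin

abbreviation NX :: "(real^'p^'m) measure" where "NX \<equiv> matrix_normal \<Theta> (mat 1) \<Sigma>"
abbreviation NZ :: "(real^'p^1) measure" where "NZ \<equiv> matrix_normal 0 (mat 1) \<Sigma>"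
abbreviation Q :: "(nat \<Rightarrow> real^'p^1) measure" where "Q \<equiv> \<Pi>\<^sub>M i\<in>{..<n}. NZ"
abbreviation P :: "((real^'p^'m) \<times> (nat \<Rightarrow> real^'p^1)) measure" where "P \<equiv> NX \<Otimes>\<^sub>M Q"
abbreviation ip :: "real^'p^'p" where "ip \<equiv> matrix_inv \<Sigma>"

definition scatter :: "(nat \<Rightarrow> real^'p^1) \<Rightarrow> real^'p^'p" where "scatter z = (\<Sum>i<n. gram (z i))"

definition U :: "(real^'p^'m) \<times> (nat \<Rightarrow> real^'p^1) \<Rightarrow> real^'p^'p" where
  "U w = shrinkage r (scatter (snd w)) (gram (fst w))"
definition B :: "(real^'p^'m) \<times> (nat \<Rightarrow> real^'p^1) \<Rightarrow> real^'p^'p" where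
  "B w = ridge_inv r (scatter (snd w)) (gram (fst w))"

sublocale NX: prob_space NX by (rule prob_space_matrix_normal[OF \<Sigma>])
sublocale NZ: prob_space NZ by (rule prob_space_matrix_normal[OF \<Sigma>])
sublocale Z: product_sigma_finite "\<lambda>i::nat. NZ" ..
sublocale Q: prob_space Q by (rule prob_space_PiM) (rule NZ.prob_space_axioms)
sublocale P: pair_prob_space NX Q ..

lemma sets_component [measurable]: "i < n \<Longrightarrow> (\<lambda>z. z i) \<in> borel_measurable Q"
  using measurable_component_singleton[of i "{..<n}" "\<lambda>_. NZ"] by (simp cong: measurable_cong_sets)

lemma fst_measurable [measurable]: "fst \<in> borel_measurable P"
  using measurable_fst[of NX Q] by (simp cong: measurable_cong_sets)

lemma snd_component_measurable [measurable]: "i < n \<Longrightarrow> (\<lambda>w. snd w i) \<in> borel_measurable P"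
  using measurable_compose[OF measurable_snd sets_component] .

lemma scatter_measurable [measurable]: "scatter \<in> borel_measurable Q"
  unfolding scatter_def by measurable

lemma scatter_snd_measurable [measurable]: "(\<lambda>w. scatter (snd w)) \<in> borel_measurable P"
  using measurable_compose[OF measurable_snd scatter_measurable] .

lemma U_measurable [measurable]: "U \<in> borel_measurable P" "B \<in> borel_measurable P"
  unfolding U_def B_def shrinkage_def ridge_inv_def by measurable

lemma row_le_scatter: "i < n \<Longrightarrow> (norm (z i *v x))\<^sup>2 \<le> x \<bullet> (scatter z *v x)"
proof -
  assume i: "i < n"
  have "x \<bullet> (scatter z *v x) = (\<Sum>l<n. x \<bullet> (gram (z l) *v x))"
    unfolding scatter_def
    by (induction n) (simp_all add: matrix_vector_mult_add_rdistrib inner_add_right)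
  also have "\<dots> = (\<Sum>l<n. (norm (z l *v x))\<^sup>2)" by (simp add: inner_gram)
  also have "\<dots> \<ge> (norm (z i *v x))\<^sup>2" using i by (intro member_le_sum) auto
  finally show ?thesis .
qed

lemma trace_scatter: "trace (scatter z) = (\<Sum>i<n. (norm (z i))\<^sup>2)"
proof -
  have "trace (scatter z) = (\<Sum>i<n. trace (gram (z i)))"
    unfolding scatter_def by (rule linear_sum[OF bounded_linear.linear[OF bounded_linear_trace]])
  then show ?thesis by (simp add: power2_norm_eq_inner inner_eq_trace gram_def)
qed

text \<open>
  Select \<open>p\<close> of the \<open>n\<close> rows and let \<open>D\<close> be the square matrix that they form.  The scatter matrix is at least
  \<open>D\<^sup>T D\<close>, so \<open>- ln det S \<le> - 2 ln \<bar>det D\<bar> \<le> 4 \<bar>det D\<bar>\<^sup>-\<^sup>1\<^sup>/\<^sup>2\<close>.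
\<close>

lemma nn_integral_neg_ln_det_scatter: "(\<integral>\<^sup>+z. ennreal (- ln (det (scatter z))) \<partial>Q) < \<infinity>"
  and AE_pos_def_scatter: "AE z in Q. pos_def (scatter z)"
proof -
  obtain \<iota> :: "'p \<Rightarrow> nat" where \<iota>: "inj \<iota>" "range \<iota> \<subseteq> {..<n}"
  proof -
    have "card (UNIV :: 'p set) \<le> card {..<n}" using pn by simp
    then show ?thesis using that card_le_inj[of "UNIV :: 'p set" "{..<n}"] by auto
  qed
  define D where "D = (\<lambda>z :: nat \<Rightarrow> real^'p^1. (\<chi> k. z (\<iota> k) $ 1) :: real^'p^'p)"
  have Dfin: "(\<integral>\<^sup>+z. inv_sqrt (det (D z)) \<partial>Q) < \<infinity>"
    using nn_integral_inv_sqrt_det_finite[OF \<Sigma> \<iota>(1) finite_lessThan[of n]] \<iota>(2)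
    by (simp add: D_def image_subset_iff)
  have mD [measurable]: "(\<lambda>z. det (D z)) \<in> borel_measurable Q"
  proof (intro borel_measurable_matrix_det borel_measurable_matrixI)
    fix k l
    have "\<iota> k < n" using \<iota>(2) by auto
    from measurable_compose[OF sets_component[OF this] borel_measurable_matrix_nth]
    show "(\<lambda>z. D z $ k $ l) \<in> borel_measurable Q" by (simp add: D_def)
  qed
  have gramD: "scatter z = gram (D z) + (\<Sum>i\<in>{..<n} - range \<iota>. gram (z i))" for z
  proof -
    have "gram (D z) = (\<Sum>k\<in>UNIV. gram (z (\<iota> k)))"
      by (simp add: vec_eq_iff gram_def matrix_matrix_mult_def transpose_def D_def)
    also have "\<dots> = (\<Sum>i\<in>range \<iota>. gram (z i))" using \<iota>(1) by (simp add: sum.reindex)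
    finally show ?thesis unfolding scatter_def
      using sum.subset_diff[OF \<iota>(2), of "\<lambda>i. gram (z i)"] by (simp add: add.commute)
  qed
  have detg: "det (gram (D z)) = (det (D z))\<^sup>2" for z by (simp add: gram_def det_mul power2_eq_square)
  have pd: "pos_def (gram (D z))" if "det (D z) \<noteq> 0" for z
    using that by (intro pos_semidef_nonsingular_imp_pos_def pos_semidef_gram) (simp add: detg)
  have ps: "pos_semidef (\<Sum>i\<in>{..<n} - range \<iota>. gram (z i))" for z
    by (intro pos_semidef_sum pos_semidef_gram)
  have ineq: "pos_def (scatter z) \<and> ennreal (- ln (det (scatter z))) \<le> 4 * inv_sqrt (det (D z))"
    if nz: "det (D z) \<noteq> 0" for z
  proof
    show "pos_def (scatter z)"
      unfolding gramD using pos_def_add_semidef[OF pd[OF nz] ps, of 1] by simp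
    define u where "u = \<bar>det (D z)\<bar>"
    have u: "u > 0" using nz by (simp add: u_def)
    have "u\<^sup>2 \<le> det (scatter z)"
      unfolding gramD using det_add_semidef_ge[OF pd[OF nz] ps] by (simp add: detg u_def)
    then have "- ln (det (scatter z)) \<le> - ln (u\<^sup>2)" using u by (simp add: ln_mono)
    also have "\<dots> = 4 * ln (inverse (sqrt u))"
      using u by (simp add: ln_realpow ln_inverse ln_sqrt)
    also have "\<dots> \<le> 4 * inverse (sqrt u)" using u ln_le_minus_one[of "inverse (sqrt u)"] by simp
    finally have "ennreal (- ln (det (scatter z))) \<le> ennreal (4 * inverse (sqrt u))" by (rule ennreal_leI)
    also have "\<dots> = 4 * inv_sqrt (det (D z))"
      using u by (simp add: inv_sqrt_def inverse_ennreal ennreal_mult u_def)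
    finally show "ennreal (- ln (det (scatter z))) \<le> 4 * inv_sqrt (det (D z))" .
  qed
  have "AE z in Q. inv_sqrt (det (D z)) \<noteq> \<infinity>"
    using Dfin by (intro nn_integral_PInf_AE) auto
  then have AE: "AE z in Q. det (D z) \<noteq> 0"
    by eventually_elim (auto simp: inv_sqrt_def)
  then show "AE z in Q. pos_def (scatter z)" by eventually_elim (simp add: ineq)
  have "(\<integral>\<^sup>+z. ennreal (- ln (det (scatter z))) \<partial>Q) \<le> (\<integral>\<^sup>+z. 4 * inv_sqrt (det (D z)) \<partial>Q)"
  proof (rule nn_integral_mono_AE)
    show "AE z in Q. ennreal (- ln (det (scatter z))) \<le> 4 * inv_sqrt (det (D z))"
      using AE by eventually_elim (simp add: ineq)
  qed
  also have "\<dots> = 4 * (\<integral>\<^sup>+z. inv_sqrt (det (D z)) \<partial>Q)" by (rule nn_integral_cmult) measurable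
  also have "\<dots> < \<infinity>" using Dfin by (simp add: ennreal_mult_less_top)
  finally show "(\<integral>\<^sup>+z. ennreal (- ln (det (scatter z))) \<partial>Q) < \<infinity>" .
qed

lemma AE_pos_def_gram_X: "AE X in NX. pos_def (gram X)"
  by (rule AE_matrix_normalI[OF AE_pos_def_gram[OF pm]])

lemma AE_P_snd: "AE z in Q. R z \<Longrightarrow> {z\<in>space Q. R z} \<in> sets Q \<Longrightarrow> AE w in P. R (snd w)"
proof (rule P.AE_pair_measure)
  assume R: "AE z in Q. R z" and [measurable]: "{z\<in>space Q. R z} \<in> sets Q"
  have "Measurable.pred Q R" by (simp add: pred_def)
  then have "Measurable.pred P (\<lambda>w. R (snd w))" by (rule measurable_compose[OF measurable_snd])
  then show "{x \<in> space P. R (snd x)} \<in> sets P" by (simp add: pred_def)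
  show "AE x in NX. AE y in Q. R (snd (x, y))" using R by simp
qed

lemma AE_P_pos_def: "AE w in P. pos_def (scatter (snd w))"
  by (intro AE_P_snd AE_pos_def_scatter) measurable

text \<open>
  The form in which almost sure statements are proved from here on: it is enough to treat sample points at which
  the diagonalizing coordinates exist, that is, at which the scatter matrix is positive definite.
\<close>

lemma AE_coords:
  assumes "\<And>w J L g. coords r (scatter (snd w)) (gram (fst w)) J L g \<Longrightarrow> R w"
  shows "AE w in P. R w"
  using AE_P_pos_def
proof eventually_elim
  case (elim w)
  show ?case
    by (rule coords_exist[OF r elim pos_semidef_gram]) (rule assms)
qed

lemma integrable_P_snd:
  assumes "integrable Q (h :: _ \<Rightarrow> real)"
  shows "integrable P (\<lambda>w. h (snd w))"
proof (rule P.Fubini_integrable)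
  show "(\<lambda>w. h (snd w)) \<in> borel_measurable P"
    by (rule measurable_compose[OF measurable_snd borel_measurable_integrable[OF assms]])
qed (use assms in auto)

lemma integrable_P_fst:
  assumes "integrable NX (h :: _ \<Rightarrow> real)"
  shows "integrable P (\<lambda>w. h (fst w))"
proof (rule P.Fubini_integrable)
  show "(\<lambda>w. h (fst w)) \<in> borel_measurable P"
    by (rule measurable_compose[OF measurable_fst borel_measurable_integrable[OF assms]])
  show "integrable NX (\<lambda>x. \<integral>y. norm (h (fst (x, y))) \<partial>Q)"
    using assms Q.prob_space by simp
qed auto

lemma integrable_row: "i < n \<Longrightarrow> integrable P (\<lambda>w. (norm (snd w i))\<^sup>2)"
proof -
  assume i: "i < n"
  have "integrable NZ (\<lambda>y. (norm y)\<^sup>2)"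
    unfolding power2_norm_eq_inner
    by (intro integrable_matrix_normal_poly_growth \<Sigma> continuous_intros poly_growth_inner poly_growth_ident)
  then have "integrable (distr Q NZ (\<lambda>z. z i)) (\<lambda>y. (norm y)\<^sup>2)"
    using i by (subst distr_PiM_component) (auto intro: NZ.prob_space_axioms)
  then have "integrable Q (\<lambda>z. (norm (z i))\<^sup>2)"
    using i by (subst (asm) integrable_distr_eq) (auto cong: measurable_cong_sets)
  then show ?thesis by (rule integrable_P_snd)
qed

lemma integrable_trace_scatter: "integrable P (\<lambda>w. trace (scatter (snd w)))"
  unfolding trace_scatter by (intro Bochner_Integration.integrable_sum integrable_row) auto

lemma integrable_X: "integrable P (\<lambda>w. (norm (fst w - \<Theta>))\<^sup>2)"
proof (rule integrable_P_fst)
  show "integrable NX (\<lambda>X. (norm (X - \<Theta>))\<^sup>2)"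
    unfolding power2_norm_eq_inner
    by (intro integrable_matrix_normal_poly_growth \<Sigma> continuous_intros poly_growth_inner poly_growth_ident
        poly_growth_diff poly_growth_const)
qed

lemma integrable_bounded:
  fixes f :: "(real^'p^'m) \<times> (nat \<Rightarrow> real^'p^1) \<Rightarrow> real"
  assumes "f \<in> borel_measurable P" "\<And>w J L g. coords r (scatter (snd w)) (gram (fst w)) J L g \<Longrightarrow> \<bar>f w\<bar> \<le> C"
  shows "integrable P f"
  by (rule P.integrable_const_bound[where B=C]) (auto intro!: AE_coords assms)

lemma inner_field_bound:
  fixes Y V :: "real^'p^'q"
  assumes "norm (Y ** ip) \<le> a * norm Y" "norm V \<le> c * sqrt t" "a \<ge> 0" "c \<ge> 0" "t \<ge> 0"
  shows "\<bar>(Y ** ip) \<bullet> V\<bar> \<le> a * c * ((norm Y)\<^sup>2 + t)"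
proof -
  have "\<bar>(Y ** ip) \<bullet> V\<bar> \<le> norm (Y ** ip) * norm V" by (rule Cauchy_Schwarz_ineq2)
  also have "\<dots> \<le> (a * norm Y) * (c * sqrt t)" using assms by (intro mult_mono) auto
  also have "\<dots> = a * c * (norm Y * sqrt t)" by simp
  also have "\<dots> \<le> a * c * ((norm Y)\<^sup>2 + t)"
  proof (intro mult_left_mono)
    have "2 * (norm Y * sqrt t) \<le> (norm Y)\<^sup>2 + (sqrt t)\<^sup>2"
      using sum_squares_bound[of "norm Y" "sqrt t"] by simp
    moreover have "0 \<le> norm Y * sqrt t" using assms by simp
    moreover have "(sqrt t)\<^sup>2 = t" using assms by simp
    ultimately show "norm Y * sqrt t \<le> (norm Y)\<^sup>2 + t" by linarith
  qed (use assms in simp)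
  finally show ?thesis .
qed

lemma integrable_inner_field:
  fixes Y V :: "(real^'p^'m) \<times> (nat \<Rightarrow> real^'p^1) \<Rightarrow> real^'p^'q"
  assumes [measurable]: "Y \<in> borel_measurable P" "V \<in> borel_measurable P"
    and Y: "integrable P (\<lambda>w. (norm (Y w))\<^sup>2)"
    and V: "\<And>w J L g. coords r (scatter (snd w)) (gram (fst w)) J L g \<Longrightarrow> norm (V w) \<le> c * sqrt (trace (scatter (snd w)))"
    and c: "c \<ge> 0"
  shows "integrable P (\<lambda>w. (Y w ** ip) \<bullet> V w)"
proof -
  obtain a where a: "a > 0" "\<And>y::real^'p^'q. norm (y ** ip) \<le> norm y * a"
    using bounded_linear.pos_bounded[OF mmul.bounded_linear_left, of ip] by metis
  show ?thesis
  proof (rule Bochner_Integration.integrable_bound)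
    show "integrable P (\<lambda>w. a * c * ((norm (Y w))\<^sup>2 + trace (scatter (snd w))))"
      by (intro integrable_mult_right Bochner_Integration.integrable_add Y integrable_trace_scatter)
    show "AE w in P. norm ((Y w ** ip) \<bullet> V w) \<le> norm (a * c * ((norm (Y w))\<^sup>2 + trace (scatter (snd w))))"
    proof (rule AE_coords)
      fix w :: "(real^'p^'m) \<times> (nat \<Rightarrow> real^'p^1)" and J L g assume co: "coords r (scatter (snd w)) (gram (fst w)) J L g"
      have t: "trace (scatter (snd w)) \<ge> 0" by (simp add: trace_scatter sum_nonneg)
      have "\<bar>(Y w ** ip) \<bullet> V w\<bar> \<le> a * c * ((norm (Y w))\<^sup>2 + trace (scatter (snd w)))"
        using a V[OF co] c t by (intro inner_field_bound) (auto simp: mult.commute)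
      then show "norm ((Y w ** ip) \<bullet> V w) \<le> norm (a * c * ((norm (Y w))\<^sup>2 + trace (scatter (snd w))))"
        by simp
    qed
  qed measurable
qed

lemma mult_const: obtains K where "K \<ge> 0"
  "\<And>A B. norm ((A::real^'p^'q) ** (B::real^'p^'p)) \<le> norm A * norm B * K"
  using mmul.pos_bounded that by (metis less_imp_le)

lemma integrable_row_field:
  assumes i: "i < n"
  shows "integrable P (\<lambda>w. (snd w i ** ip) \<bullet> (snd w i ** U w))"
    "integrable P (\<lambda>w. (snd w i ** ip) \<bullet> (snd w i ** U w ** U w))"
proof -
  obtain K where K: "K \<ge> 0" "\<And>A B. norm ((A::real^'p^1) ** (B::real^'p^'p)) \<le> norm A * norm B * K"
    using mult_const by blast
  have b: "norm (snd w i ** U w) \<le> sqrt CARD('p) * K * sqrt (trace (scatter (snd w)))"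
    "norm (snd w i ** U w ** U w) \<le> sqrt CARD('p) * K * sqrt (trace (scatter (snd w)))"
    if co: "coords r (scatter (snd w)) (gram (fst w)) J L g" for w :: "(real^'p^'m) \<times> (nat \<Rightarrow> real^'p^1)" and J L g
    using coords.norm_mult_U_le[OF co row_le_scatter[OF i] K(2,1)] by (simp_all add: U_def mult_ac)
  show "integrable P (\<lambda>w. (snd w i ** ip) \<bullet> (snd w i ** U w))"
    by (rule integrable_inner_field[where c="sqrt CARD('p) * K"])
      (use i K b in \<open>auto intro: integrable_row\<close>)
  show "integrable P (\<lambda>w. (snd w i ** ip) \<bullet> (snd w i ** U w ** U w))"
    by (rule integrable_inner_field[where c="sqrt CARD('p) * K"])
      (use i K b in \<open>auto intro: integrable_row\<close>)
qed

lemma integrable_X_field: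
  shows "integrable P (\<lambda>w. ((fst w - \<Theta>) ** ip) \<bullet> (fst w ** U w))"
proof -
  obtain K where K: "K \<ge> 0" "\<And>A B. norm ((A::real^'p^'m) ** (B::real^'p^'p)) \<le> norm A * norm B * K"
    using mult_const by blast
  show ?thesis
  proof (rule integrable_inner_field[where c="sqrt (CARD('p) / r) * K"])
    fix w :: "(real^'p^'m) \<times> (nat \<Rightarrow> real^'p^1)" and J L g assume co: "coords r (scatter (snd w)) (gram (fst w)) J L g"
    show "norm (fst w ** U w) \<le> sqrt (CARD('p) / r) * K * sqrt (trace (scatter (snd w)))"
      using coords.norm_mult_U_le'[OF co refl K(2,1)] by (simp add: U_def mult_ac)
  qed (use K r in \<open>auto intro: integrable_X\<close>)
qed

end


section \<open>Expectations by integration by parts\<close>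

text \<open>
  The divergences of \<open>z \<mapsto> z U\<close> and \<open>z \<mapsto> z U\<^sup>2\<close> with respect to a single row \<open>z\<close> with Gram matrix \<open>G\<close>, as functions of
  the current values of \<open>B\<close> and \<open>U\<close>.
\<close>

definition row_div1 :: "real^'p^'p \<Rightarrow> real^'p^'p \<Rightarrow> real^'p^'p \<Rightarrow> real" where
  "row_div1 B U G = trace U + trace (B ** G ** (mat 1 - U)) + trace (B ** G) * trace (mat 1 - U)"

definition row_div2 :: "real^'p^'p \<Rightarrow> real^'p^'p \<Rightarrow> real^'p^'p \<Rightarrow> real" where
  "row_div2 B U G = trace (U ** U) + trace (B ** G ** ((mat 1 - U) ** U))
     + trace (B ** G) * trace ((mat 1 - U) ** U) + trace (U ** B ** G ** (mat 1 - U))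
     + trace (U ** B ** G) * trace (mat 1 - U)"

context coords begin

lemma one_coords: "mat 1 = L ** diag 1 ** J"
  by (simp add: diag_linear(4)[symmetric] cancel)

lemma K_coords: "mat 1 - shrinkage r S W = L ** diag (1 - g) ** J"
  unfolding UL by (simp add: diag_linear(2) mmul.diff_left mmul.diff_right one_coords[symmetric])

lemma UB_coords: "shrinkage r S W ** ridge_inv r S W = L ** diag (g * g) ** transpose L"
  by (simp add: UL BL matrix_mul_assoc[symmetric] cancel diag_mult_left)

lemma g_bounds: "\<bar>g $ j\<bar> \<le> 1" "\<bar>1 - g $ j\<bar> \<le> 1"
  using g(1)[of j] g(2)[of j] by auto

lemma row_div_bounds:
  fixes Y :: "real^'p^'m"
  assumes Y: "\<And>x. (norm (Y *v x))\<^sup>2 \<le> x \<bullet> (S *v x)"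
  defines "c \<equiv> real CARD('p)"
  shows "\<bar>row_div1 (ridge_inv r S W) (shrinkage r S W) (gram Y)\<bar> \<le> c + c + c * c"
    "\<bar>row_div2 (ridge_inv r S W) (shrinkage r S W) (gram Y)\<bar> \<le> c + c + c * c + c + c * c"
proof -
  have gg: "\<bar>g $ j * g $ j\<bar> \<le> 1" "\<bar>g $ j * (1 - g $ j)\<bar> \<le> 1" "\<bar>(1 - g $ j) * g $ j\<bar> \<le> 1" for j
    unfolding abs_mult by (intro mult_le_one g_bounds abs_ge_zero)+
  have gg1: "g $ j * g $ j \<le> 1" for j using gg(1)[of j] by simp
  have trb: "\<bar>trace (L ** diag a ** J)\<bar> \<le> c" if "\<And>j. \<bar>a $ j\<bar> \<le> 1" for a
    unfolding c_def by (rule abs_trace_coords_le[OF that])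
  have K: "(mat 1 - shrinkage r S W) ** shrinkage r S W = L ** diag ((1 - g) * g) ** J"
    unfolding K_coords by (simp add: UL coords_mult)
  have t1: "\<bar>trace (shrinkage r S W)\<bar> \<le> c" unfolding UL by (rule trb) (rule g_bounds)
  have t2: "\<bar>trace (shrinkage r S W ** shrinkage r S W)\<bar> \<le> c"
    unfolding UL coords_mult by (rule trb) (simp add: gg gg1)
  have tK: "\<bar>trace (mat 1 - shrinkage r S W)\<bar> \<le> c" unfolding K_coords by (rule trb) (simp add: g_bounds)
  have tKU: "\<bar>trace ((mat 1 - shrinkage r S W) ** shrinkage r S W)\<bar> \<le> c"
    unfolding K by (rule trb) (simp add: gg gg1)
  have b1: "\<bar>trace (ridge_inv r S W ** gram Y ** (mat 1 - shrinkage r S W))\<bar> \<le> c"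
    unfolding BL K_coords c_def by (rule trace_gram_bound[OF Y]) (simp add: gg gg1)
  have b2: "\<bar>trace (ridge_inv r S W ** gram Y)\<bar> \<le> c"
  proof -
    have "\<bar>trace (ridge_inv r S W ** gram Y ** (L ** diag 1 ** J))\<bar> \<le> c"
      unfolding BL c_def by (rule trace_gram_bound[OF Y]) (simp add: g_bounds)
    then show ?thesis by (simp add: one_coords[symmetric])
  qed
  have b3: "\<bar>trace (ridge_inv r S W ** gram Y ** ((mat 1 - shrinkage r S W) ** shrinkage r S W))\<bar> \<le> c"
  proof -
    have "\<bar>g $ j * ((1 - g) * g) $ j\<bar> \<le> 1" for j
      using mult_le_one[OF g_bounds(1) abs_ge_zero gg(3), of j j] by (simp add: abs_mult mult_ac)
    then show ?thesis unfolding BL K c_def by (rule trace_gram_bound[OF Y])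
  qed
  have b4: "\<bar>trace (shrinkage r S W ** ridge_inv r S W ** gram Y ** (mat 1 - shrinkage r S W))\<bar> \<le> c"
  proof -
    have "\<bar>(g * g) $ j * (1 - g) $ j\<bar> \<le> 1" for j
      using mult_le_one[OF g_bounds(1) abs_ge_zero gg(2), of j j] by (simp add: abs_mult mult_ac)
    then show ?thesis unfolding UB_coords K_coords c_def by (rule trace_gram_bound[OF Y])
  qed
  have b5: "\<bar>trace (shrinkage r S W ** ridge_inv r S W ** gram Y)\<bar> \<le> c"
  proof -
    have "\<bar>trace (shrinkage r S W ** ridge_inv r S W ** gram Y ** (L ** diag 1 ** J))\<bar> \<le> c"
      unfolding UB_coords c_def by (rule trace_gram_bound[OF Y]) (simp add: gg gg1)
    then show ?thesis by (simp add: one_coords[symmetric])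
  qed
  have p: "\<bar>x * y\<bar> \<le> c * c" if "\<bar>x\<bar> \<le> c" "\<bar>y\<bar> \<le> c" for x y :: real
    unfolding abs_mult using that by (intro mult_mono) auto
  show "\<bar>row_div1 (ridge_inv r S W) (shrinkage r S W) (gram Y)\<bar> \<le> c + c + c * c"
    unfolding row_div1_def using t1 b1 p[OF b2 tK] by linarith
  show "\<bar>row_div2 (ridge_inv r S W) (shrinkage r S W) (gram Y)\<bar> \<le> c + c + c * c + c + c * c"
    unfolding row_div2_def using t2 b3 p[OF b2 tKU] b4 p[OF b5 tK] by linarith
qed

end

lemma sum_trace_mid: "(\<Sum>i\<in>I. trace (A ** G i ** C)) = trace (A ** (\<Sum>i\<in>I. G i) ** C)"
  for A :: "real^'p^'q" and G :: "_ \<Rightarrow> real^'p^'p" and C :: "real^'q^'p"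
proof -
  have "linear (\<lambda>G::real^'p^'p. trace (A ** G ** C))"
    by (simp add: linear_iff mat_linear)
  from linear_sum[OF this, of G I] show ?thesis by simp
qed

lemma sum_trace_right: "(\<Sum>i\<in>I. trace (A ** G i)) = trace (A ** (\<Sum>i\<in>I. G i))"
  for A :: "real^'p^'p" and G :: "_ \<Rightarrow> real^'p^'p"
  using sum_trace_mid[of A G "mat 1"] by simp

text \<open>
  The divergences are linear in the Gram matrices of the rows, whose sum is \<open>S\<close>, and \<open>B S = U\<close>.
\<close>

lemma sum_row_div1:
  fixes G :: "nat \<Rightarrow> real^'p^'p"
  assumes "B ** (\<Sum>i<n. G i) = U"
  shows "(\<Sum>i<n. row_div1 B U (G i)) = (real n + real CARD('p) + 1) * trace U - trace (U ** U) - (trace U)\<^sup>2"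
  unfolding row_div1_def sum.distrib sum_trace_mid sum_trace_right sum_distrib_right[symmetric] assms
  by (simp add: mat_linear trace_I algebra_simps power2_eq_square)

lemma sum_row_div2:
  fixes G :: "nat \<Rightarrow> real^'p^'p"
  assumes BU: "B ** (\<Sum>i<n. G i) = U"
  shows "(\<Sum>i<n. row_div2 B U (G i)) = (real n + real CARD('p) + 2) * trace (U ** U) + (trace U)\<^sup>2
      - 2 * trace (U ** U ** U) - 2 * (trace U * trace (U ** U))"
proof -
  have UBU: "U ** B ** (\<Sum>i<n. G i) = U ** U" using BU by (simp add: matrix_mul_assoc[symmetric])
  show ?thesis
    unfolding row_div2_def sum.distrib sum_constant card_lessThan
    unfolding sum_trace_mid sum_trace_right sum_distrib_right[symmetric] BU UBU
    by (simp add: mat_linear trace_I algebra_simps power2_eq_square matrix_mul_assoc)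
qed

context wishart_model begin

lemma BU: "U w = B w ** scatter (snd w)"
  by (simp add: U_def B_def shrinkage_def)

text \<open>
  Fubini's theorem isolates row \<open>i\<close>.  The Gram matrix of \<open>X\<close> may be taken positive definite, because it almost
  surely is; the Stein identity for the row uses this.
\<close>

lemma integral_eq_rowwise:
  fixes F D :: "(real^'p^'m) \<times> (nat \<Rightarrow> real^'p^1) \<Rightarrow> real"
  assumes i: "i < n" and F: "integrable P F" and D: "integrable P D"
    and eq: "\<And>X z. pos_def (gram X) \<Longrightarrow> (\<integral>y. F (X, z(i := y)) \<partial>NZ) = (\<integral>y. D (X, z(i := y)) \<partial>NZ)"
  shows "integral\<^sup>L P F = integral\<^sup>L P D"
proof -
  have ins: "insert i ({..<n} - {i}) = {..<n}" using i by auto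
  have step: "integral\<^sup>L Q h = (\<integral>z. \<integral>y. h (z(i := y)) \<partial>NZ \<partial>(\<Pi>\<^sub>M i\<in>{..<n} - {i}. NZ))"
    if "integrable Q h" for h :: "_ \<Rightarrow> real"
    using Z.product_integral_insert[of "{..<n} - {i}" i h] that by (simp only: ins) auto
  have "AE X in NX. (\<integral>z. F (X, z) \<partial>Q) = (\<integral>z. D (X, z) \<partial>Q)"
    using AE_pos_def_gram_X P.AE_integrable_fst'[OF F] P.AE_integrable_fst'[OF D]
    by eventually_elim (simp add: step eq)
  then have "(\<integral>X. \<integral>z. F (X, z) \<partial>Q \<partial>NX) = (\<integral>X. \<integral>z. D (X, z) \<partial>Q \<partial>NX)"
    using P.integrable_fst'[OF F] P.integrable_fst'[OF D]
    by (intro integral_cong_AE borel_measurable_integrable)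
  then show ?thesis by (simp add: P.integral_fst'[OF F] P.integral_fst'[OF D])
qed

lemma integral_eq_X:
  fixes F D :: "(real^'p^'m) \<times> (nat \<Rightarrow> real^'p^1) \<Rightarrow> real"
  assumes F: "integrable P F" and D: "integrable P D"
    and eq: "\<And>z. pos_def (scatter z) \<Longrightarrow> (\<integral>X. F (X, z) \<partial>NX) = (\<integral>X. D (X, z) \<partial>NX)"
  shows "integral\<^sup>L P F = integral\<^sup>L P D"
proof -
  have F': "integrable P (case_prod (\<lambda>x y. F (x, y)))" and D': "integrable P (case_prod (\<lambda>x y. D (x, y)))"
    using F D by simp_all
  have "AE z in Q. (\<integral>X. F (X, z) \<partial>NX) = (\<integral>X. D (X, z) \<partial>NX)"
    using AE_pos_def_scatter by eventually_elim (rule eq)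
  then have "(\<integral>z. \<integral>X. F (X, z) \<partial>NX \<partial>Q) = (\<integral>z. \<integral>X. D (X, z) \<partial>NX \<partial>Q)"
    using P.integrable_snd[OF F'] P.integrable_snd[OF D']
    by (intro integral_cong_AE borel_measurable_integrable)
  then show ?thesis using P.integral_snd[OF F'] P.integral_snd[OF D'] by simp
qed

lemma row_stein:
  assumes i: "i < n" and X: "pos_def (gram X)"
  shows "(\<integral>y. (y ** ip) \<bullet> (y ** U (X, z(i := y))) \<partial>NZ)
      = (\<integral>y. row_div1 (B (X, z(i := y))) (U (X, z(i := y))) (gram y) \<partial>NZ)"
    "(\<integral>y. (y ** ip) \<bullet> (y ** U (X, z(i := y)) ** U (X, z(i := y))) \<partial>NZ)
      = (\<integral>y. row_div2 (B (X, z(i := y))) (U (X, z(i := y))) (gram y) \<partial>NZ)"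
proof -
\<comment> \<open>the rows other than \<open>i\<close>, which together with \<open>X\<close> are held fixed\<close>
  define S0 where "S0 = (\<Sum>l\<in>{..<n} - {i}. gram (z l))"
  define A where "A = r *\<^sub>R gram X + S0"
  have S0: "pos_semidef S0" unfolding S0_def by (intro pos_semidef_sum pos_semidef_gram)
  have rX: "pos_def (r *\<^sub>R gram X)"
    using X r by (auto simp: pos_def_def transpose_linear scaleR_matrix_vector_assoc[symmetric])
  have A: "pos_def A" unfolding A_def using pos_def_add_semidef[OF rX S0, of 1] by simp
  have tS0: "transpose S0 = S0" using S0 by (simp add: pos_semidef_def)
  note defs = shrink_U_def[OF A tS0] shrink_B_def[OF A tS0] shrink_M_def[OF A tS0] shrink_S_def[OF A tS0 order_refl]
    shrink_K_def[OF A tS0] shrink_div1_def[OF A tS0] shrink_div2_def[OF A tS0]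
  have sc: "scatter (z(i := y)) = S0 + gram y" for y
    unfolding scatter_def S0_def using i by (subst sum.remove[of _ i]) (auto simp: add.commute)
  have B': "B (X, z(i := y)) = shrink_B A 1 y" for y
  proof -
    have "scatter (z(i := y)) + r *\<^sub>R gram X = A + gram y" by (simp add: sc A_def add_ac)
    then show ?thesis by (simp add: B_def ridge_inv_def defs)
  qed
  have U': "U (X, z(i := y)) = shrink_U A S0 1 1 y" for y
    by (simp add: BU B' defs(1,4) sc)
  show "(\<integral>y. (y ** ip) \<bullet> (y ** U (X, z(i := y))) \<partial>NZ)
      = (\<integral>y. row_div1 (B (X, z(i := y))) (U (X, z(i := y))) (gram y) \<partial>NZ)"
    using stein_shrink1[OF A tS0 _ \<Sigma>, of 1 "0::real^'p^1" 1] unfolding U' B'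
    by (simp add: row_div1_def defs(5,6))
  show "(\<integral>y. (y ** ip) \<bullet> (y ** U (X, z(i := y)) ** U (X, z(i := y))) \<partial>NZ)
      = (\<integral>y. row_div2 (B (X, z(i := y))) (U (X, z(i := y))) (gram y) \<partial>NZ)"
    using stein_shrink2[OF A tS0 _ \<Sigma>, of 1 "0::real^'p^1" 1] unfolding U' B'
    by (simp add: row_div2_def defs(5,7))
qed

lemma row_div_measurable:
  assumes [measurable]: "i < n"
  shows "(\<lambda>w. row_div1 (B w) (U w) (gram (snd w i))) \<in> borel_measurable P"
    "(\<lambda>w. row_div2 (B w) (U w) (gram (snd w i))) \<in> borel_measurable P"
  unfolding row_div1_def row_div2_def by measurable

lemma integrable_row_div:
  assumes i: "i < n"
  shows "integrable P (\<lambda>w. row_div1 (B w) (U w) (gram (snd w i)))"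
    "integrable P (\<lambda>w. row_div2 (B w) (U w) (gram (snd w i)))"
proof -
  let ?c = "real CARD('p)"
  show "integrable P (\<lambda>w. row_div1 (B w) (U w) (gram (snd w i)))"
    by (rule integrable_bounded[where C="?c + ?c + ?c * ?c"], rule row_div_measurable[OF i])
      (unfold U_def B_def, erule coords.row_div_bounds[OF _ row_le_scatter[OF i]])
  show "integrable P (\<lambda>w. row_div2 (B w) (U w) (gram (snd w i)))"
    by (rule integrable_bounded[where C="?c + ?c + ?c * ?c + ?c + ?c * ?c"], rule row_div_measurable[OF i])
      (unfold U_def B_def, erule coords.row_div_bounds[OF _ row_le_scatter[OF i]])
qed

lemma trace_scatter_U: "trace (ip ** scatter z ** V) = (\<Sum>i<n. (z i ** ip) \<bullet> (z i ** V))"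
  unfolding gram_row_quadratic pos_def_matrix_inv(3)[OF \<Sigma>] scatter_def sum_trace_mid ..

definition T1 :: "(real^'p^'m) \<times> (nat \<Rightarrow> real^'p^1) \<Rightarrow> real" where "T1 w = trace (U w)"
definition T2 :: "(real^'p^'m) \<times> (nat \<Rightarrow> real^'p^1) \<Rightarrow> real" where "T2 w = trace (U w ** U w)"
definition T3 :: "(real^'p^'m) \<times> (nat \<Rightarrow> real^'p^1) \<Rightarrow> real" where "T3 w = trace (U w ** U w ** U w)"

text \<open>
  \<open>tr (\<Sigma>\<^sup>-\<^sup>1 S U)\<close> is the sum over the rows of \<open>(z \<Sigma>\<^sup>-\<^sup>1) \<bullet> (z U)\<close>, to each of which the Stein identity applies;
  the unknown \<open>\<Sigma>\<close> disappears.
\<close>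

lemma expectation_scatter_U:
  "integrable P (\<lambda>w. trace (ip ** scatter (snd w) ** U w))"
  "(\<integral>w. trace (ip ** scatter (snd w) ** U w) \<partial>P)
    = (\<integral>w. (real n + real CARD('p) + 1) * T1 w - T2 w - (T1 w)\<^sup>2 \<partial>P)"
proof -
  show "integrable P (\<lambda>w. trace (ip ** scatter (snd w) ** U w))"
    unfolding trace_scatter_U by (intro Bochner_Integration.integrable_sum integrable_row_field(1)) auto
  have "(\<integral>w. trace (ip ** scatter (snd w) ** U w) \<partial>P) = (\<Sum>i<n. \<integral>w. (snd w i ** ip) \<bullet> (snd w i ** U w) \<partial>P)"
    unfolding trace_scatter_U by (intro Bochner_Integration.integral_sum integrable_row_field(1)) auto
  also have "\<dots> = (\<Sum>i<n. \<integral>w. row_div1 (B w) (U w) (gram (snd w i)) \<partial>P)"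
    by (intro sum.cong refl integral_eq_rowwise integrable_row_field(1) integrable_row_div)
       (auto simp: row_stein)
  also have "\<dots> = (\<integral>w. (\<Sum>i<n. row_div1 (B w) (U w) (gram (snd w i))) \<partial>P)"
    by (intro Bochner_Integration.integral_sum[symmetric] integrable_row_div) auto
  also have "\<dots> = (\<integral>w. (real n + real CARD('p) + 1) * T1 w - T2 w - (T1 w)\<^sup>2 \<partial>P)"
    by (simp add: sum_row_div1[OF BU[unfolded scatter_def, symmetric]] T1_def T2_def)
  finally show "(\<integral>w. trace (ip ** scatter (snd w) ** U w) \<partial>P)
    = (\<integral>w. (real n + real CARD('p) + 1) * T1 w - T2 w - (T1 w)\<^sup>2 \<partial>P)" .
qed

lemma expectation_scatter_U2:
  "integrable P (\<lambda>w. trace (ip ** scatter (snd w) ** (U w ** U w)))"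
  "(\<integral>w. trace (ip ** scatter (snd w) ** (U w ** U w)) \<partial>P)
    = (\<integral>w. (real n + real CARD('p) + 2) * T2 w + (T1 w)\<^sup>2 - 2 * T3 w - 2 * (T1 w * T2 w) \<partial>P)"
proof -
  show "integrable P (\<lambda>w. trace (ip ** scatter (snd w) ** (U w ** U w)))"
    unfolding trace_scatter_U unfolding matrix_mul_assoc
    by (intro Bochner_Integration.integrable_sum integrable_row_field(2)) auto
  have "(\<integral>w. trace (ip ** scatter (snd w) ** (U w ** U w)) \<partial>P)
      = (\<Sum>i<n. \<integral>w. (snd w i ** ip) \<bullet> (snd w i ** U w ** U w) \<partial>P)"
    unfolding trace_scatter_U unfolding matrix_mul_assoc
    by (intro Bochner_Integration.integral_sum integrable_row_field(2)) auto
  also have "\<dots> = (\<Sum>i<n. \<integral>w. row_div2 (B w) (U w) (gram (snd w i)) \<partial>P)"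
    by (intro sum.cong refl integral_eq_rowwise integrable_row_field(2) integrable_row_div)
       (auto simp: row_stein)
  also have "\<dots> = (\<integral>w. (\<Sum>i<n. row_div2 (B w) (U w) (gram (snd w i))) \<partial>P)"
    by (intro Bochner_Integration.integral_sum[symmetric] integrable_row_div) auto
  also have "\<dots> = (\<integral>w. (real n + real CARD('p) + 2) * T2 w + (T1 w)\<^sup>2 - 2 * T3 w - 2 * (T1 w * T2 w) \<partial>P)"
    by (simp add: sum_row_div2[OF BU[unfolded scatter_def, symmetric]] T1_def T2_def T3_def)
  finally show "(\<integral>w. trace (ip ** scatter (snd w) ** (U w ** U w)) \<partial>P)
    = (\<integral>w. (real n + real CARD('p) + 2) * T2 w + (T1 w)\<^sup>2 - 2 * T3 w - 2 * (T1 w * T2 w) \<partial>P)" .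
qed

lemma T_measurable [measurable]: "T1 \<in> borel_measurable P" "T2 \<in> borel_measurable P" "T3 \<in> borel_measurable P"
  unfolding T1_def T2_def T3_def by measurable

lemma T_bounds:
  assumes "coords r (scatter (snd w)) (gram (fst w)) J L g"
  shows "\<bar>T1 w\<bar> \<le> CARD('p)" "\<bar>T2 w\<bar> \<le> CARD('p)" "\<bar>T3 w\<bar> \<le> CARD('p)"
  using coords.trace_U_bounds[OF assms] by (simp_all add: T1_def T2_def T3_def U_def)

lemma integrable_T:
  "integrable P T1" "integrable P T2" "integrable P T3" "integrable P (\<lambda>w. (T1 w)\<^sup>2)" "integrable P (\<lambda>w. T1 w * T2 w)"
proof -
  show "integrable P T1" "integrable P T2" "integrable P T3"
    by (rule integrable_bounded[where C="CARD('p)"], measurable, erule T_bounds)+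
  show "integrable P (\<lambda>w. T1 w * T2 w)"
    by (rule integrable_bounded[where C="real CARD('p) * real CARD('p)"], measurable)
       (unfold abs_mult, intro mult_mono T_bounds abs_ge_zero of_nat_0_le_iff, assumption+)
  show "integrable P (\<lambda>w. (T1 w)\<^sup>2)"
    unfolding power2_eq_square
    by (rule integrable_bounded[where C="real CARD('p) * real CARD('p)"], measurable)
       (unfold abs_mult, intro mult_mono T_bounds abs_ge_zero of_nat_0_le_iff, assumption+)
qed

text \<open>
  Here \<open>K = - r U\<close>, and \<open>r B W = 1 - U\<close> expresses the divergence by traces of powers of \<open>U\<close>.
\<close>

lemma expectation_X:
  "(\<integral>w. ((fst w - \<Theta>) ** ip) \<bullet> (fst w ** U w) \<partial>P)
    = (\<integral>w. (real CARD('m) - real CARD('p) - 1) * T1 w + T2 w + (T1 w)\<^sup>2 \<partial>P)"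
proof (rule integral_eq_X[OF integrable_X_field])
  show "integrable P (\<lambda>w. (real CARD('m) - real CARD('p) - 1) * T1 w + T2 w + (T1 w)\<^sup>2)"
    by (intro Bochner_Integration.integrable_add integrable_mult_right integrable_T)
  fix z assume S: "pos_def (scatter z)"
  let ?S = "scatter z"
  have tS: "transpose ?S = ?S" by (rule pos_def_sym[OF S])
  note defs = shrink_U_def[OF S tS] shrink_B_def[OF S tS] shrink_M_def[OF S tS] shrink_S_def[OF S tS order_refl]
    shrink_K_def[OF S tS] shrink_div1_def[OF S tS]
  have r0: "0 \<le> r" using r by simp
  have U': "U (X, z) = shrink_U ?S ?S r 0 X" for X
    by (simp add: U_def shrinkage_def ridge_inv_def defs r0)
  have div: "shrink_div1 ?S ?S r 0 X = (real CARD('m) - real CARD('p) - 1) * T1 (X, z) + T2 (X, z) + (T1 (X, z))\<^sup>2" for X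
  proof -
    obtain J L g where co: "coords r ?S (gram X) J L g"
      using coords_exist[OF r S pos_semidef_gram] by blast
    have BW: "r *\<^sub>R (shrink_B ?S r X ** gram X) = mat 1 - U (X, z)"
      using coords.BW[OF co] by (simp add: U_def ridge_inv_def defs r0)
    have K: "shrink_K ?S ?S r 0 X = - (r *\<^sub>R U (X, z))" by (simp add: defs(5) r0 U')
    have trm: "trace (- A) = - trace A" for A :: "real^'p^'p" by (simp add: trace_def sum_negf)
    have a: "trace (shrink_B ?S r X ** gram X ** shrink_K ?S ?S r 0 X) = - trace ((mat 1 - U (X, z)) ** U (X, z))"
      unfolding K BW[symmetric] by (simp add: mat_linear trm)
    have b: "trace (shrink_B ?S r X ** gram X) * trace (shrink_K ?S ?S r 0 X) = - (trace (mat 1 - U (X, z)) * trace (U (X, z)))"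
      unfolding K BW[symmetric] by (simp add: mat_linear trm)
    show ?thesis unfolding defs(6)[OF r0] a b U'[symmetric]
      by (simp add: mat_linear T1_def T2_def trace_I algebra_simps power2_eq_square)
  qed
  show "(\<integral>X. ((fst (X, z) - \<Theta>) ** ip) \<bullet> (fst (X, z) ** U (X, z)) \<partial>NX)
    = (\<integral>X. (real CARD('m) - real CARD('p) - 1) * T1 (X, z) + T2 (X, z) + (T1 (X, z))\<^sup>2 \<partial>NX)"
    using stein_shrink1[OF S tS r0 \<Sigma>, of \<Theta> 0] unfolding div[symmetric] by (simp add: U')
qed

end


section \<open>Comparison of the risks\<close>

lemma det_scaleR_matrix: "det (c *\<^sub>R (A::real^'p^'p)) = c ^ CARD('p) * det A"
proof -
  have "det (c *\<^sub>R A) = det (diag (\<chi> i. c) ** A)"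
  proof -
    have "diag (\<chi> i. c) = c *\<^sub>R (mat 1 :: real^'p^'p)" by (auto simp: diag_def mat_def vec_eq_iff)
    then show ?thesis by (simp add: mmul.scaleR_left)
  qed
  then show ?thesis by (simp add: det_mul det_diag)
qed

lemma pos_def_scaleR: "pos_def A \<Longrightarrow> c > 0 \<Longrightarrow> pos_def (c *\<^sub>R A)"
  by (auto simp: pos_def_def transpose_linear scaleR_matrix_vector_assoc[symmetric])

lemma generalized_bayes_inverse_eq:
  assumes r: "r > 0" and S: "pos_def S"
  shows "matrix_inv (mat 1 + r *\<^sub>R (matrix_inv S ** transpose X ** X)) = shrinkage r S (gram X)"
proof (rule matrix_inv_eqI)
  obtain J L g where "coords r S (gram X) J L g"
    using coords_exist[OF r S pos_semidef_gram] by blast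
  then interpret coords r S "gram X" J L g .
  note Si = pos_def_matrix_inv[OF S]
  have "mat 1 + r *\<^sub>R (matrix_inv S ** transpose X ** X) = matrix_inv S ** (S + r *\<^sub>R gram X)"
    by (simp add: mat_linear Si gram_def matrix_mul_assoc)
  then have "(mat 1 + r *\<^sub>R (matrix_inv S ** transpose X ** X)) ** shrinkage r S (gram X)
     = matrix_inv S ** ((S + r *\<^sub>R gram X) ** ridge_inv r S (gram X)) ** S"
    by (simp add: shrinkage_def matrix_mul_assoc)
  then show "(mat 1 + r *\<^sub>R (matrix_inv S ** transpose X ** X)) ** shrinkage r S (gram X) = mat 1"
    by (simp add: B_inverse Si)
qed

definition kl_closed_form :: "real^'p^'m \<Rightarrow> real^'p^'p \<Rightarrow> real^'p^'m \<Rightarrow> real^'p^'p \<Rightarrow> real" where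
  "kl_closed_form \<Theta> \<Sigma> T V = real CARD('m) / 2 * (trace (matrix_inv \<Sigma> ** V) - ln (det V / det \<Sigma>) - real CARD('p))
       + (T - \<Theta>) \<bullet> ((T - \<Theta>) ** matrix_inv \<Sigma>) / 2"

lemma kl_closed_form_nonneg:
  assumes "pos_def \<Sigma>" "pos_def V"
  shows "0 \<le> kl_closed_form \<Theta> \<Sigma> T V"
proof -
  note P = pos_def_matrix_inv[OF assms(1)]
  have "0 \<le> (T - \<Theta>) \<bullet> ((T - \<Theta>) ** matrix_inv \<Sigma>)"
    unfolding inner_mult_right_rows[OF P(3)]
    by (intro sum_nonneg) (use pos_def_imp_semidef[OF P(4)] in \<open>simp add: pos_semidef_def\<close>)
  then show ?thesis
    unfolding kl_closed_form_def using KL_covariance_part_nonneg[OF assms] by simp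
qed

text \<open>
  The parameter \<open>d\<close> stands for \<open>a + m + 2 p - n\<close>; in terms of it the two conditions on \<open>a\<close> are the two inequalities
  assumed here.
\<close>

locale shrinkage_risk = wishart_model n \<Theta> \<Sigma> r
  for n :: nat and \<Theta> :: "real^'p^'m" and \<Sigma> :: "real^'p^'p" and r :: real +
  fixes d k :: real
  assumes d: "real CARD('p) - 1 < d"
    and hyp: "d * (real n + real CARD('m) / 2 + real CARD('p) + 1)
      \<le> 2 * real n * (real CARD('m) - real CARD('p) - 1) + 2 * real CARD('m)"
    and k: "k = d / (real n + d)" and rk: "r = 1 - k"
begin

lemma constants: "1 \<le> real n" "0 < d" "0 < k" "k < 1" "k / r = d / real n"
proof -
  have p: "1 \<le> real CARD('p)" by (simp add: Suc_leI)
  show n: "1 \<le> real n" using p pn by linarith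
  show d0: "0 < d" using d p by linarith
  show "0 < k" "k < 1" using n d0 by (auto simp: k)
  have "r = real n / (real n + d)" using n d0 by (simp add: rk k field_simps)
  then show "k / r = d / real n" using n d0 by (simp add: k)
qed

definition loss_std :: "real^'p^'m \<Rightarrow> real^'p^'p \<Rightarrow> real" where
  "loss_std X S = kl_closed_form \<Theta> \<Sigma> X ((1 / real n) *\<^sub>R S)"

definition loss_GB :: "real^'p^'m \<Rightarrow> real^'p^'p \<Rightarrow> real" where
  "loss_GB X S = kl_closed_form \<Theta> \<Sigma> (X - k *\<^sub>R (X ** shrinkage r S (gram X)))
     ((1 / real n) *\<^sub>R (S - k *\<^sub>R (S ** shrinkage r S (gram X))))"

lemma loss_measurable [measurable]:
  assumes [measurable]: "f \<in> borel_measurable M" "h \<in> borel_measurable M"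
  shows "(\<lambda>x. loss_std (f x) (h x)) \<in> borel_measurable M" "(\<lambda>x. loss_GB (f x) (h x)) \<in> borel_measurable M"
  unfolding loss_std_def loss_GB_def kl_closed_form_def shrinkage_def ridge_inv_def by measurable

text \<open>
  Two changes of the integral: from the Wishart distribution to the rows that define it, and from the loss to a
  measurable function that agrees with it for positive definite \<open>S\<close>, hence almost surely.
\<close>

lemma KL_risk_eq:
  assumes mL: "(\<lambda>w. L (fst w) (snd w)) \<in> borel_measurable (NX \<Otimes>\<^sub>M borel)"
    and eq: "\<And>X S. pos_def S \<Longrightarrow> KL_loss (\<delta> X S) \<Theta> \<Sigma> = L X S"
  shows "KL_risk n \<delta> \<Theta> \<Sigma> = (\<integral>\<^sup>+w. ennreal (L (fst w) (scatter (snd w))) \<partial>P)"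
proof -
  have wi: "wishart n \<Sigma> = distr Q borel scatter"
    by (simp add: wishart_def scatter_def[abs_def] gram_def)
  have mp [measurable]: "(\<lambda>(x, y). (x, scatter y)) \<in> P \<rightarrow>\<^sub>M NX \<Otimes>\<^sub>M borel" by measurable
  have "prob_space (distr Q borel scatter)" by (rule Q.prob_space_distr) measurable
  then have "sigma_finite_measure (distr Q borel scatter)" by (simp add: prob_space_imp_sigma_finite)
  then have pm: "NX \<Otimes>\<^sub>M wishart n \<Sigma> = distr P (NX \<Otimes>\<^sub>M borel) (\<lambda>(x, y). (x, scatter y))"
    unfolding wi using pair_measure_distr[of "\<lambda>x. x" NX NX scatter Q borel] by (simp add: distr_id)
  have [measurable]: "Measurable.pred (NX \<Otimes>\<^sub>M borel) (\<lambda>w. pos_def (snd w :: real^'p^'p))"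
    by (rule measurable_compose[OF measurable_snd pred_pos_def])
  have ev: "{w \<in> space (NX \<Otimes>\<^sub>M borel). pos_def (snd w :: real^'p^'p)} \<in> sets (NX \<Otimes>\<^sub>M borel)"
    by (rule predE) measurable
  have AE: "AE w in distr P (NX \<Otimes>\<^sub>M borel) (\<lambda>(x, y). (x, scatter y)). pos_def (snd w)"
    using AE_P_pos_def by (subst AE_distr_iff[OF mp ev]) (simp add: case_prod_beta')
  have "KL_risk n \<delta> \<Theta> \<Sigma> = (\<integral>\<^sup>+w. ennreal (KL_loss (\<delta> (fst w) (snd w)) \<Theta> \<Sigma>)
      \<partial>distr P (NX \<Otimes>\<^sub>M borel) (\<lambda>(x, y). (x, scatter y)))"
    unfolding KL_risk_def pm by (simp add: case_prod_beta')
  also have "\<dots> = (\<integral>\<^sup>+w. ennreal (L (fst w) (snd w)) \<partial>distr P (NX \<Otimes>\<^sub>M borel) (\<lambda>(x, y). (x, scatter y)))"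
    using AE by (intro nn_integral_cong_AE) (auto simp: eq)
  also have "\<dots> = (\<integral>\<^sup>+w. ennreal (L (fst w) (scatter (snd w))) \<partial>P)"
    using mL by (subst nn_integral_distr) (auto simp: case_prod_beta')
  finally show ?thesis .
qed

lemma pos_def_estimates:
  assumes S: "pos_def S"
  shows "pos_def ((1 / real n) *\<^sub>R S)" "pos_def ((1 / real n) *\<^sub>R (S - k *\<^sub>R (S ** shrinkage r S (gram X))))"
proof -
  have n: "1 / real n > 0" using constants(1) by simp
  then show "pos_def ((1 / real n) *\<^sub>R S)" by (rule pos_def_scaleR[OF S])
  obtain J L g where "coords r S (gram X) J L g"
    using coords_exist[OF r S pos_semidef_gram] by blast
  from coords.det_shrunk(2)[OF this constants(3,4)]
  show "pos_def ((1 / real n) *\<^sub>R (S - k *\<^sub>R (S ** shrinkage r S (gram X))))"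
    by (rule pos_def_scaleR[OF _ n])
qed

lemma KL_risk0: "KL_risk n (\<lambda>X S. (X, Sigma_hat_0 n S)) \<Theta> \<Sigma> = (\<integral>\<^sup>+w. ennreal (loss_std (fst w) (scatter (snd w))) \<partial>P)"
proof (rule KL_risk_eq)
  show "(\<lambda>w. loss_std (fst w) (snd w)) \<in> borel_measurable (NX \<Otimes>\<^sub>M borel)"
    using measurable_fst[of NX "borel :: (real^'p^'p) measure"]
    by (intro loss_measurable measurable_snd) (simp cong: measurable_cong_sets)
  show "KL_loss (X, Sigma_hat_0 n S) \<Theta> \<Sigma> = loss_std X S" if "pos_def S" for X S
    unfolding loss_std_def kl_closed_form_def Sigma_hat_0_def
    by (rule KL_loss_eq[OF \<Sigma> pos_def_estimates(1)[OF that]])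
qed

lemma KL_risk1:
  assumes ka: "k0 CARD('m) CARD('p) n a = k"
  shows "KL_risk n (\<lambda>X S. (Theta_hat_GB n a X S, Sigma_hat_GB n a X S)) \<Theta> \<Sigma>
     = (\<integral>\<^sup>+w. ennreal (loss_GB (fst w) (scatter (snd w))) \<partial>P)"
proof (rule KL_risk_eq)
  show "(\<lambda>w. loss_GB (fst w) (snd w)) \<in> borel_measurable (NX \<Otimes>\<^sub>M borel)"
    using measurable_fst[of NX "borel :: (real^'p^'p) measure"]
    by (intro loss_measurable measurable_snd) (simp cong: measurable_cong_sets)
  fix X :: "real^'p^'m" and S :: "real^'p^'p"
  assume S: "pos_def S"
  have inv: "matrix_inv (mat 1 + (1 - k) *\<^sub>R (matrix_inv S ** transpose X ** X)) = shrinkage r S (gram X)"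
    using generalized_bayes_inverse_eq[OF r S, of X] by (simp add: rk)
  have T: "Theta_hat_GB n a X S = X - k *\<^sub>R (X ** shrinkage r S (gram X))"
    by (simp add: Theta_hat_GB_def ka inv Let_def)
  have V: "Sigma_hat_GB n a X S = (1 / real n) *\<^sub>R (S - k *\<^sub>R (S ** shrinkage r S (gram X)))"
    by (simp add: Sigma_hat_GB_def Sigma_hat_0_def ka inv Let_def mmul.scaleR_left scaleR_diff_right mult.commute)
  show "KL_loss (Theta_hat_GB n a X S, Sigma_hat_GB n a X S) \<Theta> \<Sigma> = loss_GB X S"
    unfolding T V loss_GB_def kl_closed_form_def by (rule KL_loss_eq[OF \<Sigma> pos_def_estimates(2)[OF S]])
qed

definition log_det_ratio :: "(real^'p^'m) \<times> (nat \<Rightarrow> real^'p^1) \<Rightarrow> real" where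
  "log_det_ratio w = ln (det (scatter (snd w) - k *\<^sub>R (scatter (snd w) ** U w)) / det (scatter (snd w)))"

lemma log_det_ratio_measurable [measurable]: "log_det_ratio \<in> borel_measurable P"
  unfolding log_det_ratio_def by measurable

lemma log_det_ratio_eq:
  assumes co: "coords r (scatter (snd w)) (gram (fst w)) J L g"
  shows "log_det_ratio w = (\<Sum>i\<in>UNIV. ln (1 - k * g $ i))"
proof -
  interpret coords r "scatter (snd w)" "gram (fst w)" J L g by (rule co)
  have "log_det_ratio w = ln (\<Prod>i\<in>UNIV. 1 - k * g $ i)"
    using pos_def_matrix_inv(5)[OF S] by (simp add: log_det_ratio_def U_def det_shrunk(1))
  then show ?thesis
    using kg_less_1[OF constants(3,4)] by (simp add: ln_prod less_imp_neq[THEN not_sym])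
qed

lemma integrable_log_det_ratio: "integrable P log_det_ratio"
proof (rule integrable_bounded[where C="CARD('p) * (- ln (1 - k))"])
  fix w :: "(real^'p^'m) \<times> (nat \<Rightarrow> real^'p^1)" and J L g
  assume co: "coords r (scatter (snd w)) (gram (fst w)) J L g"
  interpret coords r "scatter (snd w)" "gram (fst w)" J L g by (rule co)
  have "\<bar>ln (1 - k * g $ i)\<bar> \<le> - ln (1 - k)" for i
  proof -
    have "k * g $ i \<le> k" "0 \<le> k * g $ i"
      using g(1)[of i] g(2)[of i] constants(3) by (auto simp: mult_left_le)
    then have le: "0 < 1 - k" "1 - k \<le> 1 - k * g $ i" "1 - k * g $ i \<le> 1"
      using constants(3,4) by auto
    then have "0 < 1 - k * g $ i" by linarith
    then have "ln (1 - k) \<le> ln (1 - k * g $ i)" "ln (1 - k * g $ i) \<le> 0"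
      using le by (simp_all add: ln_mono ln_le_zero_iff)
    then show ?thesis by simp
  qed
  then have "\<bar>\<Sum>i\<in>UNIV. ln (1 - k * g $ i)\<bar> \<le> (\<Sum>i\<in>(UNIV::'p set). - ln (1 - k))"
    by (intro order_trans[OF sum_abs sum_mono])
  then show "\<bar>log_det_ratio w\<bar> \<le> CARD('p) * (- ln (1 - k))" by (simp add: log_det_ratio_eq[OF co])
qed measurable

text \<open>
  The difference of the two losses (shown in \<open>loss_difference\<close>), and after it the function of the eigenvalues alone that has
  the same expectation.
\<close>

definition gain :: "(real^'p^'m) \<times> (nat \<Rightarrow> real^'p^1) \<Rightarrow> real" where
  "gain w = (k / (2 * real n)) * ((real CARD('m) - d) * trace (ip ** scatter (snd w) ** U w)
     + real CARD('m) * (real n / k * log_det_ratio w)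
     + 2 * real n * (((fst w - \<Theta>) ** ip) \<bullet> (fst w ** U w))
     + d * trace (ip ** scatter (snd w) ** (U w ** U w)))"

definition gain_estimate :: "(real^'p^'m) \<times> (nat \<Rightarrow> real^'p^1) \<Rightarrow> real" where
  "gain_estimate w = (k / (2 * real n)) * ((real CARD('m) - d) * ((real n + real CARD('p) + 1) * T1 w - T2 w - (T1 w)\<^sup>2)
     + real CARD('m) * (real n / k * log_det_ratio w)
     + 2 * real n * ((real CARD('m) - real CARD('p) - 1) * T1 w + T2 w + (T1 w)\<^sup>2)
     + d * ((real n + real CARD('p) + 2) * T2 w + (T1 w)\<^sup>2 - 2 * T3 w - 2 * (T1 w * T2 w)))"

lemma integrable_gain: "integrable P gain"
  unfolding gain_def[abs_def]
  by (intro integrable_mult_right Bochner_Integration.integrable_add expectation_scatter_U(1)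
      expectation_scatter_U2(1) integrable_X_field integrable_log_det_ratio)

lemma integrable_T_forms:
  "integrable P (\<lambda>w. (real n + real CARD('p) + 1) * T1 w - T2 w - (T1 w)\<^sup>2)"
  "integrable P (\<lambda>w. (real CARD('m) - real CARD('p) - 1) * T1 w + T2 w + (T1 w)\<^sup>2)"
  "integrable P (\<lambda>w. (real n + real CARD('p) + 2) * T2 w + (T1 w)\<^sup>2 - 2 * T3 w - 2 * (T1 w * T2 w))"
  by (intro Bochner_Integration.integrable_add Bochner_Integration.integrable_diff integrable_mult_right integrable_T)+

lemma integrable_gain_estimate: "integrable P gain_estimate"
  unfolding gain_estimate_def[abs_def]
  by (intro integrable_mult_right Bochner_Integration.integrable_add integrable_T_forms integrable_log_det_ratio)

lemma integral_gain: "integral\<^sup>L P gain = integral\<^sup>L P gain_estimate"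
  unfolding gain_def[abs_def] gain_estimate_def[abs_def]
  using expectation_scatter_U expectation_scatter_U2 expectation_X integrable_X_field integrable_log_det_ratio
    integrable_T_forms
  by simp

lemma gain_estimate_pos:
  assumes co: "coords r (scatter (snd w)) (gram (fst w)) J L g"
  shows "0 < gain_estimate w"
proof -
  interpret coords r "scatter (snd w)" "gram (fst w)" J L g by (rule co)
  have T: "T1 w = (\<Sum>i\<in>UNIV. g $ i)" "T2 w = (\<Sum>i\<in>UNIV. (g $ i)\<^sup>2)" "T3 w = (\<Sum>i\<in>UNIV. (g $ i) ^ 3)"
    using trace_U by (simp_all add: T1_def T2_def T3_def U_def)
  have "gain_estimate w = (k / (2 * real n)) * (real CARD('m) * ((real n + real CARD('p) + 1) * T1 w - T2 w - (T1 w)\<^sup>2)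
     + real CARD('m) * (real n / k * log_det_ratio w)
     + 2 * real n * ((real CARD('m) - real CARD('p) - 1) * T1 w + T2 w + (T1 w)\<^sup>2)
     + d * (- (real n + real CARD('p) + 1) * T1 w + (real n + real CARD('p) + 3) * T2 w + 2 * (T1 w)\<^sup>2 - 2 * T3 w - 2 * (T1 w * T2 w)))"
    unfolding gain_estimate_def by (intro arg_cong[where f="\<lambda>x. (k / (2 * real n)) * x"]) (simp add: algebra_simps)
  also have "\<dots> > 0"
    unfolding T log_det_ratio_eq[OF co]
    using constants by (intro mult_pos_pos risk_difference_pos[OF pn pm d hyp k] g) auto
  finally show ?thesis .
qed

text \<open>
  The only term that is not directly one of the four in \<open>gain\<close> is \<open>tr (X U \<Sigma>\<^sup>-\<^sup>1 U\<^sup>T X\<^sup>T)\<close>.  Since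
  \<open>U\<^sup>T = S B\<close> and \<open>r W U = S - S U\<close>, it equals \<open>(tr (\<Sigma>\<^sup>-\<^sup>1 S U) - tr (\<Sigma>\<^sup>-\<^sup>1 S U\<^sup>2)) / r\<close>.
\<close>

lemma loss_difference:
  assumes co: "coords r (scatter (snd w)) (gram (fst w)) J L g"
  shows "loss_std (fst w) (scatter (snd w)) - loss_GB (fst w) (scatter (snd w)) = gain w"
proof -
  interpret coords r "scatter (snd w)" "gram (fst w)" J L g by (rule co)
  let ?S = "scatter (snd w)" and ?X = "fst w"
  let ?V0 = "(1 / real n) *\<^sub>R ?S" and ?V1 = "(1 / real n) *\<^sub>R (?S - k *\<^sub>R (?S ** U w))"
  note ipP = pos_def_matrix_inv[OF \<Sigma>]
  have U': "shrinkage r ?S (gram ?X) = U w" by (simp add: U_def)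
  have l1: "loss_GB ?X ?S = kl_closed_form \<Theta> \<Sigma> (?X - k *\<^sub>R (?X ** U w)) ?V1" by (simp add: loss_GB_def U')
  have pd1: "pos_def ?V1" using pos_def_estimates(2)[OF S, of ?X] by (simp add: U')
  have pd0: "pos_def ?V0" by (rule pos_def_estimates(1)[OF S])
  have d0: "det ?V0 > 0" "det ?V1 > 0" "det \<Sigma> > 0" "det ?S > 0"
    using pos_def_matrix_inv(5) pd0 pd1 \<Sigma> S by blast+
\<comment> \<open>the factor \<open>1 / n\<close> cancels in the quotient of the determinants of the two estimates\<close>
  have lnd: "ln (det ?V1 / det \<Sigma>) = ln (det ?V0 / det \<Sigma>) + log_det_ratio w"
  proof -
    have "det ?V1 / det \<Sigma> = (det ?V0 / det \<Sigma>) * (det (?S - k *\<^sub>R (?S ** U w)) / det ?S)"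
      using d0(4) constants(1) by (simp add: det_scaleR_matrix)
    moreover have "det (?S - k *\<^sub>R (?S ** U w)) / det ?S > 0"
      using d0 constants(1) by (simp add: det_scaleR_matrix zero_less_mult_iff zero_less_divide_iff)
    ultimately show ?thesis using d0 ln_mult[of "det ?V0 / det \<Sigma>" "det (?S - k *\<^sub>R (?S ** U w)) / det ?S"]
      by (simp only: log_det_ratio_def) auto
  qed
  have tr1: "trace (ip ** ?V1) = trace (ip ** ?V0) - k / real n * trace (ip ** ?S ** U w)"
    by (simp add: mat_linear matrix_mul_assoc right_diff_distrib)
  let ?C = "?X - \<Theta>" and ?Y = "?X ** U w"
  have q1: "(?X - k *\<^sub>R ?Y - \<Theta>) \<bullet> ((?X - k *\<^sub>R ?Y - \<Theta>) ** ip)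
     = ?C \<bullet> (?C ** ip) - 2 * k * ((?C ** ip) \<bullet> ?Y) + k\<^sup>2 * (?Y \<bullet> (?Y ** ip))"
  proof -
    define C Y where "C = ?C" and "Y = ?Y"
    have e: "?X - k *\<^sub>R ?Y - \<Theta> = C + (- k) *\<^sub>R Y" by (simp add: C_def Y_def)
    have c: "C \<bullet> (Y ** ip) = (C ** ip) \<bullet> Y"
      using inner_mult_left[of C ip Y] ipP(3) by simp
    have "(?X - k *\<^sub>R ?Y - \<Theta>) \<bullet> ((?X - k *\<^sub>R ?Y - \<Theta>) ** ip)
      = C \<bullet> (C ** ip) + 2 * (C \<bullet> (((- k) *\<^sub>R Y) ** ip)) + ((- k) *\<^sub>R Y) \<bullet> (((- k) *\<^sub>R Y) ** ip)"
      unfolding e by (rule quadratic_form_add[OF ipP(3)])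
    also have "\<dots> = C \<bullet> (C ** ip) - 2 * k * ((C ** ip) \<bullet> Y) + k\<^sup>2 * (Y \<bullet> (Y ** ip))"
      by (simp add: mmul.scaleR_left mmul.minus_left power2_eq_square c)
    finally show ?thesis unfolding C_def Y_def .
  qed
  have q2: "r * (?Y \<bullet> (?Y ** ip)) = trace (ip ** ?S ** U w) - trace (ip ** ?S ** (U w ** U w))"
  proof -
    have UtW: "r *\<^sub>R (gram ?X ** U w) = ?S - ?S ** U w"
    proof -
      have "(?S + r *\<^sub>R gram ?X) ** U w = ?S"
        using B_inverse(2) by (simp add: U_def shrinkage_def matrix_mul_assoc)
      then show ?thesis by (simp add: mmul.add_left mmul.scaleR_left algebra_simps)
    qed
    have tU: "transpose (U w) = ?S ** B w"
      using pos_def_matrix_inv(3)[OF pos_def_M] pos_def_sym[OF S]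
      by (simp add: BU matrix_transpose_mul) (simp add: B_def ridge_inv_def)
    have "?Y \<bullet> (?Y ** ip) = (?Y ** ip) \<bullet> ?Y" by (rule inner_commute)
    also have "\<dots> = trace (ip ** transpose (U w) ** gram ?X ** U w)"
      using ipP(3) by (simp add: inner_eq_trace matrix_transpose_mul gram_def matrix_mul_assoc)
    finally have "r * (?Y \<bullet> (?Y ** ip)) = trace (ip ** ?S ** B w ** (r *\<^sub>R (gram ?X ** U w)))"
      by (simp add: tU mmul.scaleR_right trace_linear matrix_mul_assoc)
    also have "\<dots> = trace (ip ** ?S ** U w) - trace (ip ** ?S ** (U w ** U w))"
      unfolding UtW by (simp add: mmul.diff_right trace_linear BU matrix_mul_assoc)
    finally show ?thesis .
  qed
  define A1 A2 A4 qY where "A1 = trace (ip ** ?S ** U w)" and "A2 = (?C ** ip) \<bullet> ?Y"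
    and "A4 = trace (ip ** ?S ** (U w ** U w))" and "qY = ?Y \<bullet> (?Y ** ip)"
  have "loss_std ?X ?S - loss_GB ?X ?S = real CARD('m) / 2 * (k / real n * A1 + log_det_ratio w) + k * A2 - k\<^sup>2 / 2 * qY"
    unfolding loss_std_def l1 kl_closed_form_def tr1 lnd q1 A1_def[symmetric] A2_def[symmetric] qY_def[symmetric]
    by (simp add: field_simps)
  also have "k\<^sup>2 / 2 * qY = k / 2 * (k / r) * (r * qY)"
    using r by (simp add: power2_eq_square)
  also have "r * qY = A1 - A4" using q2 by (simp add: A1_def A4_def qY_def)
  also have "real CARD('m) / 2 * (k / real n * A1 + log_det_ratio w) + k * A2 - k / 2 * (k / r) * (A1 - A4) = gain w"
    unfolding gain_def A1_def[symmetric] A2_def[symmetric] A4_def[symmetric] constants(5)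
    using constants by (simp add: field_simps)
  finally show ?thesis .
qed

lemma losses_nonneg:
  assumes "pos_def (scatter (snd w))"
  shows "0 \<le> loss_std (fst w) (scatter (snd w))" "0 \<le> loss_GB (fst w) (scatter (snd w))"
  unfolding loss_std_def loss_GB_def
  by (intro kl_closed_form_nonneg \<Sigma> pos_def_estimates assms)+

text \<open>
  The losses are nonnegative and differ almost surely by the integrable function \<open>gain\<close>, whose expectation is
  positive.  Only when the larger risk is finite can it be subtracted.
\<close>

lemma risk_comparison:
  defines "R0 \<equiv> \<integral>\<^sup>+w. ennreal (loss_std (fst w) (scatter (snd w))) \<partial>P"
    and "R1 \<equiv> \<integral>\<^sup>+w. ennreal (loss_GB (fst w) (scatter (snd w))) \<partial>P"
  shows "R1 \<le> R0" "R0 < \<infinity> \<Longrightarrow> R1 < R0"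
proof -
  let ?f0 = "\<lambda>w. loss_std (fst w) (scatter (snd w))" and ?f1 = "\<lambda>w. loss_GB (fst w) (scatter (snd w))"
  have m0: "?f0 \<in> borel_measurable P" and m1: "?f1 \<in> borel_measurable P"
    by (intro loss_measurable; measurable)+
  have nn0: "AE w in P. 0 \<le> ?f0 w" and nn1: "AE w in P. 0 \<le> ?f1 w"
    using AE_P_pos_def by (eventually_elim, simp add: losses_nonneg)+
  have pos: "0 < integral\<^sup>L P gain"
  proof -
    have "AE w in P. 0 < gain_estimate w" by (rule AE_coords) (rule gain_estimate_pos)
    then have "(\<integral>w. 0 \<partial>P) < integral\<^sup>L P gain_estimate"
      by (intro P.integral_less_AE_space integrable_gain_estimate) (auto simp: P.emeasure_space_1)
    then show ?thesis by (simp add: integral_gain)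
  qed
  have diff: "AE w in P. ?f1 w = ?f0 w - gain w"
    by (rule AE_coords) (use loss_difference in fastforce)
  show lt: "R1 < R0" if fin: "R0 < \<infinity>"
  proof -
    have i0: "integrable P ?f0"
      using m0 nn0 fin unfolding R0_def by (rule integrableI_nonneg)
    then have "integrable P (\<lambda>w. ?f0 w - gain w)" using integrable_gain by simp
    then have i1: "integrable P ?f1"
      using diff m1 by (subst integrable_cong_AE[where g="\<lambda>w. ?f0 w - gain w"]) (auto intro: borel_measurable_integrable)
    have "integral\<^sup>L P ?f1 = (\<integral>w. ?f0 w - gain w \<partial>P)"
      using diff m1 i0 integrable_gain by (intro integral_cong_AE) auto
    also have "\<dots> = integral\<^sup>L P ?f0 - integral\<^sup>L P gain" using i0 integrable_gain by simp
    finally have "integral\<^sup>L P ?f1 < integral\<^sup>L P ?f0" using pos by simp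
    moreover have "0 \<le> integral\<^sup>L P ?f1" using nn1 by (rule integral_nonneg_AE)
    moreover have "R0 = ennreal (integral\<^sup>L P ?f0)" unfolding R0_def by (rule nn_integral_eq_integral[OF i0 nn0])
    moreover have "R1 = ennreal (integral\<^sup>L P ?f1)" unfolding R1_def by (rule nn_integral_eq_integral[OF i1 nn1])
    ultimately show ?thesis by (simp add: ennreal_lessI)
  qed
  show "R1 \<le> R0"
  proof (cases "R0 < \<infinity>")
    case True then show ?thesis using lt by simp
  next
    case False
    then have "R0 = top" by (metis less_top infinity_ennreal_def)
    then show ?thesis by simp
  qed
qed

text \<open>
  Up to an integrable summand the loss is \<open>- m / 2\<close> times \<open>ln det S\<close>.
\<close>

lemma risk0_finite: "(\<integral>\<^sup>+w. ennreal (loss_std (fst w) (scatter (snd w))) \<partial>P) < \<infinity>"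
proof -
  let ?m = "real CARD('m)"
  define h where "h = (\<lambda>w. ?m / 2 * (trace (ip ** scatter (snd w) ** mat 1) / real n + real CARD('p) * ln (real n)
      + ln (det \<Sigma>) - real CARD('p)) + (fst w - \<Theta>) \<bullet> ((fst w - \<Theta>) ** ip) / 2)"
  have "integrable P (\<lambda>w. trace (ip ** scatter (snd w) ** mat 1))"
    unfolding trace_scatter_U
  proof (intro Bochner_Integration.integrable_sum)
    fix i assume "i \<in> {..<n}"
    then have i: "i < n" by simp
    show "integrable P (\<lambda>w. (snd w i ** ip) \<bullet> (snd w i ** mat 1))"
    proof (rule integrable_inner_field[where c=1])
      show "norm (snd w i ** mat 1) \<le> 1 * sqrt (trace (scatter (snd w)))" for w
        using i member_le_sum[of i "{..<n}" "\<lambda>i. (norm (snd w i))\<^sup>2"]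
        by (simp add: trace_scatter real_le_rsqrt)
    qed (use i in \<open>auto intro: integrable_row\<close>)
  qed
  moreover have "integrable P (\<lambda>w. (fst w - \<Theta>) \<bullet> ((fst w - \<Theta>) ** ip))"
    by (rule integrable_P_fst, intro integrable_matrix_normal_poly_growth \<Sigma> poly_growth_inner poly_growth_matrix_mult
        poly_growth_diff poly_growth_ident poly_growth_const continuous_intros mmul.continuous_on)
  ultimately have h: "integrable P h" unfolding h_def by (intro Bochner_Integration.integrable_add
      Bochner_Integration.integrable_diff integrable_mult_right integrable_divide_zero) auto
  have le: "AE w in P. ennreal (loss_std (fst w) (scatter (snd w)))
      \<le> ennreal (norm (h w)) + ennreal (?m / 2) * ennreal (- ln (det (scatter (snd w))))"
    using AE_P_pos_def
  proof eventually_elim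
    case (elim w)
    have ds: "det (scatter (snd w)) > 0" "det \<Sigma> > 0" using pos_def_matrix_inv(5) elim \<Sigma> by blast+
    have "ln (det ((1 / real n) *\<^sub>R scatter (snd w)) / det \<Sigma>) = ln (det (scatter (snd w))) - real CARD('p) * ln (real n) - ln (det \<Sigma>)"
      using ds constants(1) by (simp add: det_scaleR_matrix ln_div ln_mult ln_realpow power_one_over)
    note lneq = this
    have "loss_std (fst w) (scatter (snd w)) = h w + ?m / 2 * (- ln (det (scatter (snd w))))"
      unfolding loss_std_def kl_closed_form_def h_def lneq by (simp add: mat_linear field_simps)
    also have "ennreal \<dots> \<le> ennreal (norm (h w) + ?m / 2 * max 0 (- ln (det (scatter (snd w)))))"
      by (intro ennreal_leI add_mono mult_left_mono) auto
    also have "\<dots> = ennreal (norm (h w)) + ennreal (?m / 2) * ennreal (max 0 (- ln (det (scatter (snd w)))))"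
    proof -
      have "ennreal (u + v * x) = ennreal u + ennreal v * ennreal x" if "0 \<le> u" "0 \<le> v" "0 \<le> x" for u v x
        using that by (simp add: ennreal_mult)
      note split = this
      show ?thesis by (rule split) simp_all
    qed
    also have "ennreal (max 0 (- ln (det (scatter (snd w))))) = ennreal (- ln (det (scatter (snd w))))"
      by (simp add: max_def ennreal_neg)
    finally show ?case .
  qed
  have m: "(\<lambda>w. ennreal (- ln (det (scatter (snd w))))) \<in> borel_measurable P" by measurable
  have "(\<integral>\<^sup>+w. ennreal (loss_std (fst w) (scatter (snd w))) \<partial>P)
     \<le> (\<integral>\<^sup>+w. ennreal (norm (h w)) + ennreal (?m / 2) * ennreal (- ln (det (scatter (snd w)))) \<partial>P)"
    by (rule nn_integral_mono_AE[OF le])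
  also have "\<dots> = (\<integral>\<^sup>+w. ennreal (norm (h w)) \<partial>P) + ennreal (?m / 2) * (\<integral>\<^sup>+w. ennreal (- ln (det (scatter (snd w)))) \<partial>P)"
    using h m by (subst nn_integral_add) (auto simp: nn_integral_cmult)
  also have "\<dots> < \<infinity>"
  proof -
    have "(\<integral>\<^sup>+w. ennreal (- ln (det (scatter (snd w)))) \<partial>P) = (\<integral>\<^sup>+z. ennreal (- ln (det (scatter z))) \<partial>Q)"
      using P.nn_integral_snd[OF m] by (simp add: NX.emeasure_space_1[simplified])
    then show ?thesis
      using nn_integral_neg_ln_det_scatter h by (simp add: integrable_iff_bounded ennreal_mult_less_top)
  qed
  finally show ?thesis .
qed

end

theorem corollary4p4:
  fixes m p n :: nat
  assumes m: "m = CARD('m::finite)" and p: "p = CARD('p::finite)"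
    and "p \<le> n" and "p \<le> m"
  shows "(\<forall>a::real. real n - real m - real p - 1 < a \<and> a \<le> a_upp m p n \<longrightarrow>
            KL_dominates n
              (\<lambda>(X :: real ^ 'p ^ 'm) S. (Theta_hat_GB n a X S, Sigma_hat_GB n a X S))
              (\<lambda>X S. (X, Sigma_hat_0 n S)))
       \<and> (real m > (3 * real p + 1) / 2 \<and>
          real n > (2 * real p ^ 2 + real m * real p - 5 * real m - 1)
                   / (2 * (2 * real m - 3 * real p - 1)) \<longrightarrow>
          (\<exists>a::real. real n - real m - real p - 1 < a \<and> a \<le> a_upp m p n))"
proof (intro conjI allI impI)
  fix a :: real
  assume a: "real n - real m - real p - 1 < a \<and> a \<le> a_upp m p n"
  have p1: "1 \<le> p" using p by (simp add: Suc_leI)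
  then have n1: "1 \<le> real n" using assms(3) by simp
  define d where "d = a + real m + 2 * real p - real n"
  define k where "k = d / (real n + d)"
  have d1: "real p - 1 < d" using a by (simp add: d_def)
  then have d0: "0 < d" using p1 by simp
\<comment> \<open>the bound \<open>a \<le> a_upp\<close>, cleared of denominators\<close>
  have hyp: "d * (real n + real m / 2 + real p + 1) \<le> 2 * real n * (real m - real p - 1) + 2 * real m"
  proof -
    let ?D = "real n + real m / 2 + real p + 1"
    have D: "?D > 0" by simp
    have "d \<le> real n * (2 * ((real m - real p - 1 + real m / real n) / ?D))"
      using a by (simp add: d_def a_upp_def algebra_simps)
    then have "d * ?D \<le> real n * (2 * ((real m - real p - 1 + real m / real n) / ?D)) * ?D"
      using D by (intro mult_right_mono) auto
    also have "\<dots> = 2 * real n * (real m - real p - 1 + real m / real n)" using D by simp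
    also have "\<dots> = 2 * real n * (real m - real p - 1) + 2 * real m" using n1 by (simp add: algebra_simps)
    finally show ?thesis .
  qed
  have ka: "k0 CARD('m) CARD('p) n a = k" by (simp add: k0_def k_def d_def m p)
  have loc: "shrinkage_risk TYPE('m) n \<Sigma> (1 - k) d k" if "pos_def \<Sigma>" for \<Sigma> :: "real^'p^'p"
    using that n1 d0 d1 hyp assms by unfold_locales (auto simp: k_def field_simps)
  note risk = shrinkage_risk.risk_comparison[OF loc] shrinkage_risk.KL_risk0[OF loc]
    shrinkage_risk.KL_risk1[OF loc ka] shrinkage_risk.risk0_finite[OF loc]
  have "pos_def (mat 1 :: real^'p^'p)" by (simp add: pos_def_def)
  then show "KL_dominates n
              (\<lambda>(X :: real ^ 'p ^ 'm) S. (Theta_hat_GB n a X S, Sigma_hat_GB n a X S))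
              (\<lambda>X S. (X, Sigma_hat_0 n S))"
    unfolding KL_dominates_def
  proof (intro conjI allI impI exI[of _ "0 :: real^'p^'m"] exI[of _ "mat 1 :: real^'p^'p"])
    fix \<Theta> :: "real^'p^'m" and \<Sigma> :: "real^'p^'p"
    assume "pos_def \<Sigma>"
    from risk(1,3,4)[OF this] show "KL_risk n (\<lambda>X S. (Theta_hat_GB n a X S, Sigma_hat_GB n a X S)) \<Theta> \<Sigma>
        \<le> KL_risk n (\<lambda>X S. (X, Sigma_hat_0 n S)) \<Theta> \<Sigma>" by simp
  next
    assume I: "pos_def (mat 1 :: real^'p^'p)"
    from risk(2)[OF I risk(5)[OF I]] risk(3,4)[OF I]
    show "KL_risk n (\<lambda>X S. (Theta_hat_GB n a X S, Sigma_hat_GB n a X S)) (0 :: real^'p^'m) (mat 1)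
        < KL_risk n (\<lambda>X S. (X, Sigma_hat_0 n S)) (0 :: real^'p^'m) (mat 1)" by simp
  qed
next
  assume h: "real m > (3 * real p + 1) / 2 \<and>
          real n > (2 * real p ^ 2 + real m * real p - 5 * real m - 1)
                   / (2 * (2 * real m - 3 * real p - 1))"
  have "1 \<le> p" using p by (simp add: Suc_leI)
  then have n1: "1 \<le> real n" using assms(3) by simp
  let ?D = "real n + real m / 2 + real p + 1"
  have "2 * real m - 3 * real p - 1 > 0" using h by simp
  then have "2 * real p ^ 2 + real m * real p - 5 * real m - 1 < real n * (2 * (2 * real m - 3 * real p - 1))"
    using h by (simp add: pos_divide_less_eq)
\<comment> \<open>that the interval of admissible \<open>a\<close> is nonempty means \<open>p - 1 < d\<close> for the largest admissible \<open>d\<close>\<close>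
  then have "(real p - 1) * (2 * real n + real m + 2 * real p + 2)
      < 2 * (2 * real n * (real m - real p - 1) + 2 * real m)"
    by (simp add: algebra_simps power2_eq_square)
  moreover have "2 * ((real p - 1) * ?D) = (real p - 1) * (2 * real n + real m + 2 * real p + 2)"
    by (simp add: field_simps)
  ultimately have "2 * ((real p - 1) * ?D) < 2 * (2 * real n * (real m - real p - 1) + 2 * real m)" by (simp only:)
  then have "(real p - 1) * ?D < 2 * real n * (real m - real p - 1) + 2 * real m" by simp
  also have "\<dots> = 2 * real n * (real m - real p - 1 + real m / real n)" using n1 by (simp add: algebra_simps)
  finally have "real p - 1 < 2 * real n * (real m - real p - 1 + real m / real n) / ?D"
    by (subst pos_less_divide_eq) auto
  then have "real n - real m - real p - 1 < a_upp m p n" by (simp add: a_upp_def algebra_simps)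
  then show "\<exists>a::real. real n - real m - real p - 1 < a \<and> a \<le> a_upp m p n" by blast
qed

end
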